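(* Suppose that $\mathcal A$ is a unital Noetherian $\mathcal Z$-domain. (1) For all $\lambda\in X$ there exists an up to isomorphism unique object $S_{\min}(\lambda)$ in $\mathcal X$ with the following properties: (a) $S_{\min}(\lambda)_\lambda$ is free of rank $1$, and $S_{\min}(\lambda)_\mu\neq\{0\}$ implies $\mu\le\lambda$; (b) $S_{\min}(\lambda)$ is indecomposable and minimal. Moreover, the objects $S_{\min}(\lambda)$ characterized in (1) have the following properties. (2) For all $\lambda\in X$ we have $\operatorname{End}_{\mathcal X}(S_{\min}(\lambda))=\mathcal A\cdot\mathrm{id}$, and $\operatorname{Hom}_{\mathcal X}(S_{\min}(\lambda),S_{\min}(\mu))=0$ for $\lambda\ne\mu$. (3) Let $S$ be a minimal object in $\mathcal X$. Then there is an index set $J$ and elements $\lambda_i\in X$ for $i\in J$ such that $S\cong\bigoplus_{i\in J}S_{\min}(\lambda_i)$.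
   Context: Ground data. $\mathcal Z:=\mathbb Z[v,v^{-1}]$; for $n\in\mathbb Z$, $d>0$: $[n]_d:=\frac{v^{dn}-v^{-dn}}{v^d-v^{-d}}\in\mathcal Z$, $\left[{n\atop 0}\right]_d:=1$, $\left[{n\atop r}\right]_d:=\frac{[n]_d[n-1]_d\cdots[n-r+1]_d}{[1]_d\cdots[r]_d}\in\mathcal Z$ for $r\ge1$. $\mathcal A$ is a (commutative) unital $\mathcal Z$-algebra that is a Noetherian domain. $R$ is a finite (reduced, crystallographic) root system in a real vector space $V$ with simple roots $\Pi$, coroots $\alpha^\vee$, weight lattice $X=\{\lambda\in V\mid\langle\lambda,\alpha^\vee\rangle\in\mathbb Z\ \forall\alpha\in R\}$; $\mu\le\lambda$ iff $\lambda-\mu$ is a sum of elements of $\Pi$. $(d_\alpha)_{\alpha\in\Pi}$ has entries in $\{1,2,3\}$, $(d_\alpha\langle\beta,\alpha^\vee\rangle)_{\alpha,\beta\in\Pi}$ is symmetric, and each irreducible component of $R$ contains a simple root $\alpha$ with $d_\alpha=1$. A subset $S\subset X$ is quasi-bounded if for every $\mu\in X$ the set $\{\lambda\in S\mid\mu\le\lambda\}$ is finite. The category $\mathcal X=\mathcal X_{\mathcal A}$. Objects are $X$-graded $\mathcal A$-modules $M=\bigoplus_{\mu\in X}M_\mu$ with $\mathcal A$-linear maps $E_{\mu,\alpha,n}\colon M_\mu\to M_{\mu+n\alpha}$, $F_{\mu,\alpha,n}\colon M_{\mu+n\alpha}\to M_\mu$ ($\mu\in X,\alpha\in\Pi,n>0$;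 the index $\mu$ is often dropped; $E_{\alpha,0}=F_{\alpha,0}=\mathrm{id}$) satisfying (a weight of $M$ is a $\mu$ with $M_\mu\ne0$): (X1) The set of weights is quasi-bounded and each $M_\mu$ is a finitely generated $\mathcal A$-module. (X2) For $\mu\in X$, $\alpha,\beta\in\Pi$, $m,n>0$, $x\in M_{\mu+n\beta}$: $E_{\alpha,m}F_{\beta,n}(x)=F_{\beta,n}E_{\alpha,m}(x)$ if $\alpha\neq\beta$, and $E_{\alpha,m}F_{\alpha,n}(x)=\sum_{r=0}^{\min(m,n)}\left[{\langle\mu,\alpha^\vee\rangle+m+n\atop r}\right]_{d_\alpha}F_{\alpha,n-r}E_{\alpha,m-r}(x)$ if $\alpha=\beta$. (X3) With $M_{\delta\mu}:=\bigoplus_{\alpha\in\Pi,n>0}M_{\mu+n\alpha}$, $E_\mu\colon M_\mu\to M_{\delta\mu}$ the column vector with entries $E_{\mu,\alpha,n}$, $F_\mu\colon M_{\delta\mu}\to M_\mu$ the row vector with entries $F_{\mu,\alpha,n}$, $M_{\{\mu\}}:=E_\mu(\operatorname{im}F_\mu)$, $M_{\langle\mu\rangle}:=E_\mu(M_\mu)$, for all $\mu$: (a) $E_\mu|_{\operatorname{im}F_\mu}$ is injective; (b) $M_{\langle\mu\rangle}/M_{\{\mu\}}$ is a torsion $\mathcal A$-module; (c) $M_\mu/\operatorname{im}F_\mu$ is a free $\mathcal A$-module. Morphisms are degree-preserving $\mathcal A$-linear maps commuting with all $E$- and $F$-maps. An object $M$ is minimal if $M_{\{\mu\}}=M_{\langle\mu\rangle}$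 for all $\mu\in X$. *)

theory Defs
  imports Complex_Main "HOL-Library.Function_Algebras" "HOL-Library.Poly_Mapping"
begin

section \<open>Quantum integers\<close>

text \<open>The ring of Laurent polynomials \<open>\<int>[v, v\<^sup>-\<^sup>1]\<close> is the group ring of the additive group of integers
  over the integers; \<open>vpow k\<close> is the monomial \<open>v\<^sup>k\<close>.\<close>

type_synonym laurent = "int \<Rightarrow>\<^sub>0 int"

definition vpow :: "int \<Rightarrow> laurent" where
  "vpow k = Poly_Mapping.single k 1"

text \<open>The fraction \<open>a / b\<close>, for \<open>b\<close> nonzero and dividing \<open>a\<close> in the domain of Laurent polynomials.
  That this is the case for the fractions below is shown in \<open>qint_eq\<close> and \<open>qbinom_eq\<close>.\<close>

definition laurent_quot :: "laurent \<Rightarrow> laurent \<Rightarrow> laurent" where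
  "laurent_quot a b = (THE x. x * b = a)"

definition qint :: "nat \<Rightarrow> int \<Rightarrow> laurent" where
  "qint d n = laurent_quot (vpow (int d * n) - vpow (- (int d * n))) (vpow (int d) - vpow (- int d))"

definition qbinom :: "nat \<Rightarrow> int \<Rightarrow> nat \<Rightarrow> laurent" where
  "qbinom d n r = laurent_quot (\<Prod>i<r. qint d (n - int i)) (\<Prod>i=1..r. qint d (int i))"

lemma laurent_quot_unique:
  assumes "b \<noteq> 0" and "x * b = a"
  shows "laurent_quot a b = x"
  unfolding laurent_quot_def using assms by (intro the_equality) auto

lemma vpow_add: "vpow (a + b) = vpow a * vpow b"
  by (simp add: vpow_def mult_single)

lemma vpow_0 [simp]: "vpow 0 = 1"
  by (simp add: vpow_def)

lemma vpow_diff_neq_0: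
  assumes "k > 0"
  shows "vpow k - vpow (- k) \<noteq> 0"
proof
  assume "vpow k - vpow (- k) = 0"
  then have "Poly_Mapping.lookup (vpow k) k = Poly_Mapping.lookup (vpow (- k)) k" by simp
  then show False using assms by (simp add: vpow_def lookup_single when_def)
qed

lemma qint_dvd: "vpow (int d) - vpow (- int d) dvd vpow (int d * n) - vpow (- (int d * n))"
proof (induction n rule: int_induct[where k = 0])
  case base
  then show ?case by simp
next
  case (step1 i)
  have "vpow (int d * (i + 1)) - vpow (- (int d * (i + 1)))
      = vpow (int d) * (vpow (int d * i) - vpow (- (int d * i)))
        + vpow (- (int d * i)) * (vpow (int d) - vpow (- int d))"
    by (simp add: algebra_simps flip: vpow_add)
  with step1 show ?case by simp
next
  case (step2 i)
  have "vpow (int d * (i - 1)) - vpow (- (int d * (i - 1)))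
      = vpow (- int d) * (vpow (int d * i) - vpow (- (int d * i)))
        - vpow (- (int d * i)) * (vpow (int d) - vpow (- int d))"
    by (simp add: algebra_simps flip: vpow_add)
  with step2 show ?case by simp
qed

lemma qint_eq:
  assumes "d > 0"
  shows "qint d n * (vpow (int d) - vpow (- int d)) = vpow (int d * n) - vpow (- (int d * n))"
proof -
  obtain x where "vpow (int d * n) - vpow (- (int d * n)) = (vpow (int d) - vpow (- int d)) * x"
    using qint_dvd by (metis dvdE)
  moreover have "vpow (int d) - vpow (- int d) \<noteq> 0"
    using assms by (intro vpow_diff_neq_0) simp
  ultimately show ?thesis
    unfolding qint_def by (simp add: laurent_quot_unique mult.commute)
qed

lemma qint_add:
  assumes "d > 0"
  shows "qint d (a + b) = vpow (int d * b) * qint d a + vpow (- (int d * a)) * qint d b"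
proof -
  let ?q = "vpow (int d) - vpow (- int d)"
  have nz: "?q \<noteq> 0" using assms by (intro vpow_diff_neq_0) simp
  have "(vpow (int d * b) * qint d a + vpow (- (int d * a)) * qint d b) * ?q
      = vpow (int d * b) * (qint d a * ?q) + vpow (- (int d * a)) * (qint d b * ?q)"
    by (simp only: distrib_right mult.assoc)
  also have "\<dots> = qint d (a + b) * ?q"
    unfolding qint_eq[OF assms] by (simp add: algebra_simps flip: vpow_add)
  finally show ?thesis using nz by (metis mult_right_cancel)
qed

lemma qint_0: "d > 0 \<Longrightarrow> qint d 0 = 0"
  using qint_add[of d 0 0] by simp

lemma qint_neq_0:
  assumes "d > 0" and "n > 0"
  shows "qint d n \<noteq> 0"
proof
  assume "qint d n = 0"
  then have "vpow (int d * n) - vpow (- (int d * n)) = 0" using qint_eq[OF assms(1), of n] by simp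
  moreover have "int d * n > 0" using assms by simp
  ultimately show False using vpow_diff_neq_0 by blast
qed

lemma qbinom_dvd:
  assumes d: "d > 0"
  shows "(\<Prod>i=1..r. qint d (int i)) dvd (\<Prod>i<r. qint d (n - int i))"
proof (induction r arbitrary: n)
  case 0
  then show ?case by simp
next
  case (Suc r)
  let ?f = "\<Prod>i=1..Suc r. qint d (int i)"
  let ?P = "\<lambda>n r. \<Prod>i<r. qint d (n - int i)"
  have shift: "?P (m + 1) (Suc r) = qint d (m + 1) * ?P m r" for m
    unfolding prod.lessThan_Suc_shift by (simp add: algebra_simps)
  have rec: "?P (m + 1) (Suc r) = vpow (int d * (int r + 1)) * ?P m (Suc r)
      + vpow (- (int d * (m - int r))) * (?P m r * qint d (int (Suc r)))" for m
  proof -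
    have "qint d (m + 1) = vpow (int d * (int r + 1)) * qint d (m - int r)
        + vpow (- (int d * (m - int r))) * qint d (int (Suc r))"
      using qint_add[OF d, of "m - int r" "int r + 1"] by (simp add: algebra_simps)
    then show ?thesis unfolding shift by (simp add: algebra_simps)
  qed
  have tail: "?f dvd ?P m r * qint d (int (Suc r))" for m
  proof -
    have f: "?f = (\<Prod>i=1..r. qint d (int i)) * qint d (int (Suc r))" by simp
    show ?thesis unfolding f by (intro mult_dvd_mono Suc.IH dvd_refl)
  qed
  show ?case
  proof (induction n rule: int_induct[where k = 0])
    case base
    have "?P 0 (Suc r) = 0"
      by (rule prod_zero) (auto intro!: bexI[of _ 0] simp: qint_0 d)
    then show ?case by (simp only: dvd_0_right)
  next
    case (step1 m)
    have "?f dvd vpow (int d * (int r + 1)) * ?P m (Suc r)"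
      using step1(2) by (rule dvd_mult)
    moreover have "?f dvd vpow (- (int d * (m - int r))) * (?P m r * qint d (int (Suc r)))"
      using tail by (rule dvd_mult)
    ultimately show ?case unfolding rec by (rule dvd_add)
  next
    case (step2 m)
    have "?f dvd vpow (- (int d * (m - 1 - int r))) * (?P (m - 1) r * qint d (int (Suc r)))"
      using tail by (rule dvd_mult)
    moreover have "?f dvd ?P (m - 1 + 1) (Suc r)" using step2(2) by simp
    ultimately have "?f dvd vpow (int d * (int r + 1)) * ?P (m - 1) (Suc r)"
      unfolding rec[of "m - 1"] by (metis dvd_add_left_iff)
    then have "?f dvd vpow (- (int d * (int r + 1))) * (vpow (int d * (int r + 1)) * ?P (m - 1) (Suc r))"
      by (rule dvd_mult)
    also have "\<dots> = ?P (m - 1) (Suc r)"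
      by (simp only: mult.assoc[symmetric] vpow_add[symmetric]) simp
    finally show ?case .
  qed
qed

lemma qbinom_eq:
  assumes "d > 0"
  shows "qbinom d n r * (\<Prod>i=1..r. qint d (int i)) = (\<Prod>i<r. qint d (n - int i))"
proof -
  obtain x where "(\<Prod>i<r. qint d (n - int i)) = (\<Prod>i=1..r. qint d (int i)) * x"
    using qbinom_dvd[OF assms] by (metis dvdE)
  moreover have "(\<Prod>i=1..r. qint d (int i)) \<noteq> 0"
    using assms by (simp add: qint_neq_0)
  ultimately show ?thesis
    unfolding qbinom_def by (simp add: laurent_quot_unique mult.commute)
qed


section \<open>Ground data\<close>

text \<open>\<open>coroot G \<alpha> \<mu>\<close> is the pairing of the vector \<open>\<mu>\<close> with the coroot of \<open>\<alpha>\<close>; \<open>zmap\<close> is the structure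
  homomorphism of the algebra over the ring of Laurent polynomials.\<close>

record ('v, 'a) ground =
  roots :: "'v set"
  simples :: "'v set"
  coroot :: "'v \<Rightarrow> 'v \<Rightarrow> real"
  dnum :: "'v \<Rightarrow> nat"
  zmap :: "laurent \<Rightarrow> 'a"

text \<open>Finite, reduced and crystallographic root systems in the real vector space \<open>'v\<close>. The coroots are
  uniquely determined by the set of roots, because the latter is finite and spans.\<close>

definition root_system :: "'v::real_vector set \<Rightarrow> ('v \<Rightarrow> 'v \<Rightarrow> real) \<Rightarrow> bool" where
  "root_system R c \<longleftrightarrow>
     finite R \<and> 0 \<notin> R \<and> span R = UNIV \<and>
     (\<forall>\<alpha>\<in>R. linear (c \<alpha>) \<and> c \<alpha> \<alpha> = 2 \<and> (\<lambda>x. x - c \<alpha> x *\<^sub>R \<alpha>) ` R = R) \<and>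
     (\<forall>\<alpha>\<in>R. \<forall>\<beta>\<in>R. c \<alpha> \<beta> \<in> \<int>) \<and>
     (\<forall>\<alpha>\<in>R. \<forall>t. t *\<^sub>R \<alpha> \<in> R \<longrightarrow> t = 1 \<or> t = - 1)"

definition nonneg_comb :: "'v::real_vector set \<Rightarrow> 'v \<Rightarrow> bool" where
  "nonneg_comb P x \<longleftrightarrow> (\<exists>k::'v \<Rightarrow> nat. x = (\<Sum>\<alpha>\<in>P. real (k \<alpha>) *\<^sub>R \<alpha>))"

definition simple_roots :: "'v::real_vector set \<Rightarrow> 'v set \<Rightarrow> bool" where
  "simple_roots R P \<longleftrightarrow>
     P \<subseteq> R \<and> independent P \<and> (\<forall>\<beta>\<in>R. nonneg_comb P \<beta> \<or> nonneg_comb P (- \<beta>))"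

definition orthogonal_roots :: "('v \<Rightarrow> 'v \<Rightarrow> real) \<Rightarrow> 'v set \<Rightarrow> 'v set \<Rightarrow> bool" where
  "orthogonal_roots c A B \<longleftrightarrow> (\<forall>\<alpha>\<in>A. \<forall>\<beta>\<in>B. c \<alpha> \<beta> = 0 \<and> c \<beta> \<alpha> = 0)"

definition irreducible_component :: "'v set \<Rightarrow> ('v \<Rightarrow> 'v \<Rightarrow> real) \<Rightarrow> 'v set \<Rightarrow> bool" where
  "irreducible_component R c C \<longleftrightarrow>
     C \<subseteq> R \<and> C \<noteq> {} \<and> orthogonal_roots c C (R - C) \<and>
     \<not> (\<exists>A B. A \<noteq> {} \<and> B \<noteq> {} \<and> A \<union> B = C \<and> A \<inter> B = {} \<and> orthogonal_roots c A B)"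

definition noetherian :: "'a::comm_ring_1 itself \<Rightarrow> bool" where
  "noetherian _ \<longleftrightarrow>
     (\<forall>I::'a set. module.subspace (*) I \<longrightarrow> (\<exists>B. finite B \<and> module.span (*) B = I))"

definition ground_data :: "('v::real_vector, 'a::comm_ring_1) ground \<Rightarrow> bool" where
  "ground_data G \<longleftrightarrow>
     root_system (roots G) (coroot G) \<and>
     simple_roots (roots G) (simples G) \<and>
     (\<forall>\<alpha>\<in>simples G. dnum G \<alpha> \<in> {1, 2, 3}) \<and>
     (\<forall>\<alpha>\<in>simples G. \<forall>\<beta>\<in>simples G.
        real (dnum G \<alpha>) * coroot G \<alpha> \<beta> = real (dnum G \<beta>) * coroot G \<beta> \<alpha>) \<and>
     (\<forall>C. irreducible_component (roots G) (coroot G) C \<longrightarrow> (\<exists>\<alpha>\<in>C \<inter> simples G. dnum G \<alpha> = 1)) \<and>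
     zmap G 1 = 1 \<and>
     (\<forall>p q. zmap G (p + q) = zmap G p + zmap G q \<and> zmap G (p * q) = zmap G p * zmap G q)"

definition weights :: "('v::real_vector, 'a) ground \<Rightarrow> 'v set" where
  "weights G = {\<mu>. \<forall>\<alpha>\<in>roots G. coroot G \<alpha> \<mu> \<in> \<int>}"

definition wle :: "('v::real_vector, 'a) ground \<Rightarrow> 'v \<Rightarrow> 'v \<Rightarrow> bool" where
  "wle G \<mu> \<nu> \<longleftrightarrow> nonneg_comb (simples G) (\<nu> - \<mu>)"

definition quasi_bounded :: "('v::real_vector, 'a) ground \<Rightarrow> 'v set \<Rightarrow> bool" where
  "quasi_bounded G S \<longleftrightarrow> (\<forall>\<mu>\<in>weights G. finite {\<nu> \<in> S. wle G \<mu> \<nu>})"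


section \<open>Modules\<close>

text \<open>All modules below are submodules, in the sense of \<^const>\<open>module.subspace\<close>, of a module whose
  elements form a whole type.\<close>

definition linear_between ::
  "('a \<Rightarrow> 'm::ab_group_add \<Rightarrow> 'm) \<Rightarrow> ('a \<Rightarrow> 'n::ab_group_add \<Rightarrow> 'n) \<Rightarrow> 'm set \<Rightarrow> 'n set \<Rightarrow> ('m \<Rightarrow> 'n) \<Rightarrow> bool"
  where
  "linear_between s t A B f \<longleftrightarrow>
     f ` A \<subseteq> B \<and>
     (\<forall>x\<in>A. \<forall>y\<in>A. f (x + y) = f x + f y) \<and>
     (\<forall>a. \<forall>x\<in>A. f (s a x) = t a (f x))"

definition finitely_generated :: "('a::comm_ring_1 \<Rightarrow> 'm::ab_group_add \<Rightarrow> 'm) \<Rightarrow> 'm set \<Rightarrow> bool" where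
  "finitely_generated s A \<longleftrightarrow> (\<exists>B. finite B \<and> module.span s B = A)"

definition free_of_rank :: "('a::comm_ring_1 \<Rightarrow> 'm::ab_group_add \<Rightarrow> 'm) \<Rightarrow> 'm set \<Rightarrow> nat \<Rightarrow> bool" where
  "free_of_rank s A r \<longleftrightarrow>
     (\<exists>B. finite B \<and> card B = r \<and> \<not> module.dependent s B \<and> module.span s B = A)"

text \<open>Quotient modules \<open>A / N\<close> are treated through representatives. In \<open>free_quotient\<close> the classes of
  the elements of \<open>B\<close> generate \<open>A / N\<close> and are linearly independent; by the second property
  distinct elements of \<open>B\<close> have distinct classes.\<close>

definition torsion_quotient :: "('a::comm_ring_1 \<Rightarrow> 'm::ab_group_add \<Rightarrow> 'm) \<Rightarrow> 'm set \<Rightarrow> 'm set \<Rightarrow> bool" where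
  "torsion_quotient s A N \<longleftrightarrow> (\<forall>x\<in>A. \<exists>a. a \<noteq> 0 \<and> s a x \<in> N)"

definition free_quotient :: "('a::comm_ring_1 \<Rightarrow> 'm::ab_group_add \<Rightarrow> 'm) \<Rightarrow> 'm set \<Rightarrow> 'm set \<Rightarrow> bool" where
  "free_quotient s A N \<longleftrightarrow>
     (\<exists>B\<subseteq>A. (\<forall>x\<in>A. \<exists>y\<in>module.span s B. x - y \<in> N) \<and>
             (\<forall>T u. finite T \<and> T \<subseteq> B \<and> (\<Sum>b\<in>T. s (u b) b) \<in> N \<longrightarrow> (\<forall>b\<in>T. u b = 0)))"


section \<open>The category of graded modules with operators\<close>

text \<open>A graded module is given by the family of its homogeneous components \<open>comp M \<mu>\<close>. All data are
  relevant only for \<open>\<mu>\<close> in the weight lattice, \<open>\<alpha>\<close> simple and \<open>n > 0\<close>, and the maps only on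
  their source component. Indices are as follows:
  \<open>Eact M \<mu> \<alpha> n\<close> maps \<open>comp M \<mu>\<close> to \<open>comp M (\<mu> + n\<alpha>)\<close>, and
  \<open>Fact M \<mu> \<alpha> n\<close> maps \<open>comp M (\<mu> + n\<alpha>)\<close> to \<open>comp M \<mu>\<close>.\<close>

record ('v, 'a, 'm) gobj =
  scl :: "'a \<Rightarrow> 'm \<Rightarrow> 'm"
  comp :: "'v \<Rightarrow> 'm set"
  Eact :: "'v \<Rightarrow> 'v \<Rightarrow> nat \<Rightarrow> 'm \<Rightarrow> 'm"
  Fact :: "'v \<Rightarrow> 'v \<Rightarrow> nat \<Rightarrow> 'm \<Rightarrow> 'm"

definition up :: "'v::real_vector \<Rightarrow> 'v \<Rightarrow> nat \<Rightarrow> 'v" where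
  "up \<mu> \<alpha> n = \<mu> + real n *\<^sub>R \<alpha>"

definition E0 :: "('v, 'a, 'm) gobj \<Rightarrow> 'v \<Rightarrow> 'v \<Rightarrow> nat \<Rightarrow> 'm \<Rightarrow> 'm" where
  "E0 M \<mu> \<alpha> n = (if n = 0 then id else Eact M \<mu> \<alpha> n)"

definition F0 :: "('v, 'a, 'm) gobj \<Rightarrow> 'v \<Rightarrow> 'v \<Rightarrow> nat \<Rightarrow> 'm \<Rightarrow> 'm" where
  "F0 M \<mu> \<alpha> n = (if n = 0 then id else Fact M \<mu> \<alpha> n)"

definition graded_operators ::
  "('v::real_vector, 'a::comm_ring_1) ground \<Rightarrow> ('v, 'a, 'm::ab_group_add) gobj \<Rightarrow> bool" where
  "graded_operators G M \<longleftrightarrow>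
     module (scl M) \<and>
     (\<forall>\<mu>\<in>weights G. module.subspace (scl M) (comp M \<mu>)) \<and>
     (\<forall>\<mu>\<in>weights G. \<forall>\<alpha>\<in>simples G. \<forall>n>0.
        linear_between (scl M) (scl M) (comp M \<mu>) (comp M (up \<mu> \<alpha> n)) (Eact M \<mu> \<alpha> n) \<and>
        linear_between (scl M) (scl M) (comp M (up \<mu> \<alpha> n)) (comp M \<mu>) (Fact M \<mu> \<alpha> n))"

definition X1 ::
  "('v::real_vector, 'a::comm_ring_1) ground \<Rightarrow> ('v, 'a, 'm::ab_group_add) gobj \<Rightarrow> bool" where
  "X1 G M \<longleftrightarrow>
     quasi_bounded G {\<mu> \<in> weights G. comp M \<mu> \<noteq> {0}} \<and>
     (\<forall>\<mu>\<in>weights G. finitely_generated (scl M) (comp M \<mu>))"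

definition X2 ::
  "('v::real_vector, 'a::comm_ring_1) ground \<Rightarrow> ('v, 'a, 'm::ab_group_add) gobj \<Rightarrow> bool" where
  "X2 G M \<longleftrightarrow>
     (\<forall>\<mu>\<in>weights G. \<forall>\<alpha>\<in>simples G. \<forall>\<beta>\<in>simples G. \<forall>m>0. \<forall>n>0. \<forall>x\<in>comp M (up \<mu> \<beta> n).
        (\<alpha> \<noteq> \<beta> \<longrightarrow>
           E0 M \<mu> \<alpha> m (F0 M \<mu> \<beta> n x) = F0 M (up \<mu> \<alpha> m) \<beta> n (E0 M (up \<mu> \<beta> n) \<alpha> m x)) \<and>
        (\<alpha> = \<beta> \<longrightarrow>
           E0 M \<mu> \<alpha> m (F0 M \<mu> \<alpha> n x) =
             (\<Sum>r=0..min m n.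
                scl M (zmap G (qbinom (dnum G \<alpha>) (\<lfloor>coroot G \<alpha> \<mu>\<rfloor> + int m + int n) r))
                  (F0 M (up \<mu> \<alpha> m) \<alpha> (n - r) (E0 M (up \<mu> \<alpha> n) \<alpha> (m - r) x)))))"

text \<open>The direct sum of the components \<open>comp M (\<mu> + n\<alpha>)\<close> over all pairs \<open>(\<alpha>, n)\<close>, as a set of finitely
  supported families. For objects satisfying \<open>X1\<close> the family \<open>Ecol G M \<mu> x\<close> is finitely supported.\<close>

definition delta :: "('v::real_vector, 'a) ground \<Rightarrow> ('v, 'a, 'm::zero) gobj \<Rightarrow> 'v \<Rightarrow> ('v \<times> nat \<Rightarrow> 'm) set" where
  "delta G M \<mu> = {y. finite {p. y p \<noteq> 0} \<and>
     (\<forall>\<alpha> n. if \<alpha> \<in> simples G \<and> n > 0 then y (\<alpha>, n) \<in> comp M (up \<mu> \<alpha> n) else y (\<alpha>, n) = 0)}"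

definition Ecol ::
  "('v, 'a) ground \<Rightarrow> ('v, 'a, 'm::zero) gobj \<Rightarrow> 'v \<Rightarrow> 'm \<Rightarrow> 'v \<times> nat \<Rightarrow> 'm" where
  "Ecol G M \<mu> x = (\<lambda>(\<alpha>, n). if \<alpha> \<in> simples G \<and> n > 0 then Eact M \<mu> \<alpha> n x else 0)"

definition Frow ::
  "('v, 'a, 'm::ab_group_add) gobj \<Rightarrow> 'v \<Rightarrow> ('v \<times> nat \<Rightarrow> 'm) \<Rightarrow> 'm" where
  "Frow M \<mu> y = (\<Sum>(\<alpha>, n) \<in> {p. y p \<noteq> 0}. Fact M \<mu> \<alpha> n (y (\<alpha>, n)))"

definition imF :: "('v::real_vector, 'a) ground \<Rightarrow> ('v, 'a, 'm::ab_group_add) gobj \<Rightarrow> 'v \<Rightarrow> 'm set" where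
  "imF G M \<mu> = Frow M \<mu> ` delta G M \<mu>"

definition curly ::
  "('v::real_vector, 'a) ground \<Rightarrow> ('v, 'a, 'm::ab_group_add) gobj \<Rightarrow> 'v \<Rightarrow> ('v \<times> nat \<Rightarrow> 'm) set" where
  "curly G M \<mu> = Ecol G M \<mu> ` imF G M \<mu>"

definition angle ::
  "('v::real_vector, 'a) ground \<Rightarrow> ('v, 'a, 'm::ab_group_add) gobj \<Rightarrow> 'v \<Rightarrow> ('v \<times> nat \<Rightarrow> 'm) set" where
  "angle G M \<mu> = Ecol G M \<mu> ` comp M \<mu>"

definition X3 ::
  "('v::real_vector, 'a::comm_ring_1) ground \<Rightarrow> ('v, 'a, 'm::ab_group_add) gobj \<Rightarrow> bool" where
  "X3 G M \<longleftrightarrow>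
     (\<forall>\<mu>\<in>weights G.
        inj_on (Ecol G M \<mu>) (imF G M \<mu>) \<and>
        torsion_quotient (\<lambda>a y p. scl M a (y p)) (angle G M \<mu>) (curly G M \<mu>) \<and>
        free_quotient (scl M) (comp M \<mu>) (imF G M \<mu>))"

definition obj ::
  "('v::real_vector, 'a::comm_ring_1) ground \<Rightarrow> ('v, 'a, 'm::ab_group_add) gobj \<Rightarrow> bool" where
  "obj G M \<longleftrightarrow> graded_operators G M \<and> X1 G M \<and> X2 G M \<and> X3 G M"

definition hom ::
  "('v::real_vector, 'a::comm_ring_1) ground \<Rightarrow> ('v, 'a, 'm::ab_group_add) gobj \<Rightarrow>
   ('v, 'a, 'n::ab_group_add) gobj \<Rightarrow> ('v \<Rightarrow> 'm \<Rightarrow> 'n) \<Rightarrow> bool" where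
  "hom G M N f \<longleftrightarrow>
     (\<forall>\<mu>\<in>weights G. linear_between (scl M) (scl N) (comp M \<mu>) (comp N \<mu>) (f \<mu>)) \<and>
     (\<forall>\<mu>\<in>weights G. \<forall>\<alpha>\<in>simples G. \<forall>n>0.
        (\<forall>x\<in>comp M \<mu>. f (up \<mu> \<alpha> n) (Eact M \<mu> \<alpha> n x) = Eact N \<mu> \<alpha> n (f \<mu> x)) \<and>
        (\<forall>x\<in>comp M (up \<mu> \<alpha> n). f \<mu> (Fact M \<mu> \<alpha> n x) = Fact N \<mu> \<alpha> n (f (up \<mu> \<alpha> n) x)))"

definition iso ::
  "('v::real_vector, 'a::comm_ring_1) ground \<Rightarrow> ('v, 'a, 'm::ab_group_add) gobj \<Rightarrow>
   ('v, 'a, 'n::ab_group_add) gobj \<Rightarrow> bool" where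
  "iso G M N \<longleftrightarrow>
     obj G M \<and> obj G N \<and>
     (\<exists>f g. hom G M N f \<and> hom G N M g \<and>
        (\<forall>\<mu>\<in>weights G. (\<forall>x\<in>comp M \<mu>. g \<mu> (f \<mu> x) = x) \<and> (\<forall>y\<in>comp N \<mu>. f \<mu> (g \<mu> y) = y)))"

definition minimal ::
  "('v::real_vector, 'a::comm_ring_1) ground \<Rightarrow> ('v, 'a, 'm::ab_group_add) gobj \<Rightarrow> bool" where
  "minimal G M \<longleftrightarrow> (\<forall>\<mu>\<in>weights G. curly G M \<mu> = angle G M \<mu>)"

definition zero_obj :: "('v::real_vector, 'a) ground \<Rightarrow> ('v, 'a, 'm::zero) gobj \<Rightarrow> bool" where
  "zero_obj G M \<longleftrightarrow> (\<forall>\<mu>\<in>weights G. comp M \<mu> = {0})"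

text \<open>The summands in a decomposition are required to be objects of the category themselves: a direct
  summand as a graded module with operators satisfies the last part of \<open>X3\<close> only with projective in place of
  free quotients. \<open>M\<lparr>comp := A\<rparr>\<close> is the submodule with components \<open>A \<mu>\<close>.\<close>

definition indecomposable ::
  "('v::real_vector, 'a::comm_ring_1) ground \<Rightarrow> ('v, 'a, 'm::ab_group_add) gobj \<Rightarrow> bool" where
  "indecomposable G M \<longleftrightarrow>
     \<not> zero_obj G M \<and>
     (\<forall>A B. obj G (M\<lparr>comp := A\<rparr>) \<and> obj G (M\<lparr>comp := B\<rparr>) \<and>
        (\<forall>\<mu>\<in>weights G. comp M \<mu> = {a + b | a b. a \<in> A \<mu> \<and> b \<in> B \<mu>} \<and> A \<mu> \<inter> B \<mu> = {0}) \<longrightarrow>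
        zero_obj G (M\<lparr>comp := A\<rparr>) \<or> zero_obj G (M\<lparr>comp := B\<rparr>))"

text \<open>The componentwise direct sum over \<open>J\<close>. Families vanish outside \<open>J\<close>; the values \<open>S i\<close> for
  \<open>i \<notin> J\<close> only serve to make scalar multiplication a module structure on the whole type.\<close>

definition dsum :: "'i set \<Rightarrow> ('i \<Rightarrow> ('v, 'a, 'm::zero) gobj) \<Rightarrow> ('v, 'a, 'i \<Rightarrow> 'm) gobj" where
  "dsum J S = \<lparr>
     scl = (\<lambda>a x i. scl (S i) a (x i)),
     comp = (\<lambda>\<mu>. {x. finite {i. x i \<noteq> 0} \<and> (\<forall>i. if i \<in> J then x i \<in> comp (S i) \<mu> else x i = 0)}),
     Eact = (\<lambda>\<mu> \<alpha> n x i. if i \<in> J then Eact (S i) \<mu> \<alpha> n (x i) else 0),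
     Fact = (\<lambda>\<mu> \<alpha> n x i. if i \<in> J then Fact (S i) \<mu> \<alpha> n (x i) else 0)\<rparr>"

definition is_Smin ::
  "('v::real_vector, 'a::comm_ring_1) ground \<Rightarrow> 'v \<Rightarrow> ('v, 'a, 'm::ab_group_add) gobj \<Rightarrow> bool" where
  "is_Smin G \<nu> M \<longleftrightarrow>
     obj G M \<and>
     free_of_rank (scl M) (comp M \<nu>) 1 \<and>
     (\<forall>\<mu>\<in>weights G. comp M \<mu> \<noteq> {0} \<longrightarrow> wle G \<mu> \<nu>) \<and>
     indecomposable G M \<and> minimal G M"

end

theory Submission
  imports Defs "HOL-Library.Nat_Bijection" "HOL-Library.FuncSet"
begin

text \<open>
  In a minimal object every weight space splits. Minimality says that \<open>E\<^sub>\<mu>\<close> takes the same values on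
  \<open>im F\<^sub>\<mu>\<close> as on all of \<open>M\<^sub>\<mu>\<close>, and it is injective on \<open>im F\<^sub>\<mu>\<close>; hence \<open>M\<^sub>\<mu> = im F\<^sub>\<mu> \<oplus> ker E\<^sub>\<mu>\<close>, and
  the space \<open>ker E\<^sub>\<mu>\<close> of singular vectors is isomorphic to \<open>M\<^sub>\<mu> / im F\<^sub>\<mu>\<close>, so free of finite rank. Bases of
  all these spaces generate \<open>M\<close> under the operators \<open>F\<close>, by descending induction on the weight. The
  predicate \<open>highest_weight_basis\<close> records such bases with their coordinate forms. Every minimal object
  has one (\<open>minimal_has_highest_weight_basis\<close>), and conversely a module with operators that satisfies
  \<open>X2\<close>, has quasi-bounded weights and has such a basis is a minimal object
  (\<open>highest_weight_basis_obj_minimal\<close>).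

  The indecomposable minimal objects sit inside a module coinduced from words in the operators \<open>E\<close>.
  Given a linear form \<open>h\<close> on \<open>M\<^sub>\<nu>\<close> that vanishes on \<open>im F\<^sub>\<nu>\<close>, send \<open>x\<close> to the function \<open>u \<mapsto> h (E\<^sub>u x)\<close> on
  words. On such functions \<open>E\<close> acts by prefixing a letter, and the commutation rules \<open>X2\<close>, read from left to right,
  are a recursion over the word that defines the action of \<open>F\<close>; with these actions \<open>x \<mapsto> (u \<mapsto> h (E\<^sub>u x))\<close> is a morphism
  (\<open>matrix_coeff_hom\<close>). \<open>Smin G \<nu>\<close> is the submodule generated under \<open>F\<close> by the indicator function of the empty word.
  A function that is killed by all \<open>E\<close> vanishes on all nonempty words, so this vacuum vector spans the
  singular vectors of \<open>Smin G \<nu>\<close>. Over a field this module is simple, and in general it is the lattice that the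
  highest weight vector generates in the simple module over the fraction field.

  For a minimal object \<open>M\<close> take the morphisms belonging to the coordinate forms of a highest weight
  basis. They are jointly injective, since an element on which all of them vanish is singular by
  induction and then has zero coordinates (\<open>matrix_coeff_joint_inj\<close>), and they send basis elements to vacua. So
  they identify \<open>M\<close> with the direct sum of the \<open>Smin G \<nu>\<close>, one for each basis element of weight \<open>\<nu>\<close>
  (\<open>minimal_iso_dsum\<close>). If \<open>M\<close> is indecomposable, splitting the basis into two parts splits \<open>M\<close>, so that only one
  basis element can exist (\<open>is_Smin_singleton_basis\<close>); this gives uniqueness. Finally, a morphism out of \<open>Smin G \<nu>\<close> is
  determined by the image of the vacuum, which is a singular vector of weight \<open>\<nu>\<close>: a multiple of the
  vacuum in \<open>Smin G \<nu>\<close>, and zero in \<open>Smin G \<kappa>\<close> for \<open>\<kappa> \<noteq> \<nu>\<close>.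
\<close>

section \<open>Weights and simple roots\<close>

lemma up_0 [simp]: "up \<mu> \<alpha> 0 = \<mu>"
  by (simp add: up_def)

lemma up_up_commute: "up (up \<mu> \<alpha> m) \<beta> n = up (up \<mu> \<beta> n) \<alpha> m"
  by (simp add: up_def)

lemma up_up: "up (up \<mu> \<alpha> m) \<alpha> n = up \<mu> \<alpha> (m + n)"
  by (simp add: up_def algebra_simps)

locale ground_context =
  fixes G :: "('v::real_vector, 'a::idom) ground"
  assumes ground: "ground_data G"
begin

lemma root_system: "root_system (roots G) (coroot G)"
  using ground by (simp add: ground_data_def)

lemma simples: "simples G \<subseteq> roots G" "independent (simples G)" "finite (simples G)"
  using ground unfolding ground_data_def simple_roots_def root_system_def
  by (auto intro: finite_subset)

lemma coroot_linear: "\<alpha> \<in> roots G \<Longrightarrow> linear (coroot G \<alpha>)"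
  using root_system by (simp add: root_system_def)

lemma up_weights:
  assumes "\<mu> \<in> weights G" "\<alpha> \<in> simples G"
  shows "up \<mu> \<alpha> n \<in> weights G"
  unfolding weights_def
proof (intro CollectI ballI)
  fix \<beta> assume b: "\<beta> \<in> roots G"
  then interpret linear "coroot G \<beta>" by (rule coroot_linear)
  have "coroot G \<beta> \<mu> \<in> \<int>" using assms b by (simp add: weights_def)
  moreover have "coroot G \<beta> \<alpha> \<in> \<int>"
    using assms b simples root_system unfolding root_system_def by blast
  ultimately show "coroot G \<beta> (up \<mu> \<alpha> n) \<in> \<int>"
    by (simp add: up_def add scale)
qed

lemma wle_refl: "wle G \<mu> \<mu>"
  unfolding wle_def nonneg_comb_def by (intro exI[of _ "\<lambda>_. 0"]) simp

lemma nonneg_comb_add: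
  fixes P :: "'v set"
  assumes "nonneg_comb P x" "nonneg_comb P y"
  shows "nonneg_comb P (x + y)"
proof -
  obtain k j :: "'v \<Rightarrow> nat" where
    "x = (\<Sum>\<alpha>\<in>P. real (k \<alpha>) *\<^sub>R \<alpha>)" "y = (\<Sum>\<alpha>\<in>P. real (j \<alpha>) *\<^sub>R \<alpha>)"
    using assms by (auto simp: nonneg_comb_def)
  then have "x + y = (\<Sum>\<alpha>\<in>P. real (k \<alpha> + j \<alpha>) *\<^sub>R \<alpha>)"
    by (simp add: scaleR_left_distrib sum.distrib)
  then show ?thesis unfolding nonneg_comb_def by (rule exI[of _ "\<lambda>a. k a + j a"])
qed

lemma wle_trans: "wle G \<mu> \<kappa> \<Longrightarrow> wle G \<kappa> \<nu> \<Longrightarrow> wle G \<mu> \<nu>"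
  unfolding wle_def using nonneg_comb_add[of "simples G" "\<kappa> - \<mu>" "\<nu> - \<kappa>"] by simp

lemma nonneg_comb_simple:
  assumes "\<alpha> \<in> simples G"
  shows "nonneg_comb (simples G) (real n *\<^sub>R \<alpha>)"
proof -
  have "(\<Sum>\<beta>\<in>simples G. real (if \<beta> = \<alpha> then n else 0) *\<^sub>R \<beta>)
      = (\<Sum>\<beta>\<in>simples G. if \<beta> = \<alpha> then real n *\<^sub>R \<alpha> else 0)"
    by (intro sum.cong) auto
  also have "\<dots> = real n *\<^sub>R \<alpha>" using assms simples by simp
  finally show ?thesis unfolding nonneg_comb_def by metis
qed

lemma wle_up: "\<alpha> \<in> simples G \<Longrightarrow> wle G \<mu> (up \<mu> \<alpha> n)"
  by (simp add: wle_def up_def nonneg_comb_simple)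

lemma comb_unique:
  assumes "(\<Sum>\<beta>\<in>simples G. f \<beta> *\<^sub>R \<beta>) = (\<Sum>\<beta>\<in>simples G. g \<beta> *\<^sub>R \<beta>)" "\<alpha> \<in> simples G"
  shows "f \<alpha> = g \<alpha>"
proof -
  have "(\<Sum>\<beta>\<in>simples G. (f \<beta> - g \<beta>) *\<^sub>R \<beta>) = 0"
    using assms(1) by (simp add: scaleR_left_diff_distrib sum_subtractf)
  then have "f \<alpha> - g \<alpha> = 0"
    using independentD[OF simples(2) simples(3) subset_refl, of "\<lambda>b. f b - g b"] assms(2) by simp
  then show ?thesis by simp
qed

lemma nonneg_comb_antisym:
  assumes "nonneg_comb (simples G) x" "nonneg_comb (simples G) (- x)"
  shows "x = 0"
proof -
  obtain k j :: "'v \<Rightarrow> nat" where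
    k: "x = (\<Sum>\<alpha>\<in>simples G. real (k \<alpha>) *\<^sub>R \<alpha>)" and j: "- x = (\<Sum>\<alpha>\<in>simples G. real (j \<alpha>) *\<^sub>R \<alpha>)"
    using assms by (auto simp: nonneg_comb_def)
  have "(\<Sum>\<alpha>\<in>simples G. real (k \<alpha> + j \<alpha>) *\<^sub>R \<alpha>) = x + - x"
    by (subst j, subst (1) k) (simp add: scaleR_left_distrib sum.distrib)
  then have "(\<Sum>\<alpha>\<in>simples G. real (k \<alpha> + j \<alpha>) *\<^sub>R \<alpha>) = (\<Sum>\<alpha>\<in>simples G. 0 *\<^sub>R \<alpha>)" by simp
  then have "real (k \<alpha> + j \<alpha>) = 0" if "\<alpha> \<in> simples G" for \<alpha>
    using comb_unique[of "\<lambda>\<alpha>. real (k \<alpha> + j \<alpha>)" "\<lambda>_. 0" \<alpha>] that by simp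
  then have "k \<alpha> = 0" if "\<alpha> \<in> simples G" for \<alpha> using that by (metis add_is_0 of_nat_eq_0_iff)
  then show ?thesis by (subst k) (simp add: sum.neutral)
qed

lemma simple_neq_0: "\<alpha> \<in> simples G \<Longrightarrow> \<alpha> \<noteq> 0"
  using simples(2) dependent_zero by blast

text \<open>Adding a positive multiple of a simple root strictly raises a weight; this keeps chains of \<open>E\<close>'s finite.\<close>

lemma not_up_wle:
  assumes "\<alpha> \<in> simples G" "n > 0"
  shows "\<not> wle G (up \<mu> \<alpha> n) \<mu>"
proof
  assume "wle G (up \<mu> \<alpha> n) \<mu>"
  then have "real n *\<^sub>R \<alpha> = 0"
    using nonneg_comb_antisym[OF nonneg_comb_simple[OF assms(1), of n]] by (simp add: wle_def up_def)
  then show False using assms simple_neq_0 by simp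
qed

text \<open>Linear independence of the simple roots makes the coefficients of \<open>\<nu> - \<mu>\<close> unique, and they bound
  those of \<open>\<nu> - \<kappa>\<close> for every \<open>\<kappa>\<close> in between.\<close>

lemma finite_interval: "finite {\<kappa>. wle G \<mu> \<kappa> \<and> wle G \<kappa> \<nu>}"
proof (cases "wle G \<mu> \<nu>")
  case False
  then have "{\<kappa>. wle G \<mu> \<kappa> \<and> wle G \<kappa> \<nu>} = {}" using wle_trans by blast
  then show ?thesis by (simp only: finite.emptyI)
next
  case True
  then obtain c :: "'v \<Rightarrow> nat" where c: "\<nu> - \<mu> = (\<Sum>\<alpha>\<in>simples G. real (c \<alpha>) *\<^sub>R \<alpha>)"
    by (auto simp: wle_def nonneg_comb_def)
  let ?P = "PiE (simples G) (\<lambda>\<beta>. {..c \<beta>})"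
  have "{\<kappa>. wle G \<mu> \<kappa> \<and> wle G \<kappa> \<nu>} \<subseteq> (\<lambda>k. \<nu> - (\<Sum>\<alpha>\<in>simples G. real (k \<alpha>) *\<^sub>R \<alpha>)) ` ?P"
  proof
    fix \<kappa> assume "\<kappa> \<in> {\<kappa>. wle G \<mu> \<kappa> \<and> wle G \<kappa> \<nu>}"
    then obtain k j :: "'v \<Rightarrow> nat" where
      j: "\<kappa> - \<mu> = (\<Sum>\<alpha>\<in>simples G. real (j \<alpha>) *\<^sub>R \<alpha>)" and
      k: "\<nu> - \<kappa> = (\<Sum>\<alpha>\<in>simples G. real (k \<alpha>) *\<^sub>R \<alpha>)"
      by (auto simp: wle_def nonneg_comb_def)
    have "(\<Sum>\<alpha>\<in>simples G. real (k \<alpha> + j \<alpha>) *\<^sub>R \<alpha>) = (\<nu> - \<kappa>) + (\<kappa> - \<mu>)"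
      unfolding j k by (simp add: scaleR_left_distrib sum.distrib)
    also have "\<dots> = (\<Sum>\<alpha>\<in>simples G. real (c \<alpha>) *\<^sub>R \<alpha>)" by (simp add: c[symmetric])
    finally have "real (k \<alpha> + j \<alpha>) = real (c \<alpha>)" if "\<alpha> \<in> simples G" for \<alpha>
      by (rule comb_unique) (rule that)
    then have le: "k \<alpha> \<le> c \<alpha>" if "\<alpha> \<in> simples G" for \<alpha> using that by fastforce
    have "\<kappa> = \<nu> - (\<Sum>\<alpha>\<in>simples G. real (restrict k (simples G) \<alpha>) *\<^sub>R \<alpha>)"
      using k by (simp add: algebra_simps)
    moreover have "restrict k (simples G) \<in> ?P" using le by auto
    ultimately show "\<kappa> \<in> (\<lambda>k. \<nu> - (\<Sum>\<alpha>\<in>simples G. real (k \<alpha>) *\<^sub>R \<alpha>)) ` ?P" by blast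
  qed
  then show ?thesis by (rule finite_subset) (intro finite_imageI finite_PiE simples(3) finite_atMost)
qed

lemma quasi_bounded_below:
  assumes "\<And>\<mu>. \<mu> \<in> S \<Longrightarrow> wle G \<mu> \<nu>"
  shows "quasi_bounded G S"
  unfolding quasi_bounded_def
  using assms by (auto intro: finite_subset[OF _ finite_interval])

lemma quasi_bounded_mono: "quasi_bounded G T \<Longrightarrow> S \<subseteq> T \<Longrightarrow> quasi_bounded G S"
  unfolding quasi_bounded_def by (auto intro: finite_subset[rotated])

text \<open>Descending induction along the weight order. It terminates because passing from \<open>\<mu> \<in> S\<close> to \<open>\<mu> + n\<alpha>\<close>
  removes at least \<open>\<mu>\<close> from the finite set of elements of \<open>S\<close> above the current weight.\<close>

lemma quasi_bounded_induct [consumes 2, case_names outside step]: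
  assumes qb: "quasi_bounded G S" and "\<mu> \<in> weights G"
    and outside: "\<And>\<mu>. \<mu> \<in> weights G \<Longrightarrow> \<mu> \<notin> S \<Longrightarrow> P \<mu>"
    and step: "\<And>\<mu>. \<mu> \<in> weights G \<Longrightarrow> (\<And>\<alpha> n. \<alpha> \<in> simples G \<Longrightarrow> n > 0 \<Longrightarrow> P (up \<mu> \<alpha> n)) \<Longrightarrow> P \<mu>"
  shows "P \<mu>"
  using \<open>\<mu> \<in> weights G\<close>
proof (induction "card {\<nu> \<in> S. wle G \<mu> \<nu>}" arbitrary: \<mu> rule: less_induct)
  case less
  show ?case
  proof (cases "\<mu> \<in> S")
    case True
    have "P (up \<mu> \<alpha> n)" if "\<alpha> \<in> simples G" "n > 0" for \<alpha> n
    proof (rule less.hyps)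
      have "\<mu> \<in> {\<nu> \<in> S. wle G \<mu> \<nu>} - {\<nu> \<in> S. wle G (up \<mu> \<alpha> n) \<nu>}"
        using True wle_refl not_up_wle[OF that] by simp
      moreover have "{\<nu> \<in> S. wle G (up \<mu> \<alpha> n) \<nu>} \<subseteq> {\<nu> \<in> S. wle G \<mu> \<nu>}"
        using wle_trans[OF wle_up[OF that(1)]] by auto
      ultimately have "{\<nu> \<in> S. wle G (up \<mu> \<alpha> n) \<nu>} \<subset> {\<nu> \<in> S. wle G \<mu> \<nu>}" by blast
      then show "card {\<nu> \<in> S. wle G (up \<mu> \<alpha> n) \<nu>} < card {\<nu> \<in> S. wle G \<mu> \<nu>}"
        using qb less.prems by (intro psubset_card_mono) (auto simp: quasi_bounded_def)
      show "up \<mu> \<alpha> n \<in> weights G" using less.prems that by (simp add: up_weights)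
    qed
    then show ?thesis using step less.prems by blast
  qed (use outside less.prems in blast)
qed

text \<open>The row \<open>F\<^sub>\<mu>\<close> has only finitely many entries with nonzero source; this is what makes the weight
  spaces of a module generated by \<open>F\<close> finitely generated.\<close>

lemma finite_letters:
  assumes qb: "quasi_bounded G S" and "\<mu> \<in> weights G"
  shows "finite {(\<alpha>, n). \<alpha> \<in> simples G \<and> n > 0 \<and> up \<mu> \<alpha> n \<in> S}"
proof -
  have fin: "finite {n. up \<mu> \<alpha> n \<in> {\<nu> \<in> S. wle G \<mu> \<nu>}}" if "\<alpha> \<in> simples G" for \<alpha>
  proof (rule finite_vimageI[of "{\<nu> \<in> S. wle G \<mu> \<nu>}" "up \<mu> \<alpha>", unfolded vimage_def])
    show "inj (up \<mu> \<alpha>)"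
      using simple_neq_0[OF that] by (auto simp: inj_def up_def)
  qed (use assms in \<open>auto simp: quasi_bounded_def\<close>)
  have "{(\<alpha>, n). \<alpha> \<in> simples G \<and> n > 0 \<and> up \<mu> \<alpha> n \<in> S}
      \<subseteq> (SIGMA \<alpha>:simples G. {n. up \<mu> \<alpha> n \<in> {\<nu> \<in> S. wle G \<mu> \<nu>}})"
    using wle_up by auto
  then show ?thesis by (rule finite_subset) (intro finite_SigmaI simples fin)
qed

text \<open>Let \<open>W\<close> be the set of all linear maps that permute the roots and fix \<open>x\<close>. It is finite, as the roots
  span, and contains the reflections, as they fix a vector killed by all coroots. Summing over \<open>W\<close>
  gives a linear map \<open>p\<close>; precomposing with the reflection in a root \<open>\<alpha>\<close> permutes \<open>W\<close> and turns \<open>p \<alpha>\<close>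
  into \<open>- p \<alpha>\<close>. So \<open>p\<close> kills all roots, hence everything, whereas \<open>p x\<close> is \<open>card W\<close> times \<open>x\<close>.\<close>

lemma coroots_separate:
  assumes fix0: "\<And>\<alpha>. \<alpha> \<in> roots G \<Longrightarrow> coroot G \<alpha> x = 0"
  shows "x = 0"
proof -
  let ?R = "roots G"
  define W where "W = {f. linear f \<and> f ` ?R = ?R \<and> f x = x}"
  define s where "s \<alpha> y = y - coroot G \<alpha> y *\<^sub>R \<alpha>" for \<alpha> y
  have R: "finite ?R" "span ?R = UNIV" using root_system by (auto simp: root_system_def)
  have "inj_on (\<lambda>f. restrict f ?R) W"
  proof (rule inj_onI)
    fix f g assume fg: "f \<in> W" "g \<in> W" "restrict f ?R = restrict g ?R"
    then have "f y = g y" if "y \<in> ?R" for y using that by (metis restrict_apply')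
    then show "f = g" using linear_eq_on_span[of f g ?R] fg R by (auto simp: W_def)
  qed
  moreover have "(\<lambda>f. restrict f ?R) ` W \<subseteq> PiE ?R (\<lambda>_. ?R)" by (auto simp: W_def)
  ultimately have finW: "finite W"
    using R by (meson finite_PiE finite_imageD finite_subset)
  define p where "p y = (\<Sum>f\<in>W. f y)" for y
  have lin_p: "linear p"
    unfolding p_def by (rule linear_compose_sum) (auto simp: W_def)
  have "p \<alpha> = 0" if a: "\<alpha> \<in> ?R" for \<alpha>
  proof -
    interpret c: linear "coroot G \<alpha>" using a by (rule coroot_linear)
    have c2: "coroot G \<alpha> \<alpha> = 2" and sR: "s \<alpha> ` ?R = ?R"
      using a root_system by (auto simp: root_system_def s_def)
    have lin_s: "linear (s \<alpha>)"
      by (rule linearI) (auto simp: s_def c.add c.scale algebra_simps)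
    have ss: "s \<alpha> (s \<alpha> y) = y" for y
      by (simp add: s_def c.diff c.scale c2 algebra_simps scaleR_2)
    have sx: "s \<alpha> x = x" using fix0[OF a] by (simp add: s_def)
    have mem: "f \<circ> s \<alpha> \<in> W" if "f \<in> W" for f
    proof -
      have "(f \<circ> s \<alpha>) ` ?R = f ` (s \<alpha> ` ?R)" by (simp only: image_comp)
      moreover have "linear (f \<circ> s \<alpha>)" using that lin_s by (intro linear_compose) (auto simp: W_def)
      ultimately show ?thesis using that sR sx by (simp only: W_def mem_Collect_eq o_apply)
    qed
    have "p \<alpha> = (\<Sum>f\<in>W. (f \<circ> s \<alpha>) \<alpha>)"
      unfolding p_def
      by (rule sum.reindex_bij_witness[of _ "\<lambda>f. f \<circ> s \<alpha>" "\<lambda>f. f \<circ> s \<alpha>"])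
        (use mem ss in \<open>auto simp: fun_eq_iff\<close>)
    also have "\<dots> = (\<Sum>f\<in>W. - f \<alpha>)"
      by (rule sum.cong) (auto simp: s_def c2 scaleR_2 W_def linear_neg)
    finally have "p \<alpha> = - p \<alpha>" by (simp add: p_def sum_negf)
    then have "p \<alpha> + p \<alpha> = 0" by (metis add.right_inverse)
    then show ?thesis by (simp flip: scaleR_2)
  qed
  then have "p x = 0" using linear_eq_0_on_span[OF lin_p, of ?R x] R by auto
  moreover have "p x = real (card W) *\<^sub>R x"
    by (simp add: p_def W_def scaleR_conv_of_real sum_constant_scaleR)
  moreover have "id \<in> W" by (auto simp: W_def linear_id[unfolded id_def] id_def)
  then have "card W \<noteq> 0" using finW by auto
  ultimately show ?thesis by simp
qed

text \<open>A weight is determined by the integers it gives on the finitely many coroots. The summands of a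
  minimal object can therefore be indexed by natural numbers.\<close>

lemma weights_inj_nat: obtains c :: "'v \<Rightarrow> nat" where "inj_on c (weights G)"
proof -
  obtain rs where rs: "set rs = roots G"
    using root_system finite_list[of "roots G"] unfolding root_system_def by metis
  define c where "c \<mu> = list_encode (map (\<lambda>\<alpha>. int_encode \<lfloor>coroot G \<alpha> \<mu>\<rfloor>) rs)" for \<mu>
  have "inj_on c (weights G)"
  proof (rule inj_onI)
    fix \<mu> \<nu> assume w: "\<mu> \<in> weights G" "\<nu> \<in> weights G" and eq: "c \<mu> = c \<nu>"
    have "coroot G \<alpha> (\<mu> - \<nu>) = 0" if a: "\<alpha> \<in> roots G" for \<alpha>
    proof -
      have "\<lfloor>coroot G \<alpha> \<mu>\<rfloor> = \<lfloor>coroot G \<alpha> \<nu>\<rfloor>" using eq a by (simp add: c_def list_encode_eq int_encode_eq flip: rs)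
      moreover have "coroot G \<alpha> \<mu> \<in> \<int>" "coroot G \<alpha> \<nu> \<in> \<int>"
        using w a by (auto simp: weights_def)
      ultimately have "coroot G \<alpha> \<mu> = coroot G \<alpha> \<nu>" by (metis of_int_floor)
      then show ?thesis using linear_diff[OF coroot_linear[OF a]] by simp
    qed
    then have "\<mu> - \<nu> = 0" by (rule coroots_separate)
    then show "\<mu> = \<nu>" by simp
  qed
  then show thesis by (rule that)
qed

end

lemma linear_between_0:
  assumes "linear_between s t A B f" "0 \<in> A"
  shows "f 0 = 0"
proof -
  have "f (0 + 0) = f 0 + f 0" using assms unfolding linear_between_def by blast
  then show ?thesis by simp
qed

lemma linear_between_sum:
  assumes f: "linear_between s t A B f" and A: "module s" "module.subspace s A"
    and g: "\<And>i. i \<in> I \<Longrightarrow> g i \<in> A"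
  shows "f (\<Sum>i\<in>I. s (c i) (g i)) = (\<Sum>i\<in>I. t (c i) (f (g i)))"
proof -
  interpret module s by (rule A)
  have z: "f 0 = 0" using linear_between_0[OF f] subspace_0[OF A(2)] .
  show ?thesis
    using g
  proof (induction I rule: infinite_finite_induct)
    case (insert i I)
    have "s (c i) (g i) \<in> A" "(\<Sum>i\<in>I. s (c i) (g i)) \<in> A"
      using insert.prems A(2) by (auto intro!: subspace_scale subspace_sum)
    then show ?case using insert f by (auto simp: linear_between_def)
  qed (use z in auto)
qed

section \<open>Generation by the lowering operators and highest weight bases\<close>

text \<open>The submodule generated by a family of homogeneous elements under the operators \<open>F\<close> alone. An inductive
  predicate is preferable to a span of iterated \<open>F\<close>'s because morphisms commute with each of its rules,
  so that statements about generated modules become inductions.\<close>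

inductive F_generated ::
  "('v::real_vector, 'a) ground \<Rightarrow> ('v, 'a, 'm::ab_group_add) gobj \<Rightarrow> ('v \<Rightarrow> 'm set) \<Rightarrow> 'v \<Rightarrow> 'm \<Rightarrow> bool"
  for G M K where
  base: "\<mu> \<in> weights G \<Longrightarrow> x \<in> K \<mu> \<Longrightarrow> F_generated G M K \<mu> x"
| zero: "\<mu> \<in> weights G \<Longrightarrow> F_generated G M K \<mu> 0"
| add: "F_generated G M K \<mu> x \<Longrightarrow> F_generated G M K \<mu> y \<Longrightarrow> F_generated G M K \<mu> (x + y)"
| scl: "F_generated G M K \<mu> x \<Longrightarrow> F_generated G M K \<mu> (scl M a x)"
| act: "\<mu> \<in> weights G \<Longrightarrow> \<alpha> \<in> simples G \<Longrightarrow> n > 0 \<Longrightarrow> F_generated G M K (up \<mu> \<alpha> n) x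
    \<Longrightarrow> F_generated G M K \<mu> (Fact M \<mu> \<alpha> n x)"

lemma F_generated_weight: "F_generated G M K \<mu> x \<Longrightarrow> \<mu> \<in> weights G"
  by (induction rule: F_generated.induct) auto

lemma F_generated_comp_update: "F_generated G (M\<lparr>comp := A\<rparr>) K = F_generated G M K"
proof (intro ext iffI)
  fix \<mu> x
  show "F_generated G (M\<lparr>comp := A\<rparr>) K \<mu> x \<Longrightarrow> F_generated G M K \<mu> x"
    by (induction rule: F_generated.induct) (auto intro: F_generated.intros)
  show "F_generated G M K \<mu> x \<Longrightarrow> F_generated G (M\<lparr>comp := A\<rparr>) K \<mu> x"
  proof (induction rule: F_generated.induct)
    case (scl \<mu> x a)
    then show ?case using F_generated.scl[of G "M\<lparr>comp := A\<rparr>"] by simp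
  next
    case (act \<mu> \<alpha> n x)
    then show ?case using F_generated.act[of \<mu> G \<alpha> n "M\<lparr>comp := A\<rparr>"] by simp
  qed (auto intro: F_generated.intros)
qed

definition singular :: "('v::real_vector, 'a) ground \<Rightarrow> ('v, 'a, 'm::zero) gobj \<Rightarrow> 'v \<Rightarrow> 'm \<Rightarrow> bool" where
  "singular G M \<mu> x \<longleftrightarrow> (\<forall>\<alpha>\<in>simples G. \<forall>n>0. Eact M \<mu> \<alpha> n x = 0)"

text \<open>A basis of the space of singular vectors of weight \<open>\<mu>\<close>, together with coordinate forms \<open>l k\<close> that are
  defined on the whole weight space and vanish on the image of \<open>F\<^sub>\<mu>\<close>. The last clause encodes in one
  condition that \<open>K\<close> spans the singular vectors and that none of them but zero lies in the image of \<open>F\<^sub>\<mu>\<close>.\<close>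

definition singular_basis ::
  "('v::real_vector, 'a::comm_ring_1) ground \<Rightarrow> ('v, 'a, 'm::ab_group_add) gobj \<Rightarrow> 'v \<Rightarrow> 'm set
    \<Rightarrow> ('m \<Rightarrow> 'm \<Rightarrow> 'a) \<Rightarrow> bool" where
  "singular_basis G M \<mu> K l \<longleftrightarrow>
     finite K \<and> K \<subseteq> comp M \<mu> \<and> (\<forall>k\<in>K. singular G M \<mu> k) \<and>
     (\<forall>k\<in>K. linear_between (scl M) (*) (comp M \<mu>) UNIV (l k) \<and>
        (\<forall>\<alpha>\<in>simples G. \<forall>n>0. \<forall>x\<in>comp M (up \<mu> \<alpha> n). l k (Fact M \<mu> \<alpha> n x) = 0) \<and>
        (\<forall>k'\<in>K. l k k' = (if k' = k then 1 else 0))) \<and>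
     (\<forall>x\<in>comp M \<mu>. singular G M \<mu> x \<and> (\<forall>k\<in>K. l k x = 0) \<longrightarrow> x = 0)"

definition highest_weight_basis ::
  "('v::real_vector, 'a::comm_ring_1) ground \<Rightarrow> ('v, 'a, 'm::ab_group_add) gobj \<Rightarrow> ('v \<Rightarrow> 'm set)
    \<Rightarrow> ('v \<Rightarrow> 'm \<Rightarrow> 'm \<Rightarrow> 'a) \<Rightarrow> bool" where
  "highest_weight_basis G M K l \<longleftrightarrow> (\<forall>\<mu>\<in>weights G.
     singular_basis G M \<mu> (K \<mu>) (l \<mu>) \<and> comp M \<mu> \<subseteq> Collect (F_generated G M K \<mu>))"

lemmas highest_weight_basis_iff = highest_weight_basis_def[unfolded singular_basis_def]

locale graded_module = ground_context G
  for G :: "('v::real_vector, 'a::idom) ground" +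
  fixes M :: "('v, 'a, 'm::ab_group_add) gobj"
  assumes ops: "graded_operators G M"
begin

sublocale md: module "scl M"
  using ops by (simp add: graded_operators_def)

lemma comp_subspace: "\<mu> \<in> weights G \<Longrightarrow> md.subspace (comp M \<mu>)"
  using ops by (simp add: graded_operators_def)

lemmas comp_0 = md.subspace_0[OF comp_subspace]
lemmas comp_add = md.subspace_add[OF comp_subspace]
lemmas comp_diff = md.subspace_diff[OF comp_subspace]
lemmas comp_scl = md.subspace_scale[OF comp_subspace]

lemma E_linear:
  assumes "\<mu> \<in> weights G" "\<alpha> \<in> simples G" "n > 0"
  shows "linear_between (scl M) (scl M) (comp M \<mu>) (comp M (up \<mu> \<alpha> n)) (Eact M \<mu> \<alpha> n)"
  using ops assms by (simp add: graded_operators_def)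

lemma F_linear:
  assumes "\<mu> \<in> weights G" "\<alpha> \<in> simples G" "n > 0"
  shows "linear_between (scl M) (scl M) (comp M (up \<mu> \<alpha> n)) (comp M \<mu>) (Fact M \<mu> \<alpha> n)"
  using ops assms by (simp add: graded_operators_def)

lemma E_props:
  assumes "\<mu> \<in> weights G" "\<alpha> \<in> simples G" "n > 0" "x \<in> comp M \<mu>"
  shows E_in: "Eact M \<mu> \<alpha> n x \<in> comp M (up \<mu> \<alpha> n)"
    and E_0: "Eact M \<mu> \<alpha> n 0 = 0"
    and E_add: "y \<in> comp M \<mu> \<Longrightarrow> Eact M \<mu> \<alpha> n (x + y) = Eact M \<mu> \<alpha> n x + Eact M \<mu> \<alpha> n y"
    and E_scl: "Eact M \<mu> \<alpha> n (scl M a x) = scl M a (Eact M \<mu> \<alpha> n x)"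
  using E_linear[OF assms(1-3)] assms linear_between_0[OF E_linear[OF assms(1-3)]] comp_0[OF assms(1)]
  by (auto simp: linear_between_def)

lemma F_props:
  assumes "\<mu> \<in> weights G" "\<alpha> \<in> simples G" "n > 0" "x \<in> comp M (up \<mu> \<alpha> n)"
  shows F_in: "Fact M \<mu> \<alpha> n x \<in> comp M \<mu>"
    and F_0: "Fact M \<mu> \<alpha> n 0 = 0"
    and F_add: "y \<in> comp M (up \<mu> \<alpha> n) \<Longrightarrow> Fact M \<mu> \<alpha> n (x + y) = Fact M \<mu> \<alpha> n x + Fact M \<mu> \<alpha> n y"
    and F_scl: "Fact M \<mu> \<alpha> n (scl M a x) = scl M a (Fact M \<mu> \<alpha> n x)"
  using F_linear[OF assms(1-3)] assms linear_between_0[OF F_linear[OF assms(1-3)]]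
    comp_0[OF up_weights[OF assms(1,2)]]
  by (auto simp: linear_between_def)

lemma E_diff:
  assumes "\<mu> \<in> weights G" "\<alpha> \<in> simples G" "n > 0" "x \<in> comp M \<mu>" "y \<in> comp M \<mu>"
  shows "Eact M \<mu> \<alpha> n (x - y) = Eact M \<mu> \<alpha> n x - Eact M \<mu> \<alpha> n y"
  using E_add[OF assms(1-3), of "x - y" y] assms comp_diff by (simp add: eq_diff_eq)

lemma F0_in:
  assumes "\<mu> \<in> weights G" "\<alpha> \<in> simples G" "x \<in> comp M (up \<mu> \<alpha> n)"
  shows "F0 M \<mu> \<alpha> n x \<in> comp M \<mu>"
  using assms F_in by (auto simp: F0_def)

lemma E0_in:
  assumes "\<mu> \<in> weights G" "\<alpha> \<in> simples G" "x \<in> comp M \<mu>"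
  shows "E0 M \<mu> \<alpha> n x \<in> comp M (up \<mu> \<alpha> n)"
  using assms E_in by (auto simp: E0_def)

lemma F_generated_sum:
  assumes "\<mu> \<in> weights G" "\<And>i. i \<in> I \<Longrightarrow> F_generated G M K \<mu> (f i)"
  shows "F_generated G M K \<mu> (sum f I)"
  using assms(2) by (induction I rule: infinite_finite_induct) (auto intro: F_generated.intros assms(1))

lemma F_generated_subspace: "\<mu> \<in> weights G \<Longrightarrow> md.subspace (Collect (F_generated G M K \<mu>))"
  by (auto simp: md.subspace_def intro: F_generated.intros)

lemma F_generated_in_comp:
  assumes "F_generated G M K \<mu> x" and "\<And>\<mu>. \<mu> \<in> weights G \<Longrightarrow> K \<mu> \<subseteq> comp M \<mu>"
  shows "x \<in> comp M \<mu>"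
  using assms
  by (induction rule: F_generated.induct)
    (auto intro: comp_0 comp_add comp_scl F_in dest: F_generated_weight)

lemma singular_zero: "\<mu> \<in> weights G \<Longrightarrow> singular G M \<mu> 0"
  unfolding singular_def using E_0 comp_0 by blast

text \<open>The image of the row \<open>F\<^sub>\<mu>\<close>, defined by finitely supported families, in the form in which it is used below.
  The work lies in adding families with different supports.\<close>

lemma imF_eq_span:
  assumes \<mu>: "\<mu> \<in> weights G"
  shows "imF G M \<mu> = md.span (\<Union>\<alpha>\<in>simples G. \<Union>n\<in>{0<..}. Fact M \<mu> \<alpha> n ` comp M (up \<mu> \<alpha> n))"
    (is "_ = md.span ?U")
proof
  show "imF G M \<mu> \<subseteq> md.span ?U"
  proof
    fix z assume "z \<in> imF G M \<mu>"
    then obtain y where y: "y \<in> delta G M \<mu>" "z = Frow M \<mu> y" by (auto simp: imF_def)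
    show "z \<in> md.span ?U"
      unfolding y(2) Frow_def
    proof (rule md.span_sum, clarify)
      fix \<alpha> n assume "y (\<alpha>, n) \<noteq> 0"
      then have "\<alpha> \<in> simples G \<and> n > 0 \<and> y (\<alpha>, n) \<in> comp M (up \<mu> \<alpha> n)"
        using y(1) by (auto simp: delta_def split: if_splits)
      then show "Fact M \<mu> \<alpha> n (y (\<alpha>, n)) \<in> md.span ?U" by (intro md.span_base) auto
    qed
  qed
  have F0: "Fact M \<mu> \<alpha> n 0 = 0" if "\<alpha> \<in> simples G" "n > 0" for \<alpha> n
    using F_0[OF \<mu> that] comp_0 up_weights \<mu> that by blast
  (* enlarging the support to a common finite set is harmless because F 0 = 0 on proper letters *)
  have row: "Frow M \<mu> y = (\<Sum>(\<alpha>, n) \<in> S. Fact M \<mu> \<alpha> n (y (\<alpha>, n)))"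
    if y: "y \<in> delta G M \<mu>" and S: "finite S" "{p. y p \<noteq> 0} \<subseteq> S" "S \<subseteq> simples G \<times> {0<..}" for y S
    unfolding Frow_def
    using S F0 by (intro sum.mono_neutral_left) auto
  have supp: "{p. y p \<noteq> 0} \<subseteq> simples G \<times> {0<..}" if "y \<in> delta G M \<mu>" for y
    using that by (auto simp: delta_def) (metis gr0I)+
  have y_in: "y (\<alpha>, n) \<in> comp M (up \<mu> \<alpha> n)" if "y \<in> delta G M \<mu>" "\<alpha> \<in> simples G" "n > 0" for y \<alpha> n
    using that by (simp add: delta_def)
  show "md.span ?U \<subseteq> imF G M \<mu>"
  proof (rule md.span_minimal)
    show "?U \<subseteq> imF G M \<mu>"
    proof clarsimp
      fix \<alpha> n x assume a: "\<alpha> \<in> simples G" "0 < n" "x \<in> comp M (up \<mu> \<alpha> n)"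
      let ?y = "\<lambda>p. if p = (\<alpha>, n) then x else 0"
      have "?y \<in> delta G M \<mu>"
        using a comp_0 up_weights \<mu> by (auto simp: delta_def)
      moreover from this have "Frow M \<mu> ?y = Fact M \<mu> \<alpha> n x"
        using a by (subst row[of _ "{(\<alpha>, n)}"]) auto
      ultimately show "Fact M \<mu> \<alpha> n x \<in> imF G M \<mu>" unfolding imF_def by (metis imageI)
    qed
    show "md.subspace (imF G M \<mu>)"
      unfolding md.subspace_def
    proof (intro conjI ballI allI)
      have "(\<lambda>_. 0) \<in> delta G M \<mu>" using comp_0 up_weights \<mu> by (auto simp: delta_def)
      moreover have "Frow M \<mu> (\<lambda>_. 0) = 0" by (simp add: Frow_def)
      ultimately show "0 \<in> imF G M \<mu>" unfolding imF_def by (metis imageI)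
    next
      fix z z' assume "z \<in> imF G M \<mu>" "z' \<in> imF G M \<mu>"
      then obtain y y' where y: "y \<in> delta G M \<mu>" "z = Frow M \<mu> y" "y' \<in> delta G M \<mu>" "z' = Frow M \<mu> y'"
        by (auto simp: imF_def)
      let ?S = "{p. y p \<noteq> 0} \<union> {p. y' p \<noteq> 0}" and ?w = "\<lambda>p. y p + y' p"
      have fin: "finite ?S" using y by (simp add: delta_def)
      have w: "?w \<in> delta G M \<mu>"
      proof -
        have "{p. ?w p \<noteq> 0} \<subseteq> ?S" by auto
        then have "finite {p. ?w p \<noteq> 0}" using fin finite_subset by blast
        then show ?thesis using y comp_add[OF up_weights[OF \<mu>]] by (auto simp: delta_def)
      qed
      have "Frow M \<mu> ?w = (\<Sum>(\<alpha>, n) \<in> ?S. Fact M \<mu> \<alpha> n (?w (\<alpha>, n)))"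
        using supp[OF y(1)] supp[OF y(3)] by (intro row[OF w fin] Un_least) auto
      also have "\<dots> = (\<Sum>(\<alpha>, n) \<in> ?S. Fact M \<mu> \<alpha> n (y (\<alpha>, n)) + Fact M \<mu> \<alpha> n (y' (\<alpha>, n)))"
      proof (intro sum.cong refl, clarify)
        fix \<alpha> n assume "(\<alpha>, n) \<in> ?S"
        then have "\<alpha> \<in> simples G" "n > 0" using supp y by blast+
        then show "Fact M \<mu> \<alpha> n (y (\<alpha>, n) + y' (\<alpha>, n)) = Fact M \<mu> \<alpha> n (y (\<alpha>, n)) + Fact M \<mu> \<alpha> n (y' (\<alpha>, n))"
          using F_add[OF \<mu>] y_in y by simp
      qed
      also have "\<dots> = z + z'"
      proof -
        have S: "?S \<subseteq> simples G \<times> {0<..}" using supp y by blast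
        have "z = (\<Sum>(\<alpha>, n) \<in> ?S. Fact M \<mu> \<alpha> n (y (\<alpha>, n)))"
          unfolding y(2) by (rule row[OF y(1) fin Un_upper1 S])
        moreover have "z' = (\<Sum>(\<alpha>, n) \<in> ?S. Fact M \<mu> \<alpha> n (y' (\<alpha>, n)))"
          unfolding y(4) by (rule row[OF y(3) fin Un_upper2 S])
        ultimately show ?thesis by (simp only: sum.distrib case_prod_beta')
      qed
      finally show "z + z' \<in> imF G M \<mu>" using w unfolding imF_def by (metis imageI)
    next
      fix c z assume "z \<in> imF G M \<mu>"
      then obtain y where y: "y \<in> delta G M \<mu>" "z = Frow M \<mu> y"
        by (auto simp: imF_def)
      let ?S = "{p. y p \<noteq> 0}" and ?w = "\<lambda>p. scl M c (y p)"
      have fin: "finite ?S" using y by (simp add: delta_def)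
      have w: "?w \<in> delta G M \<mu>"
      proof -
        have "{p. ?w p \<noteq> 0} \<subseteq> ?S" by auto
        then have "finite {p. ?w p \<noteq> 0}" using fin finite_subset by blast
        then show ?thesis using y comp_scl[OF up_weights[OF \<mu>]] by (auto simp: delta_def)
      qed
      have "Frow M \<mu> ?w = (\<Sum>(\<alpha>, n) \<in> ?S. Fact M \<mu> \<alpha> n (?w (\<alpha>, n)))"
        using supp[OF y(1)] by (intro row[OF w fin]) auto
      also have "\<dots> = (\<Sum>(\<alpha>, n) \<in> ?S. scl M c (Fact M \<mu> \<alpha> n (y (\<alpha>, n))))"
      proof (intro sum.cong refl, clarify)
        fix \<alpha> n assume "y (\<alpha>, n) \<noteq> 0"
        then have "\<alpha> \<in> simples G" "n > 0" using supp y by blast+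
        then show "Fact M \<mu> \<alpha> n (scl M c (y (\<alpha>, n))) = scl M c (Fact M \<mu> \<alpha> n (y (\<alpha>, n)))"
          using F_scl[OF \<mu>] y_in y by simp
      qed
      also have "\<dots> = scl M c z"
        by (simp add: y(2) Frow_def case_prod_beta' md.scale_sum_right)
      finally show "scl M c z \<in> imF G M \<mu>" using w unfolding imF_def by (metis imageI)
    qed
  qed
qed

lemma imF_subspace: "\<mu> \<in> weights G \<Longrightarrow> md.subspace (imF G M \<mu>)"
  by (simp add: imF_eq_span)

lemma F_in_imF:
  assumes "\<mu> \<in> weights G" "\<alpha> \<in> simples G" "n > 0" "x \<in> comp M (up \<mu> \<alpha> n)"
  shows "Fact M \<mu> \<alpha> n x \<in> imF G M \<mu>"
  unfolding imF_eq_span[OF assms(1)] using assms by (intro md.span_base) auto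

lemma imF_subset:
  assumes "\<mu> \<in> weights G" "md.subspace T"
    "\<And>\<alpha> n x. \<alpha> \<in> simples G \<Longrightarrow> n > 0 \<Longrightarrow> x \<in> comp M (up \<mu> \<alpha> n) \<Longrightarrow> Fact M \<mu> \<alpha> n x \<in> T"
  shows "imF G M \<mu> \<subseteq> T"
  unfolding imF_eq_span[OF assms(1)] using assms by (intro md.span_minimal) auto

lemma imF_in_comp: "\<mu> \<in> weights G \<Longrightarrow> imF G M \<mu> \<subseteq> comp M \<mu>"
  by (rule imF_subset) (auto intro: comp_subspace F_in)

lemma Ecol_eq_iff:
  "Ecol G M \<mu> x = Ecol G M \<mu> y \<longleftrightarrow> (\<forall>\<alpha>\<in>simples G. \<forall>n>0. Eact M \<mu> \<alpha> n x = Eact M \<mu> \<alpha> n y)"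
  by (auto simp: Ecol_def fun_eq_iff)

text \<open>Thus the injectivity of \<open>E\<^sub>\<mu>\<close> on a submodule of the weight space says that the submodule contains no
  nonzero singular vector.\<close>

lemma Ecol_eq_iff_singular:
  assumes "\<mu> \<in> weights G" "x \<in> comp M \<mu>" "y \<in> comp M \<mu>"
  shows "Ecol G M \<mu> x = Ecol G M \<mu> y \<longleftrightarrow> singular G M \<mu> (x - y)"
  unfolding Ecol_eq_iff singular_def using assms by (simp add: E_diff)

text \<open>Every element produced by an \<open>F\<close> lies in the image of \<open>F\<^sub>\<mu>\<close>, so modulo this image only the generators
  of weight \<open>\<mu>\<close> themselves remain.\<close>

lemma F_generated_decompose:
  assumes K: "\<And>\<mu>. \<mu> \<in> weights G \<Longrightarrow> K \<mu> \<subseteq> comp M \<mu>" and x: "F_generated G M K \<mu> x"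
  shows "\<exists>y\<in>md.span (K \<mu>). x - y \<in> imF G M \<mu>"
  using x
proof (induction rule: F_generated.induct)
  case (base \<mu> x)
  then show ?case using imF_subspace md.subspace_0 md.span_base by (metis cancel_comm_monoid_add_class.diff_cancel)
next
  case (zero \<mu>)
  then show ?case using imF_subspace md.subspace_0 md.span_zero by (metis diff_zero)
next
  case (add \<mu> x y)
  then obtain a b where "a \<in> md.span (K \<mu>)" "x - a \<in> imF G M \<mu>" "b \<in> md.span (K \<mu>)" "y - b \<in> imF G M \<mu>"
    by blast
  moreover have "x + y - (a + b) = (x - a) + (y - b)" by simp
  ultimately show ?case
    using md.subspace_add[OF imF_subspace] add F_generated_weight md.span_add by metis
next
  case (scl \<mu> x c)
  then obtain a where "a \<in> md.span (K \<mu>)" "x - a \<in> imF G M \<mu>" by blast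
  then show ?case
    using md.subspace_scale[OF imF_subspace] scl F_generated_weight md.span_scale md.scale_right_diff_distrib by metis
next
  case (act \<mu> \<alpha> n x)
  have "Fact M \<mu> \<alpha> n x - 0 \<in> imF G M \<mu>" using act F_generated_in_comp[OF _ K] F_in_imF by simp
  then show ?case using md.span_zero by blast
qed

text \<open>By descending induction: the weight space is generated by \<open>K \<mu>\<close> and the images under the finitely many
  relevant \<open>F\<close>'s of generators of higher weight spaces.\<close>

lemma F_generated_finitely_generated:
  assumes qb: "quasi_bounded G {\<mu> \<in> weights G. comp M \<mu> \<noteq> {0}}"
    and K: "\<And>\<mu>. \<mu> \<in> weights G \<Longrightarrow> K \<mu> \<subseteq> comp M \<mu> \<and> finite (K \<mu>) \<and> comp M \<mu> \<subseteq> Collect (F_generated G M K \<mu>)"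
    and "\<mu> \<in> weights G"
  shows "finitely_generated (scl M) (comp M \<mu>)"
  using qb \<open>\<mu> \<in> weights G\<close>
proof (induction rule: quasi_bounded_induct)
  case (outside \<mu>)
  then have "comp M \<mu> = md.span {}" by simp
  then show ?case unfolding finitely_generated_def by blast
next
  case (step \<mu>)
  define B where "B \<alpha> n = (SOME B. finite B \<and> md.span B = comp M (up \<mu> \<alpha> n))" for \<alpha> n
  have B: "finite (B \<alpha> n) \<and> md.span (B \<alpha> n) = comp M (up \<mu> \<alpha> n)" if "\<alpha> \<in> simples G" "n > 0" for \<alpha> n
    unfolding B_def using step.IH[OF that] unfolding finitely_generated_def by (rule someI_ex)
  define Q where "Q = {(\<alpha>, n). \<alpha> \<in> simples G \<and> n > 0 \<and> up \<mu> \<alpha> n \<in> {\<mu> \<in> weights G. comp M \<mu> \<noteq> {0}}}"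
  have finQ: "finite Q" unfolding Q_def using finite_letters[OF qb step.hyps] .
  define T where "T = K \<mu> \<union> (\<Union>(\<alpha>, n)\<in>Q. Fact M \<mu> \<alpha> n ` B \<alpha> n)"
  have finT: "finite T" using finQ K step.hyps B unfolding T_def Q_def by auto
  have "B \<alpha> n \<subseteq> comp M (up \<mu> \<alpha> n)" if "(\<alpha>, n) \<in> Q" for \<alpha> n
    using that B[of \<alpha> n] md.span_superset[of "B \<alpha> n"] by (simp add: Q_def)
  then have "Fact M \<mu> \<alpha> n ` B \<alpha> n \<subseteq> comp M \<mu>" if "(\<alpha>, n) \<in> Q" for \<alpha> n
    using that F_in[OF step.hyps, of \<alpha> n] by (auto simp: Q_def)
  then have "T \<subseteq> comp M \<mu>"
    using K[OF step.hyps] by (auto simp: T_def)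
  then have "md.span T \<subseteq> comp M \<mu>" using comp_subspace step.hyps by (simp add: md.span_minimal)
  moreover have "comp M \<mu> \<subseteq> md.span T"
  proof
    fix x assume "x \<in> comp M \<mu>"
    then obtain y where y: "y \<in> md.span (K \<mu>)" "x - y \<in> imF G M \<mu>"
      using F_generated_decompose[of K \<mu> x] K step.hyps by blast
    have "imF G M \<mu> \<subseteq> md.span T"
    proof (rule imF_subset[OF step.hyps md.subspace_span])
      fix \<alpha> n z assume a: "\<alpha> \<in> simples G" "(n::nat) > 0" and z: "z \<in> comp M (up \<mu> \<alpha> n)"
      show "Fact M \<mu> \<alpha> n z \<in> md.span T"
      proof (cases "(\<alpha>, n) \<in> Q")
        case True
        have "z \<in> md.span (B \<alpha> n)" using z B a by simp
        then have "Fact M \<mu> \<alpha> n z \<in> md.span T \<and> z \<in> comp M (up \<mu> \<alpha> n)"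
        proof (induction rule: md.span_induct_alt)
          case base
          then show ?case using F_0[OF step.hyps a] comp_0 up_weights[OF step.hyps] a md.span_zero by metis
        next
          case (step c x y)
          have x: "x \<in> comp M (up \<mu> \<alpha> n)" using step(1) B[OF a] md.span_base by blast
          have "Fact M \<mu> \<alpha> n x \<in> md.span T" using step(1) True by (auto simp: T_def intro!: md.span_base)
          then show ?case
            using x step(2) F_add[OF \<open>\<mu> \<in> weights G\<close> a] F_scl[OF \<open>\<mu> \<in> weights G\<close> a]
              comp_add[OF up_weights[OF \<open>\<mu> \<in> weights G\<close> a(1)]]
              comp_scl[OF up_weights[OF \<open>\<mu> \<in> weights G\<close> a(1)]]
            by (auto intro!: md.span_add md.span_scale)
        qed
        then show ?thesis by simp
      next
        case False
        then have "z = 0" using z a up_weights step.hyps by (auto simp: Q_def)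
        then show ?thesis using F_0[OF step.hyps a z] md.span_zero by simp
      qed
    qed
    moreover have "md.span (K \<mu>) \<subseteq> md.span T" by (rule md.span_mono) (simp add: T_def)
    ultimately show "x \<in> md.span T"
      using y md.span_add[of "x - y" T y] by auto
  qed
  ultimately show ?case using finT unfolding finitely_generated_def by blast
qed

text \<open>The coordinate forms vanish on the image of \<open>F\<^sub>\<mu>\<close>. Therefore a singular vector in this image is zero,
  which is the injectivity in \<open>X3\<close>, and \<open>K \<mu>\<close> is a basis of the quotient by the image, which is the
  freeness. As \<open>M\<^sub>\<mu>\<close> is the sum of the image and of singular vectors, \<open>E\<^sub>\<mu>\<close> takes no values besides those
  on the image; this is minimality, and it makes the torsion condition trivial.\<close>

lemma highest_weight_basis_obj_minimal:
  assumes hw: "highest_weight_basis G M K l" and X2: "X2 G M"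
    and qb: "quasi_bounded G {\<mu> \<in> weights G. comp M \<mu> \<noteq> {0}}"
  shows "obj G M" and "minimal G M"
proof -
  have K: "K \<mu> \<subseteq> comp M \<mu> \<and> finite (K \<mu>) \<and> comp M \<mu> \<subseteq> Collect (F_generated G M K \<mu>)" if "\<mu> \<in> weights G" for \<mu>
    using hw that by (simp add: highest_weight_basis_iff)
  have X1: "X1 G M" unfolding X1_def using qb F_generated_finitely_generated[OF qb K] by simp
  have l_imF: "l \<mu> k x = 0" if \<mu>: "\<mu> \<in> weights G" and k: "k \<in> K \<mu>" and "x \<in> imF G M \<mu>" for \<mu> k x
  proof -
    have lin: "linear_between (scl M) (*) (comp M \<mu>) UNIV (l \<mu> k)" and
      F: "\<forall>\<alpha>\<in>simples G. \<forall>n>0. \<forall>x\<in>comp M (up \<mu> \<alpha> n). l \<mu> k (Fact M \<mu> \<alpha> n x) = 0"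
      using hw \<mu> k by (simp_all add: highest_weight_basis_iff)
    have "md.subspace {x \<in> comp M \<mu>. l \<mu> k x = 0}"
      using lin linear_between_0[OF lin] comp_0 comp_add comp_scl \<mu>
      by (auto simp: md.subspace_def linear_between_def)
    then have "imF G M \<mu> \<subseteq> {x \<in> comp M \<mu>. l \<mu> k x = 0}"
      using F F_in \<mu> by (intro imF_subset) auto
    then show ?thesis using that by blast
  qed
  have inj: "x = 0" if "\<mu> \<in> weights G" "x \<in> imF G M \<mu>" "singular G M \<mu> x" for \<mu> x
  proof -
    have "\<forall>x\<in>comp M \<mu>. singular G M \<mu> x \<and> (\<forall>k\<in>K \<mu>. l \<mu> k x = 0) \<longrightarrow> x = 0"
      using hw that(1) by (simp add: highest_weight_basis_iff)
    then show ?thesis using that l_imF[OF that(1)] imF_in_comp[OF that(1)] by blast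
  qed
  have decomp: "\<exists>y\<in>md.span (K \<mu>). x - y \<in> imF G M \<mu>" if "\<mu> \<in> weights G" "x \<in> comp M \<mu>" for x \<mu>
    using that K F_generated_decompose[of K \<mu> x] by blast
  show min: "minimal G M"
    unfolding minimal_def curly_def angle_def
  proof (intro ballI subset_antisym)
    fix \<mu> assume \<mu>: "\<mu> \<in> weights G"
    show "Ecol G M \<mu> ` imF G M \<mu> \<subseteq> Ecol G M \<mu> ` comp M \<mu>" using imF_in_comp[OF \<mu>] by blast
    show "Ecol G M \<mu> ` comp M \<mu> \<subseteq> Ecol G M \<mu> ` imF G M \<mu>"
    proof
      fix z assume "z \<in> Ecol G M \<mu> ` comp M \<mu>"
      then obtain x where x: "x \<in> comp M \<mu>" "z = Ecol G M \<mu> x" by blast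
      obtain y where y: "y \<in> md.span (K \<mu>)" "x - y \<in> imF G M \<mu>" using decomp[OF \<mu> x(1)] by blast
      (* the part of x outside the image of F is a combination of singular vectors *)
      have "y \<in> comp M \<mu> \<and> singular G M \<mu> y"
        using y(1)
      proof (induction rule: md.span_induct_alt)
        case base
        then show ?case using singular_zero comp_0 \<mu> by blast
      next
        case (step c x y)
        then have "x \<in> comp M \<mu>" "singular G M \<mu> x" using hw \<mu> by (auto simp: highest_weight_basis_iff)
        then show ?case using step comp_scl[OF \<mu>] comp_add[OF \<mu>] E_add[OF \<mu>] E_scl[OF \<mu>] by (auto simp: singular_def)
      qed
      then have "Ecol G M \<mu> x = Ecol G M \<mu> (x - y)"
        using Ecol_eq_iff_singular[OF \<mu> x(1)] comp_diff[OF \<mu>] x by simp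
      then show "z \<in> Ecol G M \<mu> ` imF G M \<mu>" using x y by blast
    qed
  qed
  have "X3 G M"
    unfolding X3_def
  proof (intro ballI conjI)
    fix \<mu> assume \<mu>: "\<mu> \<in> weights G"
    show "inj_on (Ecol G M \<mu>) (imF G M \<mu>)"
    proof (rule inj_onI)
      fix x y assume xy: "x \<in> imF G M \<mu>" "y \<in> imF G M \<mu>" "Ecol G M \<mu> x = Ecol G M \<mu> y"
      then have "singular G M \<mu> (x - y)" using Ecol_eq_iff_singular[OF \<mu>] imF_in_comp[OF \<mu>] by blast
      then have "x - y = 0" using inj[OF \<mu>] md.subspace_diff[OF imF_subspace[OF \<mu>]] xy by blast
      then show "x = y" by simp
    qed
    show "torsion_quotient (\<lambda>a y p. scl M a (y p)) (angle G M \<mu>) (curly G M \<mu>)"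
      using min \<mu> unfolding torsion_quotient_def minimal_def by (auto intro!: exI[of _ 1])
    show "free_quotient (scl M) (comp M \<mu>) (imF G M \<mu>)"
      unfolding free_quotient_def
    proof (intro exI[of _ "K \<mu>"] conjI allI impI ballI)
      show "K \<mu> \<subseteq> comp M \<mu>" using K \<mu> by blast
      show "\<exists>y\<in>md.span (K \<mu>). x - y \<in> imF G M \<mu>" if "x \<in> comp M \<mu>" for x using decomp \<mu> that by blast
    next
      fix T u k assume T: "finite T \<and> T \<subseteq> K \<mu> \<and> (\<Sum>b\<in>T. scl M (u b) b) \<in> imF G M \<mu>" and k: "k \<in> T"
      then have kK: "k \<in> K \<mu>" by blast
      have lin: "linear_between (scl M) (*) (comp M \<mu>) UNIV (l \<mu> k)" and
        d: "\<forall>k'\<in>K \<mu>. l \<mu> k k' = (if k' = k then 1 else 0)"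
        using hw \<mu> kK by (simp_all add: highest_weight_basis_iff)
      have "0 = l \<mu> k (\<Sum>b\<in>T. scl M (u b) b)" using l_imF[OF \<mu> kK] T by simp
      also have "\<dots> = (\<Sum>b\<in>T. u b * l \<mu> k b)"
        using T K \<mu> by (intro linear_between_sum[OF lin md.module_axioms comp_subspace[OF \<mu>]]) blast
      also have "\<dots> = (\<Sum>b\<in>T. if b = k then u b else 0)"
        using T d by (intro sum.cong) auto
      also have "\<dots> = u k" using T k by simp
      finally show "u k = 0" by simp
    qed
  qed
  then show "obj G M" using ops X1 X2 by (simp add: obj_def)
qed

end

section \<open>Submodules generated by singular vectors\<close>

definition generated ::
  "('v::real_vector, 'a) ground \<Rightarrow> ('v, 'a, 'm::ab_group_add) gobj \<Rightarrow> ('v \<Rightarrow> 'm set) \<Rightarrow> ('v, 'a, 'm) gobj" where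
  "generated G M K = M\<lparr>comp := \<lambda>\<mu>. Collect (F_generated G M K \<mu>)\<rparr>"

lemma generated_simps [simp]:
  "scl (generated G M K) = scl M"
  "comp (generated G M K) \<mu> = Collect (F_generated G M K \<mu>)"
  "Eact (generated G M K) = Eact M"
  "Fact (generated G M K) = Fact M"
  by (simp_all add: generated_def)

lemma E0_F0_generated [simp]: "E0 (generated G M K) = E0 M" "F0 (generated G M K) = F0 M"
  by (simp_all add: E0_def F0_def fun_eq_iff)

lemma F_generated_in_generated: "F_generated G (generated G M K) L = F_generated G M L"
  by (simp add: generated_def F_generated_comp_update)

lemma singular_generated: "singular G (generated G M K) = singular G M"
  by (simp add: singular_def fun_eq_iff)

context graded_module
begin

lemma X2_other:
  assumes "X2 G M" "\<mu> \<in> weights G" "\<alpha> \<in> simples G" "\<beta> \<in> simples G" "m > 0" "n > 0"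
    "x \<in> comp M (up \<mu> \<beta> n)" "\<alpha> \<noteq> \<beta>"
  shows "Eact M \<mu> \<alpha> m (Fact M \<mu> \<beta> n x) = Fact M (up \<mu> \<alpha> m) \<beta> n (Eact M (up \<mu> \<beta> n) \<alpha> m x)"
proof -
  have "E0 M \<mu> \<alpha> m (F0 M \<mu> \<beta> n x) = F0 M (up \<mu> \<alpha> m) \<beta> n (E0 M (up \<mu> \<beta> n) \<alpha> m x)"
    using assms unfolding X2_def by blast
  then show ?thesis using assms by (simp add: E0_def F0_def)
qed

lemma X2_same:
  assumes "X2 G M" "\<mu> \<in> weights G" "\<alpha> \<in> simples G" "m > 0" "n > 0" "x \<in> comp M (up \<mu> \<alpha> n)"
  shows "Eact M \<mu> \<alpha> m (Fact M \<mu> \<alpha> n x) = (\<Sum>r=0..min m n.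
                scl M (zmap G (qbinom (dnum G \<alpha>) (\<lfloor>coroot G \<alpha> \<mu>\<rfloor> + int m + int n) r))
                  (F0 M (up \<mu> \<alpha> m) \<alpha> (n - r) (E0 M (up \<mu> \<alpha> n) \<alpha> (m - r) x)))"
proof -
  have "E0 M \<mu> \<alpha> m (F0 M \<mu> \<alpha> n x) = (\<Sum>r=0..min m n.
                scl M (zmap G (qbinom (dnum G \<alpha>) (\<lfloor>coroot G \<alpha> \<mu>\<rfloor> + int m + int n) r))
                  (F0 M (up \<mu> \<alpha> m) \<alpha> (n - r) (E0 M (up \<mu> \<alpha> n) \<alpha> (m - r) x)))"
    using assms unfolding X2_def by blast
  then show ?thesis using assms by (simp add: E0_def F0_def)
qed

text \<open>The commutation rules move an \<open>E\<close> past every \<open>F\<close> until it meets a generator, which it kills.\<close>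

lemma F_generated_E:
  assumes X2: "X2 G M"
    and K: "\<And>\<mu>. \<mu> \<in> weights G \<Longrightarrow> K \<mu> \<subseteq> comp M \<mu>"
      "\<And>\<mu> k. \<mu> \<in> weights G \<Longrightarrow> k \<in> K \<mu> \<Longrightarrow> singular G M \<mu> k"
    and "F_generated G M K \<mu> x" "\<alpha> \<in> simples G" "m > 0"
  shows "F_generated G M K (up \<mu> \<alpha> m) (Eact M \<mu> \<alpha> m x)"
  using assms(4-)
proof (induction arbitrary: \<alpha> m rule: F_generated.induct)
  case (base \<mu> x)
  then have "Eact M \<mu> \<alpha> m x = 0" using K by (simp add: singular_def)
  then show ?case using base by (simp add: F_generated.zero up_weights)
next
  case (zero \<mu>)
  then show ?case using E_0[OF _ _ _ comp_0] by (simp add: F_generated.zero up_weights)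
next
  case (add \<mu> x y)
  then have "Eact M \<mu> \<alpha> m (x + y) = Eact M \<mu> \<alpha> m x + Eact M \<mu> \<alpha> m y"
    using F_generated_in_comp[OF add.hyps(1) K(1)] F_generated_in_comp[OF add.hyps(2) K(1)] F_generated_weight[OF add.hyps(1)]
    by (intro E_add)
  then show ?case using add by (simp add: F_generated.add)
next
  case (scl \<mu> x a)
  then have "Eact M \<mu> \<alpha> m (scl M a x) = scl M a (Eact M \<mu> \<alpha> m x)"
    using F_generated_in_comp[OF scl.hyps K(1)] F_generated_weight[OF scl.hyps] by (intro E_scl)
  then show ?case using scl by (simp add: F_generated.scl)
next
  case (act \<mu> \<beta> n x)
  have x: "x \<in> comp M (up \<mu> \<beta> n)" using F_generated_in_comp[OF act.hyps(4) K(1)] .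
  have w: "up \<mu> \<alpha> m \<in> weights G" using act.hyps(1) act.prems(1) by (rule up_weights)
  show ?case
  proof (cases "\<alpha> = \<beta>")
    case False
    show ?thesis
      unfolding X2_other[OF X2 act.hyps(1) act.prems(1) act.hyps(2) act.prems(2) act.hyps(3) x False]
      using act.IH[OF act.prems] w act.hyps by (intro F_generated.act) (simp_all add: up_up_commute)
  next
    case True
    note a = act.prems act.hyps
    show ?thesis
      unfolding True
    proof (subst X2_same[OF X2], (use a x True in simp_all)[5], intro F_generated_sum F_generated.scl)
      show "up \<mu> \<beta> m \<in> weights G" using w True by simp
    next
      fix r assume r: "r \<in> {0..min m n}"
      let ?z = "E0 M (up \<mu> \<beta> n) \<beta> (m - r) x"
      have "F_generated G M K (up (up \<mu> \<beta> n) \<beta> (m - r)) ?z"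
        using act.IH[of \<beta> "m - r"] act.hyps by (auto simp: E0_def)
      moreover have "up (up \<mu> \<beta> n) \<beta> (m - r) = up (up \<mu> \<beta> m) \<beta> (n - r)"
        using r by (simp add: up_up add.commute)
      ultimately show "F_generated G M K (up \<mu> \<beta> m) (F0 M (up \<mu> \<beta> m) \<beta> (n - r) ?z)"
        using w True act.hyps by (auto simp: F0_def intro: F_generated.act)
    qed
  qed
qed

lemma generated_graded_module:
  assumes X2: "X2 G M"
    and K: "\<And>\<mu>. \<mu> \<in> weights G \<Longrightarrow> K \<mu> \<subseteq> comp M \<mu>"
      "\<And>\<mu> k. \<mu> \<in> weights G \<Longrightarrow> k \<in> K \<mu> \<Longrightarrow> singular G M \<mu> k"
  shows "graded_module G (generated G M K)" and "X2 G (generated G M K)"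
proof -
  note in_comp = F_generated_in_comp[OF _ K(1)]
  have "linear_between (scl M) (scl M) (Collect (F_generated G M K \<mu>)) (Collect (F_generated G M K (up \<mu> \<alpha> n))) (Eact M \<mu> \<alpha> n)"
    and "linear_between (scl M) (scl M) (Collect (F_generated G M K (up \<mu> \<alpha> n))) (Collect (F_generated G M K \<mu>)) (Fact M \<mu> \<alpha> n)"
    if "\<mu> \<in> weights G" "\<alpha> \<in> simples G" "n > 0" for \<mu> \<alpha> n
    using that F_generated_E[OF X2 K _ that(2,3)] F_generated.act[OF that] in_comp E_linear[OF that] F_linear[OF that]
    unfolding linear_between_def by auto
  then show "graded_module G (generated G M K)"
    using md.module_axioms F_generated_subspace ground
    by unfold_locales (simp add: graded_operators_def)
  show "X2 G (generated G M K)"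
    using X2 in_comp unfolding X2_def by simp
qed

end

section \<open>The coinduced module on words\<close>

fun weight :: "('v::real_vector \<times> nat) list \<Rightarrow> 'v" where
  "weight [] = 0"
| "weight ((\<alpha>, n) # u) = real n *\<^sub>R \<alpha> + weight u"

text \<open>A word \<open>[(\<alpha>\<^sub>1, n\<^sub>1), \<dots>]\<close> stands for the operators \<open>E\<^bsub>\<alpha>\<^sub>1,n\<^sub>1\<^esub>\<close>, \<open>E\<^bsub>\<alpha>\<^sub>2,n\<^sub>2\<^esub>\<close>, \<open>\<dots>\<close> applied in this order, head first.\<close>

definition letters :: "('v, 'a) ground \<Rightarrow> ('v \<times> nat) set" where
  "letters G = simples G \<times> {0<..}"

text \<open>The action of \<open>E\<^bsub>\<alpha>,m\<^esub>\<close> on functions on words, with \<open>E\<^bsub>\<alpha>,0\<^esub> = id\<close>.\<close>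

definition shift :: "'v \<Rightarrow> nat \<Rightarrow> (('v \<times> nat) list \<Rightarrow> 'a) \<Rightarrow> ('v \<times> nat) list \<Rightarrow> 'a" where
  "shift \<alpha> m \<phi> = (if m = 0 then \<phi> else (\<lambda>u. \<phi> ((\<alpha>, m) # u)))"

text \<open>The value at the word \<open>u\<close> of \<open>F\<^bsub>\<alpha>,n\<^esub> \<phi>\<close>, for \<open>\<phi>\<close> of weight \<open>\<mu> + n\<alpha>\<close>. The value of a function at \<open>(\<beta>, m) # u\<close>
  is the value of its image under \<open>E\<^bsub>\<beta>,m\<^esub>\<close> at \<open>u\<close>, so the commutation rules between \<open>E\<^bsub>\<beta>,m\<^esub>\<close> and \<open>F\<^bsub>\<alpha>,n\<^esub>\<close>
  leave no choice on nonempty words. The value at the empty word is \<open>0\<close> for \<open>n > 0\<close>: it belongs to the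
  weight \<open>\<nu>\<close>, on which the form defining a matrix coefficient is to vanish on images of \<open>F\<close>.\<close>

fun coinduced_F :: "('v::real_vector, 'a::comm_ring_1) ground \<Rightarrow> ('v \<times> nat) list \<Rightarrow> 'v \<Rightarrow> 'v \<Rightarrow> nat
    \<Rightarrow> (('v \<times> nat) list \<Rightarrow> 'a) \<Rightarrow> 'a" where
  "coinduced_F G [] \<mu> \<alpha> n \<phi> = (if n = 0 then \<phi> [] else 0)"
| "coinduced_F G ((\<beta>, m) # u) \<mu> \<alpha> n \<phi> =
    (if n = 0 then \<phi> ((\<beta>, m) # u)
     else if (\<beta>, m) \<notin> letters G then 0
     else if \<beta> \<noteq> \<alpha> then coinduced_F G u (up \<mu> \<beta> m) \<alpha> n (shift \<beta> m \<phi>)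
     else (\<Sum>r=0..min m n. zmap G (qbinom (dnum G \<alpha>) (\<lfloor>coroot G \<alpha> \<mu>\<rfloor> + int m + int n) r)
        * coinduced_F G u (up \<mu> \<alpha> m) \<alpha> (n - r) (shift \<alpha> (m - r) \<phi>)))"

lemma coinduced_F_0: "coinduced_F G u \<mu> \<alpha> 0 \<phi> = \<phi> u"
  by (cases u) auto

text \<open>The weight space of weight \<open>\<mu>\<close>: a word contributes only if it leads from \<open>\<mu>\<close> to the highest weight \<open>\<nu>\<close>.\<close>

definition supported :: "('v::real_vector, 'a) ground \<Rightarrow> 'v \<Rightarrow> 'v \<Rightarrow> (('v \<times> nat) list \<Rightarrow> 'b::zero) \<Rightarrow> bool" where
  "supported G \<nu> \<mu> \<phi> \<longleftrightarrow> (\<forall>u. \<phi> u \<noteq> 0 \<longrightarrow> set u \<subseteq> letters G \<and> \<mu> + weight u = \<nu>)"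

text \<open>The module of all functions on words, coinduced from the highest weight. It only serves as the ambient
  module: the operators \<open>F\<close> need not generate it from the vacuum, as minimality would require.\<close>

definition coverma :: "('v::real_vector, 'a::comm_ring_1) ground \<Rightarrow> 'v \<Rightarrow> ('v, 'a, ('v \<times> nat) list \<Rightarrow> 'a) gobj" where
  "coverma G \<nu> = \<lparr>
     scl = (\<lambda>a \<phi> u. a * \<phi> u),
     comp = (\<lambda>\<mu>. Collect (supported G \<nu> \<mu>)),
     Eact = (\<lambda>\<mu> \<alpha> n \<phi> u. \<phi> ((\<alpha>, n) # u)),
     Fact = (\<lambda>\<mu> \<alpha> n \<phi> u. coinduced_F G u \<mu> \<alpha> n \<phi>)\<rparr>"

lemma supported_shift:
  assumes "supported G \<nu> \<mu> \<phi>" shows "supported G \<nu> (up \<mu> \<alpha> m) (shift \<alpha> m \<phi>)"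
proof (cases "m = 0")
  case False
  have "set u \<subseteq> letters G \<and> up \<mu> \<alpha> m + weight u = \<nu>" if "\<phi> ((\<alpha>, m) # u) \<noteq> 0" for u
    using assms that unfolding supported_def up_def
    by (metis add.assoc insert_subset list.simps(15) weight.simps(2))
  then show ?thesis using False by (simp add: supported_def shift_def)
qed (use assms in \<open>simp add: shift_def\<close>)

text \<open>Each recursive call moves along one letter: the weight of the function and the base weight \<open>\<mu>\<close> rise
  by the same amount, in the case of equal roots after \<open>r\<close> has been cancelled on both sides.\<close>

lemma supported_coinduced_F:
  assumes "supported G \<nu> (up \<mu> \<alpha> n) \<phi>" shows "supported G \<nu> \<mu> (\<lambda>u. coinduced_F G u \<mu> \<alpha> n \<phi>)"
proof -
  have "set u \<subseteq> letters G \<and> \<mu> + weight u = \<nu>"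
    if "coinduced_F G u \<mu> \<alpha> n \<phi> \<noteq> 0" "supported G \<nu> (up \<mu> \<alpha> n) \<phi>" for u
    using that
  proof (induction u arbitrary: \<mu> n \<phi>)
    case Nil
    then show ?case by (auto simp: supported_def split: if_splits)
  next
    case (Cons p u)
    obtain \<beta> m where p: "p = (\<beta>, m)" by (cases p)
    show ?case
    proof (cases "n = 0")
      case True
      then have "\<phi> (p # u) \<noteq> 0" "supported G \<nu> \<mu> \<phi>" using Cons.prems by (simp_all add: p)
      then show ?thesis unfolding supported_def by blast
    next
      case n: False
      then have l: "(\<beta>, m) \<in> letters G" using Cons.prems p by (auto split: if_splits)
      have "\<exists>j \<psi>. coinduced_F G u (up \<mu> \<beta> m) \<alpha> j \<psi> \<noteq> 0 \<and> supported G \<nu> (up (up \<mu> \<beta> m) \<alpha> j) \<psi>"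
      proof (cases "\<beta> = \<alpha>")
        case False
        have "coinduced_F G u (up \<mu> \<beta> m) \<alpha> n (shift \<beta> m \<phi>) \<noteq> 0" using Cons.prems n l False p by simp
        moreover have "supported G \<nu> (up (up \<mu> \<beta> m) \<alpha> n) (shift \<beta> m \<phi>)"
          using supported_shift[OF Cons.prems(2), of \<beta> m] by (simp add: up_up_commute[of \<mu> \<alpha> n])
        ultimately show ?thesis by blast
      next
        case True
        obtain r where r: "r \<in> {0..min m n}" "coinduced_F G u (up \<mu> \<alpha> m) \<alpha> (n - r) (shift \<alpha> (m - r) \<phi>) \<noteq> 0"
        proof (rule sum.not_neutral_contains_not_neutral)
          show "(\<Sum>r=0..min m n. zmap G (qbinom (dnum G \<alpha>) (\<lfloor>coroot G \<alpha> \<mu>\<rfloor> + int m + int n) r)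
              * coinduced_F G u (up \<mu> \<alpha> m) \<alpha> (n - r) (shift \<alpha> (m - r) \<phi>)) \<noteq> 0"
            using Cons.prems(1) n l True p by simp
        qed (use that in \<open>metis mult_zero_right\<close>)
        have "up (up \<mu> \<alpha> n) \<alpha> (m - r) = up (up \<mu> \<alpha> m) \<alpha> (n - r)" using r by (simp add: up_up add.commute)
        then have "supported G \<nu> (up (up \<mu> \<alpha> m) \<alpha> (n - r)) (shift \<alpha> (m - r) \<phi>)"
          using supported_shift[OF Cons.prems(2), of \<alpha> "m - r"] by simp
        then show ?thesis using r True by blast
      qed
      then have "set u \<subseteq> letters G \<and> up \<mu> \<beta> m + weight u = \<nu>" using Cons.IH by blast
      then show ?thesis using l p by (simp add: up_def add.assoc)
    qed
  qed
  then show ?thesis using assms by (simp add: supported_def)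
qed

lemma shift_add: "shift \<alpha> m (\<lambda>u. \<phi> u + \<psi> u) = (\<lambda>u. shift \<alpha> m \<phi> u + shift \<alpha> m \<psi> u)"
  by (simp add: shift_def)

lemma shift_scl: "shift \<alpha> m (\<lambda>u. a * \<phi> u) = (\<lambda>u. a * shift \<alpha> m \<phi> u)"
  by (simp add: shift_def)

lemma coinduced_F_add: "coinduced_F G u \<mu> \<alpha> n (\<lambda>u. \<phi> u + \<psi> u) = coinduced_F G u \<mu> \<alpha> n \<phi> + coinduced_F G u \<mu> \<alpha> n \<psi>"
proof (induction u arbitrary: \<mu> n \<phi> \<psi>)
  case (Cons p u)
  obtain \<beta> m where "p = (\<beta>, m)" by (cases p)
  then show ?case by (simp only: coinduced_F.simps shift_add Cons.IH) (simp add: sum.distrib distrib_left)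
qed simp

lemma coinduced_F_scl: "coinduced_F G u \<mu> \<alpha> n (\<lambda>u. a * \<phi> u) = a * coinduced_F G u \<mu> \<alpha> n \<phi>"
proof (induction u arbitrary: \<mu> n \<phi>)
  case (Cons p u)
  obtain \<beta> m where "p = (\<beta>, m)" by (cases p)
  then show ?case by (simp only: coinduced_F.simps shift_scl Cons.IH) (simp add: sum_distrib_left mult.left_commute)
qed simp

lemma sum_fun_apply: "(\<Sum>i\<in>I. f i) x = (\<Sum>i\<in>I. f i x)"
  by (induction I rule: infinite_finite_induct) auto

section \<open>The minimal objects\<close>

text \<open>The highest weight vector of the coinduced module.\<close>

definition vacuum :: "'b list \<Rightarrow> 'a::zero_neq_one" where
  "vacuum u = (if u = [] then 1 else 0)"

definition vacuum_at :: "'v \<Rightarrow> 'v \<Rightarrow> (('v \<times> nat) list \<Rightarrow> 'a::zero_neq_one) set" where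
  "vacuum_at \<nu> \<mu> = (if \<mu> = \<nu> then {vacuum} else {})"

definition Smin :: "('v::real_vector, 'a::comm_ring_1) ground \<Rightarrow> 'v \<Rightarrow> ('v, 'a, ('v \<times> nat) list \<Rightarrow> 'a) gobj" where
  "Smin G \<nu> = generated G (coverma G \<nu>) (vacuum_at \<nu>)"

lemma coverma_simps [simp]:
  "scl (coverma G \<nu>) a \<phi> u = a * \<phi> u"
  "comp (coverma G \<nu>) \<mu> = Collect (supported G \<nu> \<mu>)"
  "Eact (coverma G \<nu>) \<mu> \<alpha> n \<phi> u = \<phi> ((\<alpha>, n) # u)"
  "Fact (coverma G \<nu>) \<mu> \<alpha> n \<phi> u = coinduced_F G u \<mu> \<alpha> n \<phi>"
  by (simp_all add: coverma_def)

lemma Smin_simps [simp]: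
  "scl (Smin G \<nu>) a \<phi> u = a * \<phi> u"
  "Eact (Smin G \<nu>) \<mu> \<alpha> n \<phi> u = \<phi> ((\<alpha>, n) # u)"
  "Fact (Smin G \<nu>) \<mu> \<alpha> n \<phi> u = coinduced_F G u \<mu> \<alpha> n \<phi>"
  by (simp_all add: Smin_def)

context ground_context
begin

lemma coverma_graded_module: "graded_module G (coverma G \<nu>)"
proof -
  have lin: "linear_between (scl (coverma G \<nu>)) (scl (coverma G \<nu>)) (comp (coverma G \<nu>) \<mu>) (comp (coverma G \<nu>) (up \<mu> \<alpha> n)) (Eact (coverma G \<nu>) \<mu> \<alpha> n)"
    if "n > 0" for \<mu> \<alpha> n
    using supported_shift[of G \<nu> \<mu> _ \<alpha> n] that
    by (auto simp: linear_between_def fun_eq_iff shift_def coverma_def)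
  have lin2: "linear_between (scl (coverma G \<nu>)) (scl (coverma G \<nu>)) (comp (coverma G \<nu>) (up \<mu> \<alpha> n)) (comp (coverma G \<nu>) \<mu>) (Fact (coverma G \<nu>) \<mu> \<alpha> n)"
    for \<mu> \<alpha> n
    using supported_coinduced_F[of G \<nu> \<mu> \<alpha> n]
    by (auto simp: linear_between_def fun_eq_iff coverma_def coinduced_F_scl plus_fun_def coinduced_F_add)
  have mod: "module (scl (coverma G \<nu>))"
    by unfold_locales (auto simp: fun_eq_iff algebra_simps)
  then interpret module "scl (coverma G \<nu>)" .
  have "subspace (comp (coverma G \<nu>) \<mu>)" for \<mu>
    unfolding subspace_def
  proof (intro conjI ballI allI)
    fix \<phi> \<psi> assume "\<phi> \<in> comp (coverma G \<nu>) \<mu>" "\<psi> \<in> comp (coverma G \<nu>) \<mu>"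
    moreover have "\<phi> u \<noteq> 0 \<or> \<psi> u \<noteq> 0" if "(\<phi> + \<psi>) u \<noteq> 0" for u using that by auto
    ultimately show "\<phi> + \<psi> \<in> comp (coverma G \<nu>) \<mu>" by (simp add: supported_def) metis
  qed (auto simp: supported_def)
  then show ?thesis
    using mod lin lin2 ground by unfold_locales (simp add: graded_operators_def)
qed

text \<open>The recursive equation of \<open>coinduced_F\<close> at a word with head \<open>(\<alpha>, m)\<close> is the rule itself.\<close>

lemma coverma_X2: "X2 G (coverma G \<nu>)"
  unfolding X2_def
proof (intro ballI allI impI conjI)
  fix \<mu> \<alpha> \<beta> and m n :: nat and x :: "('v \<times> nat) list \<Rightarrow> 'a"
  assume a: "\<alpha> \<in> simples G" "\<beta> \<in> simples G" "m > 0" "n > 0"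
  have E0: "E0 (coverma G \<nu>) \<mu>' \<alpha>' m' x' = shift \<alpha>' m' x'" for \<mu>' \<alpha>' m' x'
    by (simp add: E0_def shift_def fun_eq_iff)
  have F0: "F0 (coverma G \<nu>) \<mu>' \<alpha>' m' x' = (\<lambda>u. coinduced_F G u \<mu>' \<alpha>' m' x')" for \<mu>' \<alpha>' m' x'
    by (simp add: F0_def fun_eq_iff coinduced_F_0)
  show "E0 (coverma G \<nu>) \<mu> \<alpha> m (F0 (coverma G \<nu>) \<mu> \<beta> n x) =
    F0 (coverma G \<nu>) (up \<mu> \<alpha> m) \<beta> n (E0 (coverma G \<nu>) (up \<mu> \<beta> n) \<alpha> m x)" if "\<alpha> \<noteq> \<beta>"
    using a that by (simp add: E0 F0 fun_eq_iff letters_def shift_def[of \<alpha> m "\<lambda>u. coinduced_F G u \<mu> \<beta> n x"])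
  show "E0 (coverma G \<nu>) \<mu> \<alpha> m (F0 (coverma G \<nu>) \<mu> \<alpha> n x) =
    (\<Sum>r=0..min m n. scl (coverma G \<nu>) (zmap G (qbinom (dnum G \<alpha>) (\<lfloor>coroot G \<alpha> \<mu>\<rfloor> + int m + int n) r))
      (F0 (coverma G \<nu>) (up \<mu> \<alpha> m) \<alpha> (n - r) (E0 (coverma G \<nu>) (up \<mu> \<alpha> n) \<alpha> (m - r) x)))"
    using a by (simp add: E0 F0 fun_eq_iff letters_def sum_fun_apply shift_def[of \<alpha> m "\<lambda>u. coinduced_F G u \<mu> \<alpha> n x"])
qed

lemma vacuum_supported: "\<phi> \<in> vacuum_at \<nu> \<mu> \<Longrightarrow> supported G \<nu> \<mu> \<phi>"
  by (auto simp: vacuum_at_def supported_def vacuum_def split: if_splits)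

lemma vacuum_singular: "\<phi> \<in> vacuum_at \<nu> \<mu> \<Longrightarrow> singular G (coverma G \<nu>) \<mu> \<phi>"
  by (auto simp: vacuum_at_def singular_def vacuum_def fun_eq_iff split: if_splits)

lemma Smin_graded_module: "graded_module G (Smin G \<nu>)" and Smin_X2: "X2 G (Smin G \<nu>)"
  unfolding Smin_def
  using graded_module.generated_graded_module[OF coverma_graded_module coverma_X2, of "vacuum_at \<nu>" \<nu>]
    vacuum_supported vacuum_singular by auto

lemma Smin_comp: "comp (Smin G \<nu>) \<mu> = Collect (F_generated G (Smin G \<nu>) (vacuum_at \<nu>) \<mu>)"
  by (simp add: Smin_def F_generated_in_generated)

lemma Smin_supported: "\<phi> \<in> comp (Smin G \<nu>) \<mu> \<Longrightarrow> supported G \<nu> \<mu> \<phi>"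
proof -
  interpret graded_module G "coverma G \<nu>" by (rule coverma_graded_module)
  show "\<phi> \<in> comp (Smin G \<nu>) \<mu> \<Longrightarrow> supported G \<nu> \<mu> \<phi>"
    using F_generated_in_comp[of "vacuum_at \<nu>" \<mu> \<phi>] vacuum_supported by (auto simp: Smin_def)
qed

text \<open>A function killed by all \<open>E\<close> vanishes on all nonempty words, and the empty word counts only in weight
  \<open>\<nu>\<close>.\<close>

lemma Smin_singular_eq_0:
  assumes \<phi>: "\<phi> \<in> comp (Smin G \<nu>) \<mu>" and s: "singular G (Smin G \<nu>) \<mu> \<phi>" and nil: "\<mu> = \<nu> \<Longrightarrow> \<phi> [] = 0"
  shows "\<phi> = 0"
proof
  fix u
  note sup = Smin_supported[OF \<phi>]
  show "\<phi> u = 0 u"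
  proof (cases u)
    case Nil
    then show ?thesis using nil sup by (auto simp: supported_def)
  next
    case (Cons p w)
    show ?thesis
    proof (cases "p \<in> letters G")
      case True
      then have "Eact (Smin G \<nu>) \<mu> (fst p) (snd p) \<phi> = 0" using s by (auto simp: singular_def letters_def)
      then show ?thesis using Cons Smin_simps(2)[of G \<nu> \<mu> "fst p" "snd p" \<phi> w] by simp
    qed (use Cons sup in \<open>auto simp: supported_def\<close>)
  qed
qed

text \<open>The vacuum is the only basis element, and evaluation at the empty word is its coordinate form.\<close>

lemma Smin_highest_weight_basis: "highest_weight_basis G (Smin G \<nu>) (vacuum_at \<nu>) (\<lambda>_ _ \<phi>. \<phi> [])"
  unfolding highest_weight_basis_iff
proof (intro ballI conjI)
  fix \<mu> assume \<mu>: "\<mu> \<in> weights G"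
  show "finite (vacuum_at \<nu> \<mu>)" by (simp add: vacuum_at_def)
  show "vacuum_at \<nu> \<mu> \<subseteq> comp (Smin G \<nu>) \<mu>" using \<mu> by (auto simp: Smin_comp intro: F_generated.base)
  show "singular G (Smin G \<nu>) \<mu> k" if "k \<in> vacuum_at \<nu> \<mu>" for k
    using vacuum_singular[OF that] by (simp add: Smin_def singular_generated)
  show "linear_between (scl (Smin G \<nu>)) (*) (comp (Smin G \<nu>) \<mu>) UNIV (\<lambda>\<phi>. \<phi> [])"
    by (simp add: linear_between_def)
  show "\<forall>n>0. \<forall>\<phi>\<in>comp (Smin G \<nu>) (up \<mu> \<alpha> n). Fact (Smin G \<nu>) \<mu> \<alpha> n \<phi> [] = 0" for \<alpha>
    by simp
  show "k' [] = (if k' = k then 1 else 0)" if "k \<in> vacuum_at \<nu> \<mu>" "k' \<in> vacuum_at \<nu> \<mu>" for k k' :: "('v \<times> nat) list \<Rightarrow> 'a"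
    using that by (auto simp: vacuum_at_def vacuum_def split: if_splits)
  show "singular G (Smin G \<nu>) \<mu> \<phi> \<and> (\<forall>k\<in>vacuum_at \<nu> \<mu>. \<phi> [] = 0) \<longrightarrow> \<phi> = 0" if "\<phi> \<in> comp (Smin G \<nu>) \<mu>" for \<phi>
    using Smin_singular_eq_0[OF that] by (auto simp: vacuum_at_def)
  show "comp (Smin G \<nu>) \<mu> \<subseteq> Collect (F_generated G (Smin G \<nu>) (vacuum_at \<nu>) \<mu>)" by (simp add: Smin_comp)
qed

lemma nonneg_comb_weight: "set u \<subseteq> letters G \<Longrightarrow> nonneg_comb (simples G) (weight u)"
proof (induction u)
  case Nil
  then show ?case by (auto simp: nonneg_comb_def intro!: exI[of _ "\<lambda>_. 0"])
next
  case (Cons p u)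
  then show ?case using nonneg_comb_add nonneg_comb_simple by (cases p) (auto simp: letters_def)
qed

lemma Smin_wle:
  assumes "\<mu> \<in> weights G" "comp (Smin G \<nu>) \<mu> \<noteq> {0}"
  shows "wle G \<mu> \<nu>"
proof -
  interpret graded_module G "Smin G \<nu>" by (rule Smin_graded_module)
  obtain \<phi> where "\<phi> \<in> comp (Smin G \<nu>) \<mu>" "\<phi> \<noteq> 0" using assms comp_0 by blast
  then obtain u where "\<phi> u \<noteq> 0" "supported G \<nu> \<mu> \<phi>" using Smin_supported by (metis ext zero_fun_apply)
  then have "set u \<subseteq> letters G" "\<nu> - \<mu> = weight u" by (auto simp: supported_def)
  then show ?thesis using nonneg_comb_weight by (simp add: wle_def)
qed

lemma Smin_obj: "obj G (Smin G \<nu>)" and Smin_minimal: "minimal G (Smin G \<nu>)"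
proof -
  have "quasi_bounded G {\<mu> \<in> weights G. comp (Smin G \<nu>) \<mu> \<noteq> {0}}"
    using Smin_wle by (intro quasi_bounded_below) auto
  then show "obj G (Smin G \<nu>)" "minimal G (Smin G \<nu>)"
    using graded_module.highest_weight_basis_obj_minimal[OF Smin_graded_module Smin_highest_weight_basis Smin_X2] by auto
qed

text \<open>In weight \<open>\<nu>\<close> only words of weight \<open>0\<close> matter, and a nonempty word has positive weight.\<close>

lemma Smin_top:
  assumes "\<nu> \<in> weights G"
  shows "comp (Smin G \<nu>) \<nu> = range (\<lambda>a. scl (Smin G \<nu>) a vacuum)"
proof (intro subset_antisym subsetI)
  fix \<phi> assume \<phi>: "\<phi> \<in> comp (Smin G \<nu>) \<nu>"
  have "\<phi> u = 0" if "u \<noteq> []" for u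
  proof (rule ccontr)
    assume nz: "\<phi> u \<noteq> 0"
    obtain \<alpha> n w where u: "u = (\<alpha>, n) # w" using \<open>u \<noteq> []\<close> by (metis list.exhaust surj_pair)
    have l: "set u \<subseteq> letters G" and "weight u = 0" using Smin_supported[OF \<phi>] nz by (auto simp: supported_def)
    then have "real n *\<^sub>R \<alpha> + weight w = 0" by (simp add: u)
    then have "weight w = - (real n *\<^sub>R \<alpha>)" by (simp add: eq_neg_iff_add_eq_0 add.commute)
    moreover have "nonneg_comb (simples G) (weight w)" "nonneg_comb (simples G) (real n *\<^sub>R \<alpha>)"
      using nonneg_comb_weight nonneg_comb_simple l u by (auto simp: letters_def)
    ultimately have "real n *\<^sub>R \<alpha> = 0" using nonneg_comb_antisym by metis
    then show False using l u simple_neq_0 by (auto simp: letters_def)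
  qed
  then have "\<phi> = scl (Smin G \<nu>) (\<phi> []) vacuum" by (auto simp: fun_eq_iff vacuum_def)
  then show "\<phi> \<in> range (\<lambda>a. scl (Smin G \<nu>) a vacuum)" by blast
next
  fix \<phi> assume "\<phi> \<in> range (\<lambda>a. scl (Smin G \<nu>) a vacuum)"
  then show "\<phi> \<in> comp (Smin G \<nu>) \<nu>"
    using assms by (auto simp: Smin_comp vacuum_at_def intro!: F_generated.scl F_generated.base)
qed

text \<open>For indecomposability, write the vacuum as \<open>c v + d v\<close> with the summands in the two parts. Then
  \<open>c d v\<close> lies in both parts, so that \<open>c d = 0\<close>, and as the ground ring is a domain the vacuum lies in
  one of the two parts. This part is stable under \<open>F\<close>, so it is everything.\<close>

lemma Smin_is_Smin:
  assumes \<nu>: "\<nu> \<in> weights G"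
  shows "is_Smin G \<nu> (Smin G \<nu>)"
proof -
  interpret graded_module G "Smin G \<nu>" by (rule Smin_graded_module)
  let ?v = "vacuum :: ('v \<times> nat) list \<Rightarrow> 'a"
  have scl_v: "scl (Smin G \<nu>) a ?v [] = a" for a by (simp add: vacuum_def)
  have "?v \<noteq> 0" by (auto simp: vacuum_def fun_eq_iff)
  have vtop: "?v \<in> comp (Smin G \<nu>) \<nu>" using Smin_top[OF \<nu>] md.scale_one by (metis rangeI)
  have "md.span {?v} = comp (Smin G \<nu>) \<nu>" by (simp add: md.span_singleton Smin_top[OF \<nu>])
  moreover have "\<not> md.dependent {?v}"
  proof
    assume "md.dependent {?v}"
    then obtain T u where "T \<subseteq> {?v}" "(\<Sum>v\<in>T. scl (Smin G \<nu>) (u v) v) = 0" "\<exists>v\<in>T. u v \<noteq> 0"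
      unfolding md.dependent_explicit by blast
    moreover from this have "T = {?v}" by blast
    ultimately have "scl (Smin G \<nu>) (u ?v) ?v = 0" "u ?v \<noteq> 0" by auto
    then show False using scl_v[of "u ?v"] by simp
  qed
  ultimately have free: "free_of_rank (scl (Smin G \<nu>)) (comp (Smin G \<nu>) \<nu>) 1"
    unfolding free_of_rank_def by (intro exI[of _ "{?v}"]) simp
  have "indecomposable G (Smin G \<nu>)"
    unfolding indecomposable_def
  proof (intro conjI allI impI)
    show "\<not> zero_obj G (Smin G \<nu>)"
      using vtop \<open>?v \<noteq> 0\<close> \<nu> by (auto simp: zero_obj_def)
  next
    fix A B
    assume "obj G (Smin G \<nu>\<lparr>comp := A\<rparr>) \<and> obj G (Smin G \<nu>\<lparr>comp := B\<rparr>) \<and>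
      (\<forall>\<mu>\<in>weights G. comp (Smin G \<nu>) \<mu> = {a + b |a b. a \<in> A \<mu> \<and> b \<in> B \<mu>} \<and> A \<mu> \<inter> B \<mu> = {0})"
    then have A: "graded_module G (Smin G \<nu>\<lparr>comp := A\<rparr>)" and B: "graded_module G (Smin G \<nu>\<lparr>comp := B\<rparr>)"
      and AB: "\<And>\<mu>. \<mu> \<in> weights G \<Longrightarrow> comp (Smin G \<nu>) \<mu> = {a + b |a b. a \<in> A \<mu> \<and> b \<in> B \<mu>}"
      and disj: "\<And>\<mu>. \<mu> \<in> weights G \<Longrightarrow> A \<mu> \<inter> B \<mu> = {0}"
      using ground by (auto simp: obj_def intro!: graded_module.intro ground_context.intro graded_module_axioms.intro)
    have full: "comp (Smin G \<nu>) \<mu> \<subseteq> C \<mu>"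
      if C: "graded_module G (Smin G \<nu>\<lparr>comp := C\<rparr>)" and v: "?v \<in> C \<nu>" and \<mu>: "\<mu> \<in> weights G" for C \<mu>
    proof -
      interpret C: graded_module G "Smin G \<nu>\<lparr>comp := C\<rparr>" by (rule C)
      show ?thesis
        using C.F_generated_in_comp[of "vacuum_at \<nu>" \<mu>] v
        unfolding F_generated_comp_update Smin_comp by (auto simp: vacuum_at_def)
    qed
    obtain a b where ab: "?v = a + b" "a \<in> A \<nu>" "b \<in> B \<nu>" using AB[OF \<nu>] vtop by blast
    interpret A: graded_module G "Smin G \<nu>\<lparr>comp := A\<rparr>" by (rule A)
    interpret B: graded_module G "Smin G \<nu>\<lparr>comp := B\<rparr>" by (rule B)
    have A0: "0 \<in> A \<mu>" and B0: "0 \<in> B \<mu>" if "\<mu> \<in> weights G" for \<mu>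
      using A.comp_0[OF that] B.comp_0[OF that] by auto
    have "a \<in> comp (Smin G \<nu>) \<nu>" "b \<in> comp (Smin G \<nu>) \<nu>"
      using ab AB[OF \<nu>] A0[OF \<nu>] B0[OF \<nu>] by (force intro: exI[of _ 0])+
    then obtain c d where cd: "a = scl (Smin G \<nu>) c ?v" "b = scl (Smin G \<nu>) d ?v" using Smin_top[OF \<nu>] by blast
    have "scl (Smin G \<nu>) d a \<in> A \<nu>" "scl (Smin G \<nu>) c b \<in> B \<nu>"
      using A.comp_scl[OF \<nu>] B.comp_scl[OF \<nu>] ab by auto
    moreover have "scl (Smin G \<nu>) c b = scl (Smin G \<nu>) (d * c) ?v" "scl (Smin G \<nu>) d a = scl (Smin G \<nu>) (d * c) ?v"
      by (simp_all add: cd mult.commute)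
    ultimately have "scl (Smin G \<nu>) (d * c) ?v = 0" using disj[OF \<nu>] by auto
    then have "d * c = 0" using scl_v[of "d * c"] by simp
    then have "d = 0 \<or> c = 0" by simp
    then have "a = 0 \<or> b = 0" using cd md.scale_zero_left by metis
    then show "zero_obj G (Smin G \<nu>\<lparr>comp := A\<rparr>) \<or> zero_obj G (Smin G \<nu>\<lparr>comp := B\<rparr>)"
    proof
      assume "a = 0"
      then have "?v \<in> B \<nu>" using ab by simp
      then have "A \<mu> \<subseteq> B \<mu>" if "\<mu> \<in> weights G" for \<mu>
        using full[OF B _ that] AB[OF that] B0[OF that] by (force intro: exI[of _ 0])
      then have "A \<mu> = {0}" if "\<mu> \<in> weights G" for \<mu>
        using disj[OF that] that by blast
      then show ?thesis by (simp add: zero_obj_def)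
    next
      assume "b = 0"
      then have "?v \<in> A \<nu>" using ab by simp
      then have "B \<mu> \<subseteq> A \<mu>" if "\<mu> \<in> weights G" for \<mu>
        using full[OF A _ that] AB[OF that] A0[OF that] by (force intro: exI[of _ 0])
      then have "B \<mu> = {0}" if "\<mu> \<in> weights G" for \<mu>
        using disj[OF that] that by blast
      then show ?thesis by (simp add: zero_obj_def)
    qed
  qed
  then show ?thesis
    using free Smin_obj Smin_minimal Smin_wle by (simp add: is_Smin_def)
qed

end

section \<open>Minimal objects have highest weight bases\<close>

text \<open>Finitely many generators of \<open>A\<close> involve only finitely many elements of \<open>B\<close> modulo \<open>N\<close>; any further element of
  \<open>B\<close> would be dependent on these modulo \<open>N\<close>.\<close>

lemma (in module) finite_free_quotient_basis:
  assumes N: "subspace N" and T: "finite T" "span T = A" and B: "B \<subseteq> A"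
    and gen: "\<And>x. x \<in> A \<Longrightarrow> \<exists>y\<in>span B. x - y \<in> N"
    and ind: "\<And>S u b. finite S \<Longrightarrow> S \<subseteq> B \<Longrightarrow> (\<Sum>b\<in>S. u b *s b) \<in> N \<Longrightarrow> b \<in> S \<Longrightarrow> u b = 0"
    and nontriv: "(1::'a) \<noteq> 0"
  shows "finite B"
proof -
  have "\<exists>S. finite S \<and> S \<subseteq> B \<and> (\<exists>y\<in>span S. t - y \<in> N)" if t: "t \<in> T" for t
  proof -
    have "t \<in> A" using T(2) span_base[OF t] by simp
    from gen[OF this] obtain y where y: "y \<in> span B" "t - y \<in> N" ..
    then obtain S r where S: "finite S" "S \<subseteq> B" "y = (\<Sum>a\<in>S. r a *s a)" unfolding span_explicit by blast
    have "y \<in> span S" unfolding S(3) by (intro span_sum span_scale span_base)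
    then show ?thesis using S y by blast
  qed
  then obtain S where S: "\<And>t. t \<in> T \<Longrightarrow> finite (S t) \<and> S t \<subseteq> B \<and> (\<exists>y\<in>span (S t). t - y \<in> N)"
    by metis
  define U where "U = (\<Union>t\<in>T. S t)"
  have U: "finite U" "U \<subseteq> B" using S T by (auto simp: U_def)
  have sub: "subspace {y + n |y n. y \<in> span U \<and> n \<in> N}"
    unfolding subspace_def
  proof (intro conjI ballI allI)
    show "0 \<in> {y + n |y n. y \<in> span U \<and> n \<in> N}" using span_zero subspace_0[OF N] by force
  next
    fix x x' assume "x \<in> {y + n |y n. y \<in> span U \<and> n \<in> N}" "x' \<in> {y + n |y n. y \<in> span U \<and> n \<in> N}"
    then obtain y n y' n' where "x = y + n" "y \<in> span U" "n \<in> N" "x' = y' + n'" "y' \<in> span U" "n' \<in> N"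
      by blast
    moreover from this have "x + x' = (y + y') + (n + n')" by simp
    ultimately show "x + x' \<in> {y + n |y n. y \<in> span U \<and> n \<in> N}"
      using span_add subspace_add[OF N] by blast
  next
    fix c x assume "x \<in> {y + n |y n. y \<in> span U \<and> n \<in> N}"
    then show "c *s x \<in> {y + n |y n. y \<in> span U \<and> n \<in> N}"
      using span_scale subspace_scale[OF N] scale_right_distrib by blast
  qed
  have "T \<subseteq> {y + n |y n. y \<in> span U \<and> n \<in> N}"
  proof
    fix t assume t: "t \<in> T"
    then obtain y where y: "y \<in> span (S t)" "t - y \<in> N" using S by blast
    moreover have "span (S t) \<subseteq> span U" using t by (intro span_mono) (auto simp: U_def)
    moreover have "t = y + (t - y)" by simp
    ultimately show "t \<in> {y + n |y n. y \<in> span U \<and> n \<in> N}" by blast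
  qed
  then have A: "A \<subseteq> {y + n |y n. y \<in> span U \<and> n \<in> N}" using sub unfolding T(2)[symmetric] by (rule span_minimal)
  have "B \<subseteq> U"
  proof (rule ccontr)
    assume "\<not> B \<subseteq> U"
    then obtain b where b: "b \<in> B" "b \<notin> U" by blast
    then obtain y n where yn: "b = y + n" "y \<in> span U" "n \<in> N" using A B by blast
    then obtain u where y: "y = (\<Sum>a\<in>U. u a *s a)" unfolding span_finite[OF U(1)] by blast
    let ?u = "\<lambda>a. if a = b then 1 else - u a"
    have "(\<Sum>a\<in>insert b U. ?u a *s a) = b + (\<Sum>a\<in>U. ?u a *s a)" using b U by simp
    also have "(\<Sum>a\<in>U. ?u a *s a) = (\<Sum>a\<in>U. - (u a *s a))" using b by (intro sum.cong) auto
    also have "b + \<dots> = n" by (simp add: sum_negf y[symmetric] yn(1))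
    finally have "?u b = 0" using ind[of "insert b U" ?u b] U b yn(3) by simp
    then show False using nontriv by simp
  qed
  then show ?thesis using U finite_subset by blast
qed

context graded_module
begin

text \<open>Take a basis \<open>B\<close> of \<open>M\<^sub>\<mu>\<close> modulo the image of \<open>F\<^sub>\<mu>\<close>. By minimality there is for each \<open>b \<in> B\<close> an \<open>f b\<close> in the
  image with the same values under \<open>E\<^sub>\<mu>\<close>, so \<open>b - f b\<close> is singular and has the same class as \<open>b\<close>. The
  coordinate forms are the coordinates of classes with respect to \<open>B\<close>; a singular vector with zero
  coordinates lies in the image, where \<open>E\<^sub>\<mu>\<close> is injective.\<close>

lemma singular_basis_at:
  assumes M: "obj G M" "minimal G M" and \<mu>: "\<mu> \<in> weights G"
  shows "\<exists>K l. singular_basis G M \<mu> K l \<and> (\<forall>x\<in>comp M \<mu>. \<exists>y\<in>md.span K. x - y \<in> imF G M \<mu>)"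
proof -
  let ?N = "imF G M \<mu>"
  note N = imF_subspace[OF \<mu>] and NC = imF_in_comp[OF \<mu>]
  have "free_quotient (scl M) (comp M \<mu>) ?N" and inj: "inj_on (Ecol G M \<mu>) ?N"
    using M \<mu> by (auto simp: obj_def X3_def)
  then obtain B where B: "B \<subseteq> comp M \<mu>" and gen': "\<forall>x\<in>comp M \<mu>. \<exists>y\<in>md.span B. x - y \<in> ?N"
    and ind': "\<forall>T u. finite T \<and> T \<subseteq> B \<and> (\<Sum>b\<in>T. scl M (u b) b) \<in> ?N \<longrightarrow> (\<forall>b\<in>T. u b = 0)"
    unfolding free_quotient_def by (elim exE conjE)
  have gen: "\<exists>y\<in>md.span B. x - y \<in> ?N" if "x \<in> comp M \<mu>" for x using gen' that by simp
  have ind: "u b = 0" if "finite T" "T \<subseteq> B" "(\<Sum>b\<in>T. scl M (u b) b) \<in> ?N" "b \<in> T" for T u b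
    using ind' that by simp
  obtain T where "finite T" "md.span T = comp M \<mu>"
    using M \<mu> by (auto simp: obj_def X1_def finitely_generated_def)
  then have finB: "finite B"
    by (rule md.finite_free_quotient_basis[OF N _ _ B]) (use gen ind in auto)
  define c where "c x = (SOME u. x - (\<Sum>b\<in>B. scl M (u b) b) \<in> ?N)" for x
  have ex: "\<exists>u. x - (\<Sum>b\<in>B. scl M (u b) b) \<in> ?N" if "x \<in> comp M \<mu>" for x
    using gen[OF that] unfolding md.span_finite[OF finB] by auto
  have c: "x - (\<Sum>b\<in>B. scl M (c x b) b) \<in> ?N" if "x \<in> comp M \<mu>" for x
    unfolding c_def using ex[OF that] by (rule someI_ex)
  have cu: "c x b = u b" if x: "x \<in> comp M \<mu>" and u: "x - (\<Sum>b\<in>B. scl M (u b) b) \<in> ?N" and b: "b \<in> B" for x u b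
  proof -
    have "(x - (\<Sum>b\<in>B. scl M (u b) b)) - (x - (\<Sum>b\<in>B. scl M (c x b) b)) \<in> ?N"
      using md.subspace_diff[OF N u c[OF x]] .
    then have "(\<Sum>b\<in>B. scl M (c x b - u b) b) \<in> ?N"
      by (simp add: md.scale_left_diff_distrib sum_subtractf)
    then show ?thesis using ind[OF finB subset_refl, of "\<lambda>b. c x b - u b" b] b by simp
  qed
  have c_add: "c (x + y) b = c x b + c y b" if "x \<in> comp M \<mu>" "y \<in> comp M \<mu>" "b \<in> B" for x y b
  proof (rule cu)
    have "(x - (\<Sum>b\<in>B. scl M (c x b) b)) + (y - (\<Sum>b\<in>B. scl M (c y b) b)) \<in> ?N"
      using md.subspace_add[OF N c c] that by blast
    then show "x + y - (\<Sum>b\<in>B. scl M (c x b + c y b) b) \<in> ?N"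
      by (simp add: md.scale_left_distrib sum.distrib algebra_simps)
  qed (use that comp_add[OF \<mu>] in auto)
  have c_scl: "c (scl M a x) b = a * c x b" if "x \<in> comp M \<mu>" "b \<in> B" for x a b
  proof (rule cu)
    have "scl M a (x - (\<Sum>b\<in>B. scl M (c x b) b)) \<in> ?N"
      using md.subspace_scale[OF N c] that by blast
    then show "scl M a x - (\<Sum>b\<in>B. scl M (a * c x b) b) \<in> ?N"
      by (simp add: md.scale_right_diff_distrib md.scale_sum_right)
  qed (use that comp_scl[OF \<mu>] in auto)
  have c_N: "c x b = 0" if "x \<in> ?N" "b \<in> B" for x b
    by (rule cu) (use that NC in auto)
  have c_B: "c b b' = (if b = b' then 1 else 0)" if "b \<in> B" "b' \<in> B" for b b'
  proof (rule cu)
    have "(\<Sum>b'\<in>B. scl M (if b = b' then 1 else 0) b') = (\<Sum>b'\<in>B. if b = b' then b' else 0)"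
      by (intro sum.cong) auto
    then show "b - (\<Sum>b'\<in>B. scl M (if b = b' then 1 else 0) b') \<in> ?N"
      using that finB md.subspace_0[OF N] by simp
  qed (use that B in auto)
  have "\<exists>f\<in>?N. Ecol G M \<mu> b = Ecol G M \<mu> f" if "b \<in> B" for b
  proof -
    have "Ecol G M \<mu> b \<in> curly G M \<mu>"
      using M \<mu> B that by (auto simp: minimal_def angle_def)
    then show ?thesis by (auto simp: curly_def)
  qed
  then obtain f where f: "\<And>b. b \<in> B \<Longrightarrow> f b \<in> ?N \<and> Ecol G M \<mu> b = Ecol G M \<mu> (f b)" by metis
  define k where "k b = b - f b" for b
  have k: "k b \<in> comp M \<mu>" "singular G M \<mu> (k b)" "k b - b \<in> ?N" if "b \<in> B" for b
  proof -
    have "b \<in> comp M \<mu>" "f b \<in> comp M \<mu>" using that B f NC by auto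
    then show "k b \<in> comp M \<mu>" "singular G M \<mu> (k b)"
      using f[OF that] Ecol_eq_iff_singular[OF \<mu>] comp_diff[OF \<mu>] by (auto simp: k_def)
    show "k b - b \<in> ?N" using f[OF that] md.subspace_neg[OF N] by (simp add: k_def)
  qed
  have c_k: "c (k b) b' = (if b = b' then 1 else 0)" if "b \<in> B" "b' \<in> B" for b b'
  proof -
    have "b \<in> comp M \<mu>" "k b - b \<in> comp M \<mu>" using B NC k(3) that by blast+
    then have "c (b + (k b - b)) b' = c b b' + c (k b - b) b'" using that(2) by (rule c_add)
    also have "b + (k b - b) = k b" by simp
    finally show ?thesis using c_B[OF that] c_N[OF k(3)[OF that(1)] that(2)] by simp
  qed
  have inj_k: "inj_on k B"
  proof (rule inj_onI)
    fix b b' assume b: "b \<in> B" "b' \<in> B" and eq: "k b = k b'"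
    have "c (k b') b = 1" unfolding eq[symmetric] using c_k[OF b(1) b(1)] by simp
    then show "b = b'" using c_k[OF b(2) b(1)] by (metis zero_neq_one)
  qed
  define l where "l z x = c x (inv_into B k z)" for z x
  have l: "l (k b) x = c x b" if "b \<in> B" for b x using that inj_k by (simp add: l_def)
  have l_inj: "x = 0" if x: "x \<in> comp M \<mu>" "singular G M \<mu> x" and "\<And>b. b \<in> B \<Longrightarrow> c x b = 0" for x
  proof -
    have "x \<in> ?N" using c[OF x(1)] that(3) by simp
    moreover have "Ecol G M \<mu> x = Ecol G M \<mu> 0"
      using x Ecol_eq_iff_singular[OF \<mu> x(1) comp_0[OF \<mu>]] by simp
    ultimately show "x = 0" using inj md.subspace_0[OF N] by (auto dest: inj_onD)
  qed
  have k_gen: "\<exists>y\<in>md.span (k ` B). x - y \<in> ?N" if x: "x \<in> comp M \<mu>" for x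
  proof
    have "(x - (\<Sum>b\<in>B. scl M (c x b) b)) - (\<Sum>b\<in>B. scl M (c x b) (k b - b)) \<in> ?N"
    proof (rule md.subspace_diff[OF N c[OF x]], rule md.subspace_sum[OF N])
      show "scl M (c x b) (k b - b) \<in> ?N" if "b \<in> B" for b
        using md.subspace_scale[OF N k(3)[OF that]] .
    qed
    then show "x - (\<Sum>b\<in>B. scl M (c x b) (k b)) \<in> ?N"
      by (simp add: md.scale_right_diff_distrib sum_subtractf)
    show "(\<Sum>b\<in>B. scl M (c x b) (k b)) \<in> md.span (k ` B)"
      by (intro md.span_sum md.span_scale md.span_base) auto
  qed
  have "singular_basis G M \<mu> (k ` B) l"
    unfolding singular_basis_def
  proof (intro conjI ballI allI impI)
    fix z assume "z \<in> k ` B"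
    then obtain b where b: "z = k b" "b \<in> B" by blast
    show "singular G M \<mu> z" using k(2)[OF b(2)] b(1) by simp
    show "linear_between (scl M) (*) (comp M \<mu>) UNIV (l z)"
      unfolding linear_between_def b(1) l[OF b(2)]
      by (intro conjI ballI allI subset_UNIV c_add[OF _ _ b(2)] c_scl[OF _ b(2)])
    show "l z (Fact M \<mu> \<alpha> n x) = 0" if "\<alpha> \<in> simples G" "n > 0" "x \<in> comp M (up \<mu> \<alpha> n)" for \<alpha> n x
      unfolding b(1) l[OF b(2)] by (rule c_N[OF F_in_imF[OF \<mu> that] b(2)])
    show "l z z' = (if z' = z then 1 else 0)" if z': "z' \<in> k ` B" for z'
    proof -
      obtain b' where b': "z' = k b'" "b' \<in> B" using z' by blast
      show ?thesis unfolding b(1) b'(1) l[OF b(2)] c_k[OF b'(2) b(2)] inj_on_eq_iff[OF inj_k b'(2) b(2)] ..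
    qed
  next
    fix x assume x: "x \<in> comp M \<mu>" "singular G M \<mu> x \<and> (\<forall>z\<in>k ` B. l z x = 0)"
    have "l (k b) x = 0" if "b \<in> B" for b using x(2) that by blast
    then have "c x b = 0" if "b \<in> B" for b using that by (simp only: l[OF that, symmetric])
    with x show "x = 0" by (intro l_inj) auto
  qed (use finB k(1) in \<open>simp_all add: image_subset_iff\<close>)
  with k_gen show ?thesis by (intro exI[of _ "k ` B"] exI[of _ l] conjI ballI)
qed

text \<open>What is left is generation, which is a descending induction: modulo the image of \<open>F\<^sub>\<mu>\<close> an element is a
  combination of the basis, and the image comes from higher weights.\<close>

lemma minimal_has_highest_weight_basis:
  assumes M: "obj G M" "minimal G M"
  obtains K l where "highest_weight_basis G M K l"
proof -
  define Q where "Q \<mu> K l \<longleftrightarrow> singular_basis G M \<mu> K l \<and>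
      (\<forall>x\<in>comp M \<mu>. \<exists>y\<in>md.span K. x - y \<in> imF G M \<mu>)" for \<mu> K l
  have "\<exists>K l. Q \<mu> K l" if "\<mu> \<in> weights G" for \<mu>
    unfolding Q_def using M that by (rule singular_basis_at)
  then obtain K l where "\<And>\<mu>. \<mu> \<in> weights G \<Longrightarrow> Q \<mu> (K \<mu>) (l \<mu>)" by metis
  then have Kl: "singular_basis G M \<mu> (K \<mu>) (l \<mu>) \<and> (\<forall>x\<in>comp M \<mu>. \<exists>y\<in>md.span (K \<mu>). x - y \<in> imF G M \<mu>)"
    if "\<mu> \<in> weights G" for \<mu>
    using that unfolding Q_def by blast
  have "quasi_bounded G {\<mu> \<in> weights G. comp M \<mu> \<noteq> {0}}" using M by (simp add: obj_def X1_def)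
  then have gen: "comp M \<mu> \<subseteq> Collect (F_generated G M K \<mu>)" if "\<mu> \<in> weights G" for \<mu>
    using that
  proof (induction rule: quasi_bounded_induct)
    case (outside \<mu>)
    then show ?case by (auto intro: F_generated.zero)
  next
    case (step \<mu>)
    show ?case
    proof
      fix x assume "x \<in> comp M \<mu>"
      then obtain y where y: "y \<in> md.span (K \<mu>)" "x - y \<in> imF G M \<mu>" using Kl[OF step.hyps] by blast
      have "md.span (K \<mu>) \<subseteq> Collect (F_generated G M K \<mu>)"
        by (rule md.span_minimal[OF _ F_generated_subspace[OF step.hyps]]) (auto intro: F_generated.base step.hyps)
      moreover have "imF G M \<mu> \<subseteq> Collect (F_generated G M K \<mu>)"
        by (rule imF_subset[OF step.hyps F_generated_subspace[OF step.hyps]])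
          (use step in \<open>auto intro!: F_generated.act\<close>)
      ultimately have "F_generated G M K \<mu> y" "F_generated G M K \<mu> (x - y)" using y by auto
      then have "F_generated G M K \<mu> (y + (x - y))" by (rule F_generated.add)
      then show "x \<in> Collect (F_generated G M K \<mu>)" by simp
    qed
  qed
  have "highest_weight_basis G M K l" using Kl gen by (simp add: highest_weight_basis_def)
  then show thesis by (rule that)
qed

end

section \<open>Matrix coefficients\<close>

text \<open>The function \<open>u \<mapsto> h (E\<^sub>u x)\<close> on words, for \<open>x\<close> of weight \<open>\<mu>\<close> and a form \<open>h\<close> on the weight space of \<open>\<nu>\<close>. The
  current weight is carried along, and at the end of the word it decides whether \<open>h\<close> applies.\<close>

fun matrix_coeff :: "('v::real_vector, 'a::comm_ring_1) ground \<Rightarrow> ('v, 'a, 'm) gobj \<Rightarrow> 'v \<Rightarrow> ('m \<Rightarrow> 'a)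
    \<Rightarrow> 'v \<Rightarrow> 'm \<Rightarrow> ('v \<times> nat) list \<Rightarrow> 'a" where
  "matrix_coeff G M \<nu> h \<mu> x [] = (if \<mu> = \<nu> then h x else 0)"
| "matrix_coeff G M \<nu> h \<mu> x ((\<alpha>, n) # u) =
    (if (\<alpha>, n) \<in> letters G then matrix_coeff G M \<nu> h (up \<mu> \<alpha> n) (Eact M \<mu> \<alpha> n x) u else 0)"

text \<open>These are the linear forms on the quotient of \<open>M\<^sub>\<nu>\<close> by the image of \<open>F\<^sub>\<nu>\<close>. If \<open>M\<close> satisfies
  \<open>X2\<close>, they correspond to the morphisms from \<open>M\<close> to the coinduced module, by evaluation at the empty word.\<close>

definition primitive_form ::
  "('v::real_vector, 'a::comm_ring_1) ground \<Rightarrow> ('v, 'a, 'm::ab_group_add) gobj \<Rightarrow> 'v \<Rightarrow> ('m \<Rightarrow> 'a) \<Rightarrow> bool" where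
  "primitive_form G M \<nu> h \<longleftrightarrow> \<nu> \<in> weights G \<and> linear_between (scl M) (*) (comp M \<nu>) UNIV h \<and>
     (\<forall>\<alpha>\<in>simples G. \<forall>n>0. \<forall>x\<in>comp M (up \<nu> \<alpha> n). h (Fact M \<nu> \<alpha> n x) = 0)"

context graded_module
begin

lemma matrix_coeff_linear:
  assumes h: "primitive_form G M \<nu> h" and \<mu>: "\<mu> \<in> weights G"
  shows "linear_between (scl M) (*) (comp M \<mu>) UNIV (\<lambda>x. matrix_coeff G M \<nu> h \<mu> x u)"
  using \<mu>
proof (induction u arbitrary: \<mu>)
  case Nil
  then show ?case using h by (simp add: linear_between_def primitive_form_def)
next
  case (Cons p u)
  obtain \<alpha> n where p: "p = (\<alpha>, n)" by (cases p)
  show ?case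
  proof (cases "p \<in> letters G")
    case True
    then have a: "\<alpha> \<in> simples G" "n > 0" by (auto simp: p letters_def)
    have "linear_between (scl M) (*) (comp M (up \<mu> \<alpha> n)) UNIV (\<lambda>x. matrix_coeff G M \<nu> h (up \<mu> \<alpha> n) x u)"
      using Cons.IH up_weights[OF Cons.prems a(1)] .
    then show ?thesis using E_linear[OF Cons.prems a] True unfolding linear_between_def image_subset_iff
      by (simp add: p)
  qed (simp add: p linear_between_def)
qed

text \<open>Both sides satisfy the same recursion over the word: the left one by the commutation rules in \<open>M\<close>, the
  right one by definition. On the empty word both vanish, since \<open>h\<close> does so on the image of \<open>F\<^sub>\<nu>\<close>.\<close>

lemma matrix_coeff_F:
  assumes X2: "X2 G M" and h: "primitive_form G M \<nu> h"
    and "\<mu> \<in> weights G" "\<alpha> \<in> simples G" "n > 0" "x \<in> comp M (up \<mu> \<alpha> n)"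
  shows "matrix_coeff G M \<nu> h \<mu> (Fact M \<mu> \<alpha> n x) u = coinduced_F G u \<mu> \<alpha> n (matrix_coeff G M \<nu> h (up \<mu> \<alpha> n) x)"
  using assms(3-)
proof (induction u arbitrary: \<mu> n x)
  case Nil
  then show ?case using h by (auto simp: primitive_form_def)
next
  case (Cons p u)
  obtain \<beta> m where p: "p = (\<beta>, m)" by (cases p)
  have shift: "shift \<gamma> j (matrix_coeff G M \<nu> h \<kappa> y) = matrix_coeff G M \<nu> h (up \<kappa> \<gamma> j) (E0 M \<kappa> \<gamma> j y)"
    if "\<gamma> \<in> simples G" for \<gamma> j \<kappa> y
    using that by (auto simp: shift_def E0_def letters_def)
  show ?case
  proof (cases "p \<in> letters G")
    case False
    then show ?thesis using Cons.prems by (simp add: p)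
  next
    case True
    then have b: "\<beta> \<in> simples G" "m > 0" by (auto simp: p letters_def)
    have w: "up \<mu> \<beta> m \<in> weights G" "up \<mu> \<alpha> n \<in> weights G" using Cons.prems b up_weights by blast+
    show ?thesis
    proof (cases "\<beta> = \<alpha>")
      case False
      have "matrix_coeff G M \<nu> h \<mu> (Fact M \<mu> \<alpha> n x) (p # u)
          = matrix_coeff G M \<nu> h (up \<mu> \<beta> m) (Fact M (up \<mu> \<beta> m) \<alpha> n (Eact M (up \<mu> \<alpha> n) \<beta> m x)) u"
        using True X2_other[OF X2 Cons.prems(1) b(1) Cons.prems(2) b(2) Cons.prems(3,4) False] by (simp add: p)
      also have "\<dots> = coinduced_F G u (up \<mu> \<beta> m) \<alpha> n (matrix_coeff G M \<nu> h (up (up \<mu> \<beta> m) \<alpha> n) (Eact M (up \<mu> \<alpha> n) \<beta> m x))"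
        using Cons.prems b w E_in[OF w(2) b Cons.prems(4)] by (intro Cons.IH) (auto simp: up_up_commute[of \<mu> \<beta> m])
      also have "\<dots> = coinduced_F G (p # u) \<mu> \<alpha> n (matrix_coeff G M \<nu> h (up \<mu> \<alpha> n) x)"
        using True False b Cons.prems by (simp add: p shift E0_def up_up_commute[of \<mu> \<beta> m])
      finally show ?thesis .
    next
      case same: True
      let ?q = "\<lambda>r. zmap G (qbinom (dnum G \<alpha>) (\<lfloor>coroot G \<alpha> \<mu>\<rfloor> + int m + int n) r)"
      let ?y = "\<lambda>r. E0 M (up \<mu> \<alpha> n) \<alpha> (m - r) x"
      let ?z = "\<lambda>r. F0 M (up \<mu> \<alpha> m) \<alpha> (n - r) (?y r)"
      have up: "up (up \<mu> \<alpha> n) \<alpha> (m - r) = up (up \<mu> \<alpha> m) \<alpha> (n - r)" if "r \<in> {0..min m n}" for r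
        using that by (simp add: up_up add.commute)
      have y: "?y r \<in> comp M (up (up \<mu> \<alpha> m) \<alpha> (n - r))" if "r \<in> {0..min m n}" for r
        using E0_in[OF w(2) Cons.prems(2,4), of "m - r"] up[OF that] by simp
      have z: "?z r \<in> comp M (up \<mu> \<alpha> m)" if "r \<in> {0..min m n}" for r
        using F0_in[OF _ Cons.prems(2) y[OF that]] w same by simp
      have "matrix_coeff G M \<nu> h \<mu> (Fact M \<mu> \<alpha> n x) (p # u)
          = matrix_coeff G M \<nu> h (up \<mu> \<alpha> m) (\<Sum>r=0..min m n. scl M (?q r) (?z r)) u"
        using True X2_same[OF X2 Cons.prems(1,2) b(2) Cons.prems(3,4)] by (simp add: p same)
      also have "\<dots> = (\<Sum>r=0..min m n. ?q r * matrix_coeff G M \<nu> h (up \<mu> \<alpha> m) (?z r) u)"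
        using z w same
        by (intro linear_between_sum[OF matrix_coeff_linear[OF h]] md.module_axioms comp_subspace) auto
      also have "\<dots> = (\<Sum>r=0..min m n. ?q r * coinduced_F G u (up \<mu> \<alpha> m) \<alpha> (n - r)
          (matrix_coeff G M \<nu> h (up (up \<mu> \<alpha> m) \<alpha> (n - r)) (?y r)))"
      proof (intro sum.cong refl arg_cong2[where f = "(*)"])
        fix r assume r: "r \<in> {0..min m n}"
        show "matrix_coeff G M \<nu> h (up \<mu> \<alpha> m) (?z r) u
          = coinduced_F G u (up \<mu> \<alpha> m) \<alpha> (n - r) (matrix_coeff G M \<nu> h (up (up \<mu> \<alpha> m) \<alpha> (n - r)) (?y r))"
        proof (cases "n - r = 0")
          case True
          then show ?thesis by (simp only: F0_def coinduced_F_0 up_0 simp_thms if_True id_apply)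
        next
          case False
          then show ?thesis using Cons.IH[OF _ Cons.prems(2) _ y[OF r]] w same by (simp add: F0_def)
        qed
      qed
      also have "\<dots> = (\<Sum>r=0..min m n. ?q r * coinduced_F G u (up \<mu> \<alpha> m) \<alpha> (n - r)
          (shift \<alpha> (m - r) (matrix_coeff G M \<nu> h (up \<mu> \<alpha> n) x)))"
        using shift[OF Cons.prems(2)] up by (intro sum.cong refl) simp
      also have "\<dots> = coinduced_F G (p # u) \<mu> \<alpha> n (matrix_coeff G M \<nu> h (up \<mu> \<alpha> n) x)"
        using True same Cons.prems by (simp add: p)
      finally show ?thesis .
    qed
  qed
qed

lemma matrix_coeff_props:
  assumes h: "primitive_form G M \<nu> h" and \<mu>: "\<mu> \<in> weights G" and x: "x \<in> comp M \<mu>"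
  shows matrix_coeff_add: "y \<in> comp M \<mu> \<Longrightarrow> matrix_coeff G M \<nu> h \<mu> (x + y) = matrix_coeff G M \<nu> h \<mu> x + matrix_coeff G M \<nu> h \<mu> y"
    and matrix_coeff_scl: "matrix_coeff G M \<nu> h \<mu> (scl M a x) = scl (Smin G \<kappa>) a (matrix_coeff G M \<nu> h \<mu> x)"
    and matrix_coeff_0: "matrix_coeff G M \<nu> h \<mu> 0 = 0"
    and matrix_coeff_E: "\<alpha> \<in> simples G \<Longrightarrow> n > 0 \<Longrightarrow>
      matrix_coeff G M \<nu> h (up \<mu> \<alpha> n) (Eact M \<mu> \<alpha> n x) = Eact (Smin G \<kappa>) \<mu> \<alpha> n (matrix_coeff G M \<nu> h \<mu> x)"
  using matrix_coeff_linear[OF h \<mu>] x linear_between_0[OF matrix_coeff_linear[OF h \<mu>] comp_0[OF \<mu>]]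
  by (auto simp: linear_between_def fun_eq_iff letters_def)

lemma matrix_coeff_F_fun:
  assumes "X2 G M" "primitive_form G M \<nu> h"
    "\<mu> \<in> weights G" "\<alpha> \<in> simples G" "n > 0" "x \<in> comp M (up \<mu> \<alpha> n)"
  shows "matrix_coeff G M \<nu> h \<mu> (Fact M \<mu> \<alpha> n x) = Fact (Smin G \<kappa>) \<mu> \<alpha> n (matrix_coeff G M \<nu> h (up \<mu> \<alpha> n) x)"
  using matrix_coeff_F[OF assms] by (simp add: fun_eq_iff)

lemma matrix_coeff_singular:
  assumes h: "primitive_form G M \<nu> h" and \<mu>: "\<mu> \<in> weights G" and x: "x \<in> comp M \<mu>" "singular G M \<mu> x"
  shows "matrix_coeff G M \<nu> h \<mu> x = (\<lambda>u. (if \<mu> = \<nu> then h x else 0) * vacuum u)"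
proof
  fix u
  show "matrix_coeff G M \<nu> h \<mu> x u = (if \<mu> = \<nu> then h x else 0) * vacuum u"
  proof (cases u)
    case Nil
    then show ?thesis by (simp add: vacuum_def)
  next
    case (Cons p w)
    obtain \<alpha> n where p: "p = (\<alpha>, n)" by (cases p)
    have "matrix_coeff G M \<nu> h (up \<mu> \<alpha> n) 0 = 0" if "p \<in> letters G"
      using that matrix_coeff_0[OF h _ comp_0] up_weights[OF \<mu>] by (simp add: p letters_def)
    then show ?thesis using Cons x by (auto simp: p singular_def letters_def vacuum_def)
  qed
qed

lemma highest_weight_basis_props:
  assumes hw: "highest_weight_basis G M K l" and \<mu>: "\<mu> \<in> weights G"
  shows highest_weight_basis_gen: "comp M \<mu> \<subseteq> Collect (F_generated G M K \<mu>)"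
    and highest_weight_basis_finite: "finite (K \<mu>)"
    and highest_weight_basis_comp: "K \<mu> \<subseteq> comp M \<mu>"
    and highest_weight_basis_singular: "k \<in> K \<mu> \<Longrightarrow> singular G M \<mu> k"
    and highest_weight_basis_form: "k \<in> K \<mu> \<Longrightarrow> primitive_form G M \<mu> (l \<mu> k)"
    and highest_weight_basis_dual: "k \<in> K \<mu> \<Longrightarrow> k' \<in> K \<mu> \<Longrightarrow> l \<mu> k k' = (if k' = k then 1 else 0)"
    and highest_weight_basis_inj: "x \<in> comp M \<mu> \<Longrightarrow> singular G M \<mu> x \<Longrightarrow> (\<And>k. k \<in> K \<mu> \<Longrightarrow> l \<mu> k x = 0) \<Longrightarrow> x = 0"
proof -
  have sb: "singular_basis G M \<mu> (K \<mu>) (l \<mu>)" using hw \<mu> by (simp add: highest_weight_basis_def)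
  show "comp M \<mu> \<subseteq> Collect (F_generated G M K \<mu>)" using hw \<mu> by (simp add: highest_weight_basis_def)
  show "finite (K \<mu>)" "K \<mu> \<subseteq> comp M \<mu>" "k \<in> K \<mu> \<Longrightarrow> singular G M \<mu> k"
    "k \<in> K \<mu> \<Longrightarrow> k' \<in> K \<mu> \<Longrightarrow> l \<mu> k k' = (if k' = k then 1 else 0)"
    "x \<in> comp M \<mu> \<Longrightarrow> singular G M \<mu> x \<Longrightarrow> (\<And>k. k \<in> K \<mu> \<Longrightarrow> l \<mu> k x = 0) \<Longrightarrow> x = 0"
    using sb by (simp_all add: singular_basis_def)
  show "k \<in> K \<mu> \<Longrightarrow> primitive_form G M \<mu> (l \<mu> k)"
    using sb \<mu> by (simp add: singular_basis_def primitive_form_def)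
qed

lemma highest_weight_basis_nonzero: "highest_weight_basis G M K l \<Longrightarrow> \<mu> \<in> weights G \<Longrightarrow> k \<in> K \<mu> \<Longrightarrow> k \<noteq> 0"
  using highest_weight_basis_dual[of K l \<mu> k k] highest_weight_basis_form[of K l \<mu> k] linear_between_0[of "scl M" "(*)" "comp M \<mu>" UNIV "l \<mu> k"]
    comp_0 unfolding primitive_form_def by (metis zero_neq_one)

lemma matrix_coeff_basis:
  assumes hw: "highest_weight_basis G M K l" and "\<nu> \<in> weights G" "k \<in> K \<nu>" "\<mu> \<in> weights G" "k' \<in> K \<mu>"
  shows "matrix_coeff G M \<nu> (l \<nu> k) \<mu> k' = (if \<mu> = \<nu> \<and> k' = k then vacuum else 0)"
  using matrix_coeff_singular[OF highest_weight_basis_form[OF hw assms(2,3)] assms(4) subsetD[OF highest_weight_basis_comp[OF hw assms(4)] assms(5)]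
      highest_weight_basis_singular[OF hw assms(4,5)]] highest_weight_basis_dual[OF hw assms(2,3)] assms(5)
  by (auto simp: fun_eq_iff)

lemma F_generated_sub_in_comp:
  assumes hw: "highest_weight_basis G M K l" and "\<And>\<mu>. L \<mu> \<subseteq> K \<mu>" "F_generated G M L \<mu> x"
  shows "x \<in> comp M \<mu>"
  using F_generated_in_comp[OF assms(3)] highest_weight_basis_comp[OF hw] assms(2) by blast

text \<open>The coefficients for \<open>k\<close> see nothing of the submodule generated by the other basis elements; this is
  what separates the summands generated by complementary parts of a basis.\<close>

lemma matrix_coeff_complement_eq_0:
  assumes hw: "highest_weight_basis G M K l" and X2: "X2 G M" and L: "\<And>\<mu>. L \<mu> \<subseteq> K \<mu>"
    and \<nu>: "\<nu> \<in> weights G" "k \<in> K \<nu>" "k \<notin> L \<nu>" and x: "F_generated G M L \<mu> x"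
  shows "matrix_coeff G M \<nu> (l \<nu> k) \<mu> x = 0"
  using x
proof (induction rule: F_generated.induct)
  note form = highest_weight_basis_form[OF hw \<nu>(1,2)] and in_comp = F_generated_sub_in_comp[OF hw L]
  {
    case (base \<mu> x)
    then have "x \<in> K \<mu>" using L by blast
    then show ?case using matrix_coeff_basis[OF hw \<nu>(1,2) base(1)] base \<nu>(3) by auto
  next
    case (zero \<mu>)
    then show ?case using matrix_coeff_0[OF form _ comp_0] by simp
  next
    case (add \<mu> x y)
    then show ?case using matrix_coeff_add[OF form F_generated_weight[OF add(1)] in_comp[OF add(1)] in_comp[OF add(2)]] by simp
  next
    case (scl \<mu> x a)
    then show ?case using matrix_coeff_scl[OF form F_generated_weight[OF scl(1)] in_comp[OF scl(1)], of a \<nu>]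
      by (simp add: fun_eq_iff)
  next
    case (act \<mu> \<alpha> n x)
    interpret S: graded_module G "Smin G \<nu>" by (rule Smin_graded_module)
    show ?case
      unfolding matrix_coeff_F_fun[OF X2 form act(1-3) in_comp[OF act(4)], of \<nu>] act.IH
      using S.F_0[OF act(1-3) S.comp_0] up_weights[OF act(1,2)] .
  }
qed

lemma matrix_coeff_in_Smin:
  assumes hw: "highest_weight_basis G M K l" and X2: "X2 G M"
    and \<nu>: "\<nu> \<in> weights G" "k \<in> K \<nu>" and x: "F_generated G M K \<mu> x"
  shows "matrix_coeff G M \<nu> (l \<nu> k) \<mu> x \<in> comp (Smin G \<nu>) \<mu>"
  using x
proof (induction rule: F_generated.induct)
  note form = highest_weight_basis_form[OF hw \<nu>(1,2)] and in_comp = F_generated_sub_in_comp[OF hw order_refl]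
  interpret S: graded_module G "Smin G \<nu>" by (rule Smin_graded_module)
  {
    case (base \<mu> x)
    then show ?case using matrix_coeff_basis[OF hw \<nu>(1,2) base(1)] S.comp_0[OF base(1)]
      by (auto simp: Smin_comp vacuum_at_def intro: F_generated.base)
  next
    case (zero \<mu>)
    show ?case unfolding matrix_coeff_0[OF form zero comp_0[OF zero]] by (rule S.comp_0[OF zero])
  next
    case (add \<mu> x y)
    show ?case
      unfolding matrix_coeff_add[OF form F_generated_weight[OF add(1)] in_comp[OF add(1)] in_comp[OF add(2)]]
      by (rule S.comp_add[OF F_generated_weight[OF add(1)] add.IH])
  next
    case (scl \<mu> x a)
    show ?case
      unfolding matrix_coeff_scl[OF form F_generated_weight[OF scl(1)] in_comp[OF scl(1)], of a \<nu>]
      by (rule S.comp_scl[OF F_generated_weight[OF scl(1)] scl.IH])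
  next
    case (act \<mu> \<alpha> n x)
    show ?case
      unfolding matrix_coeff_F_fun[OF X2 form act(1-3) in_comp[OF act(4)], of \<nu>]
      by (rule S.F_in[OF act(1-3) act.IH])
  }
qed

lemma matrix_coeff_hom:
  assumes hw: "highest_weight_basis G M K l" and X2: "X2 G M" and \<nu>: "\<nu> \<in> weights G" "k \<in> K \<nu>"
  shows "hom G M (Smin G \<nu>) (matrix_coeff G M \<nu> (l \<nu> k))"
proof -
  note form = highest_weight_basis_form[OF hw \<nu>(1,2)]
  have "matrix_coeff G M \<nu> (l \<nu> k) \<mu> x \<in> comp (Smin G \<nu>) \<mu>" if "\<mu> \<in> weights G" "x \<in> comp M \<mu>" for \<mu> x
    using matrix_coeff_in_Smin[OF hw X2 \<nu>] highest_weight_basis_gen[OF hw that(1)] that(2) by blast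
  then show ?thesis
    unfolding hom_def linear_between_def
    using matrix_coeff_add[OF form] matrix_coeff_scl[OF form] matrix_coeff_E[OF form] matrix_coeff_F_fun[OF X2 form]
    by (auto simp only: image_subset_iff)
qed

text \<open>Descending induction: the coefficients of \<open>E\<^bsub>\<alpha>,n\<^esub> x\<close> are values of those of \<open>x\<close>, so \<open>x\<close> is singular, and its
  coordinates are the values at the empty word.\<close>

lemma matrix_coeff_joint_inj:
  assumes hw: "highest_weight_basis G M K l" and qb: "quasi_bounded G {\<mu> \<in> weights G. comp M \<mu> \<noteq> {0}}"
    and "\<mu> \<in> weights G" "x \<in> comp M \<mu>"
    and "\<And>\<nu> k. \<nu> \<in> weights G \<Longrightarrow> k \<in> K \<nu> \<Longrightarrow> matrix_coeff G M \<nu> (l \<nu> k) \<mu> x = 0"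
  shows "x = 0"
  using qb assms(3-)
proof (induction arbitrary: x rule: quasi_bounded_induct)
  case (step \<mu>)
  note form = highest_weight_basis_form[OF hw]
  have "Eact M \<mu> \<alpha> n x = 0" if a: "\<alpha> \<in> simples G" "n > 0" for \<alpha> n
  proof (rule step.IH[OF a E_in[OF step.hyps a step.prems(1)]])
    fix \<nu> k assume \<nu>: "\<nu> \<in> weights G" "k \<in> K \<nu>"
    show "matrix_coeff G M \<nu> (l \<nu> k) (up \<mu> \<alpha> n) (Eact M \<mu> \<alpha> n x) = 0"
      using matrix_coeff_E[OF form[OF \<nu>] step.hyps step.prems(1) a, of \<nu>] step.prems(2)[OF \<nu>]
      by (simp add: fun_eq_iff)
  qed
  then have "singular G M \<mu> x" by (simp add: singular_def)
  moreover have "l \<mu> k x = 0" if "k \<in> K \<mu>" for k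
    using fun_cong[OF step.prems(2)[OF step.hyps that], of "[]"] by simp
  ultimately show ?case using highest_weight_basis_inj[OF hw step.hyps step.prems(1)] by blast
qed auto

text \<open>Replace the vacuum by \<open>k\<close> in an expression of \<open>\<phi>\<close> through the operators \<open>F\<close>; the induction over this
  expression carries along that all other coefficients vanish, which makes the joint map surjective onto the direct sum.\<close>

lemma matrix_coeff_surj:
  assumes hw: "highest_weight_basis G M K l" and X2: "X2 G M"
    and \<nu>: "\<nu> \<in> weights G" "k \<in> K \<nu>" and "\<mu> \<in> weights G" "\<phi> \<in> comp (Smin G \<nu>) \<mu>"
  shows "\<exists>x\<in>comp M \<mu>. \<forall>\<nu>'\<in>weights G. \<forall>k'\<in>K \<nu>'.
    matrix_coeff G M \<nu>' (l \<nu>' k') \<mu> x = (if \<nu>' = \<nu> \<and> k' = k then \<phi> else 0)"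
proof -
  have "F_generated G (Smin G \<nu>) (vacuum_at \<nu>) \<mu> \<phi>" using assms by (simp add: Smin_comp)
  then show ?thesis
  proof (induction rule: F_generated.induct)
    note form = highest_weight_basis_form[OF hw]
    {
      case (base \<mu> \<phi>)
      then have "\<mu> = \<nu>" "\<phi> = vacuum" by (auto simp: vacuum_at_def split: if_splits)
      then show ?case
        using matrix_coeff_basis[OF hw _ _ \<nu>] highest_weight_basis_comp[OF hw \<nu>(1)] \<nu>(2) by (intro bexI[of _ k]) auto
    next
      case (zero \<mu>)
      show ?case using matrix_coeff_0[OF form zero comp_0[OF zero]] comp_0[OF zero] by (intro bexI[of _ 0]) auto
    next
      case (add \<mu> \<phi> \<psi>)
      note w = F_generated_weight[OF add(1)]
      obtain x where x: "x \<in> comp M \<mu>" "\<forall>\<nu>'\<in>weights G. \<forall>k'\<in>K \<nu>'.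
        matrix_coeff G M \<nu>' (l \<nu>' k') \<mu> x = (if \<nu>' = \<nu> \<and> k' = k then \<phi> else 0)" using add.IH(1) by blast
      obtain y where y: "y \<in> comp M \<mu>" "\<forall>\<nu>'\<in>weights G. \<forall>k'\<in>K \<nu>'.
        matrix_coeff G M \<nu>' (l \<nu>' k') \<mu> y = (if \<nu>' = \<nu> \<and> k' = k then \<psi> else 0)" using add.IH(2) by blast
      show ?case
        using matrix_coeff_add[OF form w x(1) y(1)] x y comp_add[OF w x(1) y(1)] by (intro bexI[of _ "x + y"]) auto
    next
      case (scl \<mu> \<phi> a)
      note w = F_generated_weight[OF scl(1)]
      obtain x where x: "x \<in> comp M \<mu>" "\<forall>\<nu>'\<in>weights G. \<forall>k'\<in>K \<nu>'.
        matrix_coeff G M \<nu>' (l \<nu>' k') \<mu> x = (if \<nu>' = \<nu> \<and> k' = k then \<phi> else 0)" using scl.IH by blast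
      have "scl (Smin G \<nu>) a 0 = 0" by (simp add: fun_eq_iff)
      then show ?case
        using matrix_coeff_scl[OF form w x(1), of _ _ a \<nu>] x comp_scl[OF w x(1)] by (intro bexI[of _ "scl M a x"]) auto
    next
      case (act \<mu> \<alpha> n \<phi>)
      interpret S: graded_module G "Smin G \<nu>" by (rule Smin_graded_module)
      obtain x where x: "x \<in> comp M (up \<mu> \<alpha> n)" "\<forall>\<nu>'\<in>weights G. \<forall>k'\<in>K \<nu>'.
        matrix_coeff G M \<nu>' (l \<nu>' k') (up \<mu> \<alpha> n) x = (if \<nu>' = \<nu> \<and> k' = k then \<phi> else 0)" using act.IH by blast
      have "Fact (Smin G \<nu>) \<mu> \<alpha> n 0 = 0" using S.F_0[OF act(1-3) S.comp_0] up_weights[OF act(1,2)] .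
      then show ?case
        using matrix_coeff_F_fun[OF X2 form act(1-3) x(1), of _ _ \<nu>] x F_in[OF act(1-3) x(1)]
        by (intro bexI[of _ "Fact M \<mu> \<alpha> n x"]) (auto simp del: Smin_simps)
    }
  qed
qed

lemma matrix_coeff_finite_support:
  assumes hw: "highest_weight_basis G M K l" and X2: "X2 G M" and x: "F_generated G M K \<mu> x"
  shows "finite {(\<nu>, k). \<nu> \<in> weights G \<and> k \<in> K \<nu> \<and> matrix_coeff G M \<nu> (l \<nu> k) \<mu> x \<noteq> 0}"
  using x
proof (induction rule: F_generated.induct)
  note form = highest_weight_basis_form[OF hw] and in_comp = F_generated_sub_in_comp[OF hw order_refl]
  {
    case (base \<mu> x)
    show ?case
      by (rule finite_subset[of _ "{(\<mu>, x)}"]) (use matrix_coeff_basis[OF hw _ _ base] in auto)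
  next
    case (zero \<mu>)
    show ?case
      by (rule finite_subset[of _ "{}"]) (use matrix_coeff_0[OF form zero comp_0[OF zero]] in auto)
  next
    case (add \<mu> x y)
    show ?case
      by (rule finite_subset[OF _ finite_UnI[OF add.IH]])
        (use matrix_coeff_add[OF form F_generated_weight[OF add(1)] in_comp[OF add(1)] in_comp[OF add(2)]] in auto)
  next
    case (scl \<mu> x a)
    show ?case
    proof (rule finite_subset[OF _ scl.IH], clarify)
      fix \<nu> k assume \<nu>: "\<nu> \<in> weights G" "k \<in> K \<nu>" and nz: "matrix_coeff G M \<nu> (l \<nu> k) \<mu> (scl M a x) \<noteq> 0"
        and z: "matrix_coeff G M \<nu> (l \<nu> k) \<mu> x = 0"
      have "scl (Smin G \<nu>) a 0 = 0" by (simp add: fun_eq_iff)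
      then show False
        using matrix_coeff_scl[OF form[OF \<nu>] F_generated_weight[OF scl(1)] in_comp[OF scl(1)], of a \<nu>] nz z by (simp del: Smin_simps)
    qed
  next
    case (act \<mu> \<alpha> n x)
    show ?case
    proof (rule finite_subset[OF _ act.IH], clarify)
      fix \<nu> k assume \<nu>: "\<nu> \<in> weights G" "k \<in> K \<nu>" and nz: "matrix_coeff G M \<nu> (l \<nu> k) \<mu> (Fact M \<mu> \<alpha> n x) \<noteq> 0"
        and z: "matrix_coeff G M \<nu> (l \<nu> k) (up \<mu> \<alpha> n) x = 0"
      interpret S: graded_module G "Smin G \<nu>" by (rule Smin_graded_module)
      have "Fact (Smin G \<nu>) \<mu> \<alpha> n 0 = 0" using S.F_0[OF act(1-3) S.comp_0] up_weights[OF act(1,2)] .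
      then show False
        using matrix_coeff_F_fun[OF X2 form[OF \<nu>] act(1-3) in_comp[OF act(4)], of \<nu>] nz z by (simp del: Smin_simps)
    qed
  }
qed

text \<open>A part \<open>L\<close> of a highest weight basis is one for the submodule that it generates, since the coordinates
  with respect to the rest vanish there.\<close>

lemma generated_sub_obj:
  assumes hw: "highest_weight_basis G M K l" and X2: "X2 G M" and L: "\<And>\<mu>. L \<mu> \<subseteq> K \<mu>"
    and qb: "quasi_bounded G {\<mu> \<in> weights G. comp M \<mu> \<noteq> {0}}"
  shows "obj G (generated G M L)"
proof -
  have LM: "L \<mu> \<subseteq> comp M \<mu>" "k \<in> L \<mu> \<Longrightarrow> singular G M \<mu> k" if "\<mu> \<in> weights G" for \<mu> k
    using highest_weight_basis_comp[OF hw that] highest_weight_basis_singular[OF hw that] L by blast+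
  note in_comp = F_generated_sub_in_comp[OF hw L]
  interpret A: graded_module G "generated G M L" using generated_graded_module(1)[OF X2 LM] .
  have "highest_weight_basis G (generated G M L) L l"
    unfolding highest_weight_basis_def
  proof (intro ballI conjI)
    fix \<mu> assume \<mu>: "\<mu> \<in> weights G"
    have sb: "singular_basis G M \<mu> (K \<mu>) (l \<mu>)" using hw \<mu> by (simp add: highest_weight_basis_def)
    have l0: "l \<mu> k x = 0" if "k \<in> K \<mu>" "k \<notin> L \<mu>" "F_generated G M L \<mu> x" for k x
      using fun_cong[OF matrix_coeff_complement_eq_0[OF hw X2 L \<mu> that], of "[]"] by simp
    have cmp: "comp (generated G M L) \<kappa> \<subseteq> comp M \<kappa>" for \<kappa> using in_comp by auto
    show "singular_basis G (generated G M L) \<mu> (L \<mu>) (l \<mu>)"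
      unfolding singular_basis_def singular_generated
    proof (intro conjI ballI allI impI)
      show "finite (L \<mu>)" using highest_weight_basis_finite[OF hw \<mu>] L by (rule finite_subset[rotated])
      show "L \<mu> \<subseteq> comp (generated G M L) \<mu>" using \<mu> by (auto intro: F_generated.base)
    next
      fix k assume k: "k \<in> L \<mu>"
      then have kK: "k \<in> K \<mu>" using L by blast
      show "singular G M \<mu> k" using LM \<mu> k by blast
      note form = highest_weight_basis_form[OF hw \<mu> kK]
      show "linear_between (scl (generated G M L)) (*) (comp (generated G M L) \<mu>) UNIV (l \<mu> k)"
        using form in_comp by (simp add: primitive_form_def linear_between_def)
      show "l \<mu> k (Fact (generated G M L) \<mu> \<alpha> n x) = 0"
        if "\<alpha> \<in> simples G" "n > 0" "x \<in> comp (generated G M L) (up \<mu> \<alpha> n)" for \<alpha> n x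
        using form that in_comp by (simp add: primitive_form_def)
      show "l \<mu> k k' = (if k' = k then 1 else 0)" if "k' \<in> L \<mu>" for k'
        using highest_weight_basis_dual[OF hw \<mu> kK] L that by blast
    next
      fix x assume x: "x \<in> comp (generated G M L) \<mu>" "singular G M \<mu> x \<and> (\<forall>k\<in>L \<mu>. l \<mu> k x = 0)"
      show "x = 0"
      proof (rule highest_weight_basis_inj[OF hw \<mu> subsetD[OF cmp x(1)]])
        show "l \<mu> k x = 0" if "k \<in> K \<mu>" for k using l0[OF that] x by auto
      qed (use x in simp)
    qed
    show "comp (generated G M L) \<mu> \<subseteq> Collect (F_generated G (generated G M L) L \<mu>)" by (simp add: F_generated_in_generated)
  qed
  moreover have "quasi_bounded G {\<mu> \<in> weights G. comp (generated G M L) \<mu> \<noteq> {0}}"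
    by (rule quasi_bounded_mono[OF qb]) (use in_comp A.comp_0 in fastforce)
  ultimately show ?thesis
    using A.highest_weight_basis_obj_minimal(1) generated_graded_module(2)[OF X2 LM] by blast
qed

lemma F_generated_split:
  assumes "F_generated G M K \<mu> x" and K: "\<And>\<mu>. K \<mu> \<subseteq> L \<mu> \<union> L' \<mu>"
    and LL: "\<And>\<mu>. \<mu> \<in> weights G \<Longrightarrow> L \<mu> \<union> L' \<mu> \<subseteq> comp M \<mu>"
  shows "\<exists>a b. x = a + b \<and> F_generated G M L \<mu> a \<and> F_generated G M L' \<mu> b"
  using assms(1)
proof (induction rule: F_generated.induct)
  case (base \<mu> x)
  then show ?case using K by (metis UnE add.left_neutral add.right_neutral F_generated.base F_generated.zero subsetD)
next
  case (zero \<mu>)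
  then show ?case by (metis add.left_neutral F_generated.zero)
next
  case (add \<mu> x y)
  then obtain a b a' b' where "x = a + b" "F_generated G M L \<mu> a" "F_generated G M L' \<mu> b"
    "y = a' + b'" "F_generated G M L \<mu> a'" "F_generated G M L' \<mu> b'" by blast
  moreover have "(a + b) + (a' + b') = (a + a') + (b + b')" by simp
  ultimately show ?case using F_generated.add by metis
next
  case (scl \<mu> x c)
  then obtain a b where "x = a + b" "F_generated G M L \<mu> a" "F_generated G M L' \<mu> b" by blast
  then show ?case using F_generated.scl md.scale_right_distrib by metis
next
  case (act \<mu> \<alpha> n x)
  then obtain a b where ab: "x = a + b" "F_generated G M L (up \<mu> \<alpha> n) a" "F_generated G M L' (up \<mu> \<alpha> n) b" by blast
  have "a \<in> comp M (up \<mu> \<alpha> n)" using F_generated_in_comp[OF ab(2)] LL by simp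
  moreover have "b \<in> comp M (up \<mu> \<alpha> n)" using F_generated_in_comp[OF ab(3)] LL by simp
  ultimately have "Fact M \<mu> \<alpha> n x = Fact M \<mu> \<alpha> n a + Fact M \<mu> \<alpha> n b"
    unfolding ab(1) by (rule F_add[OF act(1-3)])
  then show ?case using F_generated.act[OF act(1-3)] ab by blast
qed

end

section \<open>Bijective morphisms\<close>

lemma hom_props:
  assumes "hom G M N f" "\<mu> \<in> weights G"
  shows hom_in: "x \<in> comp M \<mu> \<Longrightarrow> f \<mu> x \<in> comp N \<mu>"
    and hom_add: "x \<in> comp M \<mu> \<Longrightarrow> y \<in> comp M \<mu> \<Longrightarrow> f \<mu> (x + y) = f \<mu> x + f \<mu> y"
    and hom_scl: "x \<in> comp M \<mu> \<Longrightarrow> f \<mu> (scl M a x) = scl N a (f \<mu> x)"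
    and hom_E: "x \<in> comp M \<mu> \<Longrightarrow> \<alpha> \<in> simples G \<Longrightarrow> n > 0 \<Longrightarrow> f (up \<mu> \<alpha> n) (Eact M \<mu> \<alpha> n x) = Eact N \<mu> \<alpha> n (f \<mu> x)"
    and hom_F: "y \<in> comp M (up \<mu> \<alpha> n) \<Longrightarrow> \<alpha> \<in> simples G \<Longrightarrow> n > 0 \<Longrightarrow> f \<mu> (Fact M \<mu> \<alpha> n y) = Fact N \<mu> \<alpha> n (f (up \<mu> \<alpha> n) y)"
  using assms unfolding hom_def linear_between_def image_subset_iff by simp_all

lemma hom_E0:
  "hom G M N f \<Longrightarrow> \<mu> \<in> weights G \<Longrightarrow> x \<in> comp M \<mu> \<Longrightarrow> \<alpha> \<in> simples G \<Longrightarrow>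
    f (up \<mu> \<alpha> n) (E0 M \<mu> \<alpha> n x) = E0 N \<mu> \<alpha> n (f \<mu> x)"
  by (simp add: E0_def hom_E)

lemma hom_F0:
  "hom G M N f \<Longrightarrow> \<mu> \<in> weights G \<Longrightarrow> x \<in> comp M (up \<mu> \<alpha> n) \<Longrightarrow> \<alpha> \<in> simples G \<Longrightarrow>
    f \<mu> (F0 M \<mu> \<alpha> n x) = F0 N \<mu> \<alpha> n (f (up \<mu> \<alpha> n) x)"
  by (simp add: F0_def hom_F)

locale two_modules = M: graded_module G M + N: graded_module G N
  for G :: "('v::real_vector, 'a::idom) ground"
    and M :: "('v, 'a, 'm::ab_group_add) gobj" and N :: "('v, 'a, 'n::ab_group_add) gobj"
begin

lemma hom_zero: "hom G M N f \<Longrightarrow> \<mu> \<in> weights G \<Longrightarrow> f \<mu> 0 = 0"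
  using linear_between_0[of "scl M" "scl N" "comp M \<mu>" "comp N \<mu>" "f \<mu>"] M.comp_0 by (simp add: hom_def)

text \<open>Morphisms commute with the operators \<open>F\<close>, so their values on generators determine them.\<close>

lemma hom_eq_on_F_generated:
  assumes f: "hom G M N f" and g: "hom G M N g"
    and K: "\<And>\<mu>. \<mu> \<in> weights G \<Longrightarrow> K \<mu> \<subseteq> comp M \<mu>"
    and eq: "\<And>\<mu> k. \<mu> \<in> weights G \<Longrightarrow> k \<in> K \<mu> \<Longrightarrow> f \<mu> k = g \<mu> k"
    and x: "F_generated G M K \<mu> x"
  shows "f \<mu> x = g \<mu> x"
  using x
proof (induction rule: F_generated.induct)
  note in_comp = M.F_generated_in_comp[OF _ K]
  {
    case (base \<mu> x)
    then show ?case by (rule eq)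
  next
    case (zero \<mu>)
    then show ?case using hom_zero f g by metis
  next
    case (add \<mu> x y)
    then show ?case
      using hom_add[OF f F_generated_weight[OF add(1)] in_comp[OF add(1)] in_comp[OF add(2)]]
        hom_add[OF g F_generated_weight[OF add(1)] in_comp[OF add(1)] in_comp[OF add(2)]] by simp
  next
    case (scl \<mu> x a)
    then show ?case
      using hom_scl[OF f F_generated_weight[OF scl(1)] in_comp[OF scl(1)]]
        hom_scl[OF g F_generated_weight[OF scl(1)] in_comp[OF scl(1)]] by simp
  next
    case (act \<mu> \<alpha> n x)
    then show ?case
      using hom_F[OF f act(1) in_comp[OF act(4)] act(2,3)] hom_F[OF g act(1) in_comp[OF act(4)] act(2,3)] by simp
  }
qed

lemma hom_bij_inverse:
  assumes f: "hom G M N f" and bij: "\<And>\<mu>. \<mu> \<in> weights G \<Longrightarrow> bij_betw (f \<mu>) (comp M \<mu>) (comp N \<mu>)"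
  obtains g where "hom G N M g"
    "\<And>\<mu> x. \<mu> \<in> weights G \<Longrightarrow> x \<in> comp M \<mu> \<Longrightarrow> g \<mu> (f \<mu> x) = x"
    "\<And>\<mu> y. \<mu> \<in> weights G \<Longrightarrow> y \<in> comp N \<mu> \<Longrightarrow> f \<mu> (g \<mu> y) = y"
proof -
  define g where "g \<mu> = inv_into (comp M \<mu>) (f \<mu>)" for \<mu>
  have gf: "g \<mu> (f \<mu> x) = x" if "\<mu> \<in> weights G" "x \<in> comp M \<mu>" for \<mu> x
    unfolding g_def using bij_betw_inv_into_left[OF bij[OF that(1)] that(2)] .
  have fg: "f \<mu> (g \<mu> y) = y" if "\<mu> \<in> weights G" "y \<in> comp N \<mu>" for \<mu> y
    unfolding g_def using bij_betw_inv_into_right[OF bij[OF that(1)] that(2)] .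
  have g_in: "g \<mu> y \<in> comp M \<mu>" if "\<mu> \<in> weights G" "y \<in> comp N \<mu>" for \<mu> y
    unfolding g_def using bij[OF that(1)] that(2) by (metis bij_betw_imp_surj_on inv_into_into)
  have "hom G N M g"
    unfolding hom_def linear_between_def
  proof (intro conjI ballI allI impI)
    fix \<mu> assume \<mu>: "\<mu> \<in> weights G"
    show "g \<mu> ` comp N \<mu> \<subseteq> comp M \<mu>" using g_in[OF \<mu>] by blast
    show "g \<mu> (x + y) = g \<mu> x + g \<mu> y" if xy: "x \<in> comp N \<mu>" "y \<in> comp N \<mu>" for x y
    proof -
      have "f \<mu> (g \<mu> x + g \<mu> y) = x + y"
        using hom_add[OF f \<mu> g_in[OF \<mu> xy(1)] g_in[OF \<mu> xy(2)]] fg[OF \<mu> xy(1)] fg[OF \<mu> xy(2)] by simp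
      then show ?thesis using gf[OF \<mu> M.comp_add[OF \<mu> g_in[OF \<mu> xy(1)] g_in[OF \<mu> xy(2)]]] by simp
    qed
    show "g \<mu> (scl N a x) = scl M a (g \<mu> x)" if x: "x \<in> comp N \<mu>" for a x
    proof -
      have "f \<mu> (scl M a (g \<mu> x)) = scl N a x"
        using hom_scl[OF f \<mu> g_in[OF \<mu> x]] fg[OF \<mu> x] by simp
      then show ?thesis using gf[OF \<mu> M.comp_scl[OF \<mu> g_in[OF \<mu> x]]] by metis
    qed
    fix \<alpha> and n :: nat assume a: "\<alpha> \<in> simples G" "0 < n"
    have w: "up \<mu> \<alpha> n \<in> weights G" using \<mu> a up_def M.up_weights by blast
    show "g (up \<mu> \<alpha> n) (Eact N \<mu> \<alpha> n x) = Eact M \<mu> \<alpha> n (g \<mu> x)" if x: "x \<in> comp N \<mu>" for x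
    proof -
      have "f (up \<mu> \<alpha> n) (Eact M \<mu> \<alpha> n (g \<mu> x)) = Eact N \<mu> \<alpha> n x"
        using hom_E[OF f \<mu> g_in[OF \<mu> x] a] fg[OF \<mu> x] by simp
      then show ?thesis using gf[OF w M.E_in[OF \<mu> a g_in[OF \<mu> x]]] by metis
    qed
    show "g \<mu> (Fact N \<mu> \<alpha> n x) = Fact M \<mu> \<alpha> n (g (up \<mu> \<alpha> n) x)" if x: "x \<in> comp N (up \<mu> \<alpha> n)" for x
    proof -
      have "f \<mu> (Fact M \<mu> \<alpha> n (g (up \<mu> \<alpha> n) x)) = Fact N \<mu> \<alpha> n x"
        using hom_F[OF f \<mu> g_in[OF w x] a] fg[OF w x] by simp
      then show ?thesis using gf[OF \<mu> M.F_in[OF \<mu> a g_in[OF w x]]] by metis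
    qed
  qed
  then show thesis using gf fg by (rule that)
qed

lemma X2_transfer:
  assumes f: "hom G M N f" and surj: "\<And>\<mu>. \<mu> \<in> weights G \<Longrightarrow> f \<mu> ` comp M \<mu> = comp N \<mu>" and X2: "X2 G M"
  shows "X2 G N"
  unfolding X2_def
proof (intro ballI allI)
  fix \<mu> \<alpha> \<beta> and m n :: nat and y
  show "0 < m \<longrightarrow> (\<forall>n>0. \<forall>y\<in>comp N (up \<mu> \<beta> n).
        (\<alpha> \<noteq> \<beta> \<longrightarrow> E0 N \<mu> \<alpha> m (F0 N \<mu> \<beta> n y) = F0 N (up \<mu> \<alpha> m) \<beta> n (E0 N (up \<mu> \<beta> n) \<alpha> m y)) \<and>
        (\<alpha> = \<beta> \<longrightarrow> E0 N \<mu> \<alpha> m (F0 N \<mu> \<alpha> n y) =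
             (\<Sum>r=0..min m n. scl N (zmap G (qbinom (dnum G \<alpha>) (\<lfloor>coroot G \<alpha> \<mu>\<rfloor> + int m + int n) r))
                  (F0 N (up \<mu> \<alpha> m) \<alpha> (n - r) (E0 N (up \<mu> \<alpha> n) \<alpha> (m - r) y)))))"
    if \<mu>: "\<mu> \<in> weights G" and \<alpha>: "\<alpha> \<in> simples G" and \<beta>: "\<beta> \<in> simples G"
  proof (intro impI allI ballI)
    fix n y assume mn: "0 < m" "0 < n" and y: "y \<in> comp N (up \<mu> \<beta> n)"
    note w = M.up_weights[OF \<mu> \<alpha>] M.up_weights[OF \<mu> \<beta>]
    obtain x where x: "x \<in> comp M (up \<mu> \<beta> n)" "y = f (up \<mu> \<beta> n) x" using surj[OF w(2)] y by blast
    have EF: "E0 N \<mu> \<alpha> m (F0 N \<mu> \<beta> n y) = f (up \<mu> \<alpha> m) (E0 M \<mu> \<alpha> m (F0 M \<mu> \<beta> n x))"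
      using hom_E0[OF f \<mu> M.F0_in[OF \<mu> \<beta> x(1)] \<alpha>] hom_F0[OF f \<mu> x(1) \<beta>] x(2) by simp
    have FE: "F0 N (up \<mu> \<alpha> m) \<beta> j (E0 N (up \<mu> \<beta> n) \<alpha> i y) = f (up \<mu> \<alpha> m) (F0 M (up \<mu> \<alpha> m) \<beta> j (E0 M (up \<mu> \<beta> n) \<alpha> i x))"
      and FE_in: "F0 M (up \<mu> \<alpha> m) \<beta> j (E0 M (up \<mu> \<beta> n) \<alpha> i x) \<in> comp M (up \<mu> \<alpha> m)"
      if "up (up \<mu> \<beta> n) \<alpha> i = up (up \<mu> \<alpha> m) \<beta> j" for i j
    proof -
      have z: "E0 M (up \<mu> \<beta> n) \<alpha> i x \<in> comp M (up (up \<mu> \<alpha> m) \<beta> j)"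
        using M.E0_in[OF w(2) \<alpha> x(1), of i] that by simp
      show "F0 M (up \<mu> \<alpha> m) \<beta> j (E0 M (up \<mu> \<beta> n) \<alpha> i x) \<in> comp M (up \<mu> \<alpha> m)"
        using M.F0_in[OF w(1) \<beta> z] .
      show "F0 N (up \<mu> \<alpha> m) \<beta> j (E0 N (up \<mu> \<beta> n) \<alpha> i y) = f (up \<mu> \<alpha> m) (F0 M (up \<mu> \<alpha> m) \<beta> j (E0 M (up \<mu> \<beta> n) \<alpha> i x))"
        using hom_F0[OF f w(1) z \<beta>] hom_E0[OF f w(2) x(1) \<alpha>, of i] x(2) that by simp
    qed
    show "(\<alpha> \<noteq> \<beta> \<longrightarrow> E0 N \<mu> \<alpha> m (F0 N \<mu> \<beta> n y) = F0 N (up \<mu> \<alpha> m) \<beta> n (E0 N (up \<mu> \<beta> n) \<alpha> m y)) \<and>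
        (\<alpha> = \<beta> \<longrightarrow> E0 N \<mu> \<alpha> m (F0 N \<mu> \<alpha> n y) =
             (\<Sum>r=0..min m n. scl N (zmap G (qbinom (dnum G \<alpha>) (\<lfloor>coroot G \<alpha> \<mu>\<rfloor> + int m + int n) r))
                  (F0 N (up \<mu> \<alpha> m) \<alpha> (n - r) (E0 N (up \<mu> \<alpha> n) \<alpha> (m - r) y))))"
    proof (intro conjI impI)
      assume "\<alpha> \<noteq> \<beta>"
      then have "E0 M \<mu> \<alpha> m (F0 M \<mu> \<beta> n x) = F0 M (up \<mu> \<alpha> m) \<beta> n (E0 M (up \<mu> \<beta> n) \<alpha> m x)"
        using M.X2_other[OF X2 \<mu> \<alpha> \<beta> mn x(1)] mn by (simp add: E0_def F0_def)
      then show "E0 N \<mu> \<alpha> m (F0 N \<mu> \<beta> n y) = F0 N (up \<mu> \<alpha> m) \<beta> n (E0 N (up \<mu> \<beta> n) \<alpha> m y)"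
        unfolding EF FE[OF up_up_commute] by simp
    next
      assume eq: "\<alpha> = \<beta>"
      have up: "up (up \<mu> \<beta> n) \<alpha> (m - r) = up (up \<mu> \<alpha> m) \<beta> (n - r)" if "r \<in> {0..min m n}" for r
        using that eq by (simp add: up_up add.commute)
      have lin: "linear_between (scl M) (scl N) (comp M (up \<mu> \<alpha> m)) (comp N (up \<mu> \<alpha> m)) (f (up \<mu> \<alpha> m))"
        using f w(1) by (simp add: hom_def)
      have E: "E0 M \<mu> \<alpha> m (F0 M \<mu> \<beta> n x) = (\<Sum>r=0..min m n.
          scl M (zmap G (qbinom (dnum G \<alpha>) (\<lfloor>coroot G \<alpha> \<mu>\<rfloor> + int m + int n) r))
                  (F0 M (up \<mu> \<alpha> m) \<beta> (n - r) (E0 M (up \<mu> \<beta> n) \<alpha> (m - r) x)))"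
        using M.X2_same[OF X2 \<mu> \<alpha> mn] x(1) mn eq by (simp add: E0_def F0_def)
      have "f (up \<mu> \<alpha> m) (E0 M \<mu> \<alpha> m (F0 M \<mu> \<beta> n x)) = (\<Sum>r=0..min m n.
          scl N (zmap G (qbinom (dnum G \<alpha>) (\<lfloor>coroot G \<alpha> \<mu>\<rfloor> + int m + int n) r))
                  (f (up \<mu> \<alpha> m) (F0 M (up \<mu> \<alpha> m) \<beta> (n - r) (E0 M (up \<mu> \<beta> n) \<alpha> (m - r) x))))"
        unfolding E by (rule linear_between_sum[OF lin M.md.module_axioms M.comp_subspace[OF w(1)]]) (rule FE_in[OF up])
      also have "\<dots> = (\<Sum>r=0..min m n.
          scl N (zmap G (qbinom (dnum G \<alpha>) (\<lfloor>coroot G \<alpha> \<mu>\<rfloor> + int m + int n) r))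
                  (F0 N (up \<mu> \<alpha> m) \<beta> (n - r) (E0 N (up \<mu> \<beta> n) \<alpha> (m - r) y)))"
        using FE[OF up] by (intro sum.cong refl) simp
      finally show "E0 N \<mu> \<alpha> m (F0 N \<mu> \<alpha> n y) = (\<Sum>r=0..min m n.
          scl N (zmap G (qbinom (dnum G \<alpha>) (\<lfloor>coroot G \<alpha> \<mu>\<rfloor> + int m + int n) r))
                  (F0 N (up \<mu> \<alpha> m) \<alpha> (n - r) (E0 N (up \<mu> \<alpha> n) \<alpha> (m - r) y)))"
        using EF eq by simp
    qed
  qed
qed

lemma hom_bij_iso:
  assumes f: "hom G M N f" and bij: "\<And>\<mu>. \<mu> \<in> weights G \<Longrightarrow> bij_betw (f \<mu>) (comp M \<mu>) (comp N \<mu>)"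
    and objs: "obj G M" "obj G N"
  shows "iso G M N"
proof -
  obtain g where "hom G N M g" "\<And>\<mu> x. \<mu> \<in> weights G \<Longrightarrow> x \<in> comp M \<mu> \<Longrightarrow> g \<mu> (f \<mu> x) = x"
    "\<And>\<mu> y. \<mu> \<in> weights G \<Longrightarrow> y \<in> comp N \<mu> \<Longrightarrow> f \<mu> (g \<mu> y) = y"
    by (rule hom_bij_inverse[OF f bij]) (assumption | rule that)+
  then show ?thesis unfolding iso_def using f objs by (intro conjI exI[of _ f] exI[of _ g]) simp_all
qed

text \<open>Everything in the criterion for minimal objects can be carried over along a bijection, in particular
  the highest weight basis and its coordinate forms; so a module isomorphic to a minimal object is an object.\<close>

lemma hom_bij_obj:
  assumes f: "hom G M N f" and bij: "\<And>\<mu>. \<mu> \<in> weights G \<Longrightarrow> bij_betw (f \<mu>) (comp M \<mu>) (comp N \<mu>)"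
    and obj: "obj G M" and hw: "highest_weight_basis G M K l"
  shows "obj G N"
proof -
  obtain g where g: "hom G N M g" and gf: "\<And>\<mu> x. \<mu> \<in> weights G \<Longrightarrow> x \<in> comp M \<mu> \<Longrightarrow> g \<mu> (f \<mu> x) = x"
    and fg: "\<And>\<mu> y. \<mu> \<in> weights G \<Longrightarrow> y \<in> comp N \<mu> \<Longrightarrow> f \<mu> (g \<mu> y) = y"
    by (rule hom_bij_inverse[OF f bij]) (assumption | rule that)+
  have surj: "f \<mu> ` comp M \<mu> = comp N \<mu>" if "\<mu> \<in> weights G" for \<mu>
    using bij[OF that] by (simp add: bij_betw_def)
  have X2: "X2 G N" using X2_transfer[OF f surj] obj by (simp add: obj_def)
  have "comp N \<mu> \<noteq> {0} \<Longrightarrow> comp M \<mu> \<noteq> {0}" if "\<mu> \<in> weights G" for \<mu>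
    using surj[OF that] hom_zero[OF f that] by auto
  then have "{\<mu> \<in> weights G. comp N \<mu> \<noteq> {0}} \<subseteq> {\<mu> \<in> weights G. comp M \<mu> \<noteq> {0}}" by blast
  then have qb: "quasi_bounded G {\<mu> \<in> weights G. comp N \<mu> \<noteq> {0}}"
    by (rule M.quasi_bounded_mono[rotated]) (use obj in \<open>simp add: X1_def obj_def\<close>)
  have gen: "F_generated G N (\<lambda>\<mu>. f \<mu> ` K \<mu>) \<mu> (f \<mu> x)" if "F_generated G M K \<mu> x" for \<mu> x
    using that
  proof (induction rule: F_generated.induct)
    note in_comp = M.F_generated_in_comp[OF _ M.highest_weight_basis_comp[OF hw]]
    {
      case (base \<mu> x)
      then show ?case by (auto intro: F_generated.base)
    next
      case (zero \<mu>)
      then show ?case using hom_zero[OF f] by (simp add: F_generated.zero)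
    next
      case (add \<mu> x y)
      then show ?case
        using hom_add[OF f F_generated_weight[OF add(1)] in_comp[OF add(1)] in_comp[OF add(2)]] by (simp add: F_generated.add)
    next
      case (scl \<mu> x a)
      then show ?case
        using hom_scl[OF f F_generated_weight[OF scl(1)] in_comp[OF scl(1)]] by (simp add: F_generated.scl)
    next
      case (act \<mu> \<alpha> n x)
      then show ?case
        using hom_F[OF f act(1) in_comp[OF act(4)] act(2,3)] by (simp add: F_generated.act)
    }
  qed
  have "highest_weight_basis G N (\<lambda>\<mu>. f \<mu> ` K \<mu>) (\<lambda>\<mu> k y. l \<mu> (g \<mu> k) (g \<mu> y))"
    unfolding highest_weight_basis_def
  proof (intro ballI conjI)
    fix \<mu> assume \<mu>: "\<mu> \<in> weights G"
    note KM = M.highest_weight_basis_comp[OF hw \<mu>]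
    show "comp N \<mu> \<subseteq> Collect (F_generated G N (\<lambda>\<mu>. f \<mu> ` K \<mu>) \<mu>)"
      unfolding surj[OF \<mu>, symmetric] image_subset_iff
      using gen subsetD[OF M.highest_weight_basis_gen[OF hw \<mu>]] by simp
    have gK: "g \<mu> z \<in> K \<mu> \<and> f \<mu> (g \<mu> z) = z" if "z \<in> f \<mu> ` K \<mu>" for z
      using that gf[OF \<mu>] KM by auto
    have sing: "singular G N \<mu> (f \<mu> x) \<longleftrightarrow> singular G M \<mu> x" if x: "x \<in> comp M \<mu>" for x
    proof -
      have "Eact N \<mu> \<alpha> n (f \<mu> x) = 0 \<longleftrightarrow> Eact M \<mu> \<alpha> n x = 0" if a: "\<alpha> \<in> simples G" "n > 0" for \<alpha> n
        using hom_E[OF f \<mu> x a] hom_zero[OF f M.up_weights[OF \<mu> a(1)]]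
          gf[OF M.up_weights[OF \<mu> a(1)] M.E_in[OF \<mu> a x]] gf[OF M.up_weights[OF \<mu> a(1)] M.comp_0[OF M.up_weights[OF \<mu> a(1)]]]
        by metis
      then show ?thesis by (simp add: singular_def)
    qed
    show "singular_basis G N \<mu> (f \<mu> ` K \<mu>) (\<lambda>k y. l \<mu> (g \<mu> k) (g \<mu> y))"
      unfolding singular_basis_def
    proof (intro conjI ballI allI impI)
      show "finite (f \<mu> ` K \<mu>)" using M.highest_weight_basis_finite[OF hw \<mu>] by simp
      show "f \<mu> ` K \<mu> \<subseteq> comp N \<mu>" using KM surj[OF \<mu>] by blast
    next
      fix z assume z: "z \<in> f \<mu> ` K \<mu>"
      have gz: "g \<mu> z \<in> K \<mu>" "f \<mu> (g \<mu> z) = z" using gK[OF z] by auto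
      show "singular G N \<mu> z" using sing[OF subsetD[OF KM gz(1)]] M.highest_weight_basis_singular[OF hw \<mu> gz(1)] gz(2) by simp
      have form: "primitive_form G M \<mu> (l \<mu> (g \<mu> z))" using M.highest_weight_basis_form[OF hw \<mu> gz(1)] .
      show "linear_between (scl N) (*) (comp N \<mu>) UNIV (\<lambda>y. l \<mu> (g \<mu> z) (g \<mu> y))"
        using form hom_in[OF g \<mu>] hom_add[OF g \<mu>] hom_scl[OF g \<mu>]
        unfolding primitive_form_def linear_between_def by simp
      show "l \<mu> (g \<mu> z) (g \<mu> (Fact N \<mu> \<alpha> n y)) = 0"
        if a: "\<alpha> \<in> simples G" "n > 0" "y \<in> comp N (up \<mu> \<alpha> n)" for \<alpha> n y
        using form a hom_F[OF g \<mu> a(3,1,2)] hom_in[OF g M.up_weights[OF \<mu> a(1)] a(3)]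
        unfolding primitive_form_def by simp
      show "l \<mu> (g \<mu> z) (g \<mu> z') = (if z' = z then 1 else 0)" if "z' \<in> f \<mu> ` K \<mu>" for z'
      proof -
        have gz': "g \<mu> z' \<in> K \<mu>" "f \<mu> (g \<mu> z') = z'" using gK[OF that] by auto
        then have "g \<mu> z' = g \<mu> z \<longleftrightarrow> z' = z" using gz by metis
        then show ?thesis using M.highest_weight_basis_dual[OF hw \<mu> gz(1) gz'(1)] by simp
      qed
    next
      fix y assume y: "y \<in> comp N \<mu>" "singular G N \<mu> y \<and> (\<forall>z\<in>f \<mu> ` K \<mu>. l \<mu> (g \<mu> z) (g \<mu> y) = 0)"
      have gy: "g \<mu> y \<in> comp M \<mu>" "f \<mu> (g \<mu> y) = y" using hom_in[OF g \<mu> y(1)] fg[OF \<mu> y(1)] by auto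
      have "g \<mu> y = 0"
      proof (rule M.highest_weight_basis_inj[OF hw \<mu> gy(1)])
        show "singular G M \<mu> (g \<mu> y)" using sing[OF gy(1)] gy(2) y(2) by simp
        fix k assume k: "k \<in> K \<mu>"
        have "l \<mu> (g \<mu> (f \<mu> k)) (g \<mu> y) = 0" using y(2) k by blast
        then show "l \<mu> k (g \<mu> y) = 0" using gf[OF \<mu>] KM k by (metis subsetD)
      qed
      then show "y = 0" using gy(2) hom_zero[OF f \<mu>] by simp
    qed
  qed
  then show ?thesis using N.highest_weight_basis_obj_minimal(1) X2 qb by blast
qed

end

section \<open>Direct sums\<close>

lemma dsum_simps [simp]:
  "scl (dsum J S) a x i = scl (S i) a (x i)"
  "x \<in> comp (dsum J S) \<mu> \<longleftrightarrow> finite {i. x i \<noteq> 0} \<and> (\<forall>i. if i \<in> J then x i \<in> comp (S i) \<mu> else x i = 0)"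
  "Eact (dsum J S) \<mu> \<alpha> n x i = (if i \<in> J then Eact (S i) \<mu> \<alpha> n (x i) else 0)"
  "Fact (dsum J S) \<mu> \<alpha> n x i = (if i \<in> J then Fact (S i) \<mu> \<alpha> n (x i) else 0)"
  by (simp_all add: dsum_def)

context ground_context
begin

lemma dsum_graded_module:
  assumes S: "\<And>i. graded_module G (S i)"
  shows "graded_module G (dsum J S)"
proof -
  have md: "module (scl (S i))" for i
    using S[of i] by (simp add: graded_module_def graded_module_axioms_def graded_operators_def)
  have mod: "module (scl (dsum J S))"
    by unfold_locales
      (auto simp: fun_eq_iff module.scale_right_distrib[OF md] module.scale_left_distrib[OF md]
        module.scale_scale[OF md] module.scale_one[OF md])
  then interpret module "scl (dsum J S)" .
  have sub: "subspace (comp (dsum J S) \<mu>)" if \<mu>: "\<mu> \<in> weights G" for \<mu>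
    unfolding subspace_def
  proof (intro conjI ballI allI)
    show "0 \<in> comp (dsum J S) \<mu>" using graded_module.comp_0[OF S \<mu>] by simp
  next
    fix x y assume xy: "x \<in> comp (dsum J S) \<mu>" "y \<in> comp (dsum J S) \<mu>"
    have "finite {i. x i + y i \<noteq> 0}"
      by (rule finite_subset[of _ "{i. x i \<noteq> 0} \<union> {i. y i \<noteq> 0}"]) (use xy in auto)
    then show "x + y \<in> comp (dsum J S) \<mu>" using xy graded_module.comp_add[OF S \<mu>] by simp
  next
    fix a x assume x: "x \<in> comp (dsum J S) \<mu>"
    have "finite {i. scl (S i) a (x i) \<noteq> 0}"
      by (rule finite_subset[of _ "{i. x i \<noteq> 0}"]) (use x module.scale_zero_right[OF md] in auto)
    then show "scl (dsum J S) a x \<in> comp (dsum J S) \<mu>"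
      using x graded_module.comp_scl[OF S \<mu>] module.scale_zero_right[OF md] by simp
  qed
  have E: "linear_between (scl (dsum J S)) (scl (dsum J S)) (comp (dsum J S) \<mu>) (comp (dsum J S) (up \<mu> \<alpha> n)) (Eact (dsum J S) \<mu> \<alpha> n)"
    and F: "linear_between (scl (dsum J S)) (scl (dsum J S)) (comp (dsum J S) (up \<mu> \<alpha> n)) (comp (dsum J S) \<mu>) (Fact (dsum J S) \<mu> \<alpha> n)"
    if a: "\<mu> \<in> weights G" "\<alpha> \<in> simples G" "n > 0" for \<mu> \<alpha> n
  proof -
    have E0: "Eact (S i) \<mu> \<alpha> n 0 = 0" and F0: "Fact (S i) \<mu> \<alpha> n 0 = 0" for i
      using graded_module.E_0[OF S a graded_module.comp_0[OF S a(1)]]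
        graded_module.F_0[OF S a graded_module.comp_0[OF S up_weights[OF a(1,2)]]] by auto
    have finE: "finite {i. (if i \<in> J then Eact (S i) \<mu> \<alpha> n (x i) else 0) \<noteq> 0}" if "finite {i. x i \<noteq> 0}" for x
      by (rule finite_subset[OF _ that]) (use E0 in \<open>auto split: if_splits\<close>)
    have finF: "finite {i. (if i \<in> J then Fact (S i) \<mu> \<alpha> n (x i) else 0) \<noteq> 0}" if "finite {i. x i \<noteq> 0}" for x
      by (rule finite_subset[OF _ that]) (use F0 in \<open>auto split: if_splits\<close>)
    show "linear_between (scl (dsum J S)) (scl (dsum J S)) (comp (dsum J S) \<mu>) (comp (dsum J S) (up \<mu> \<alpha> n)) (Eact (dsum J S) \<mu> \<alpha> n)"
      unfolding linear_between_def image_subset_iff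
      using finE graded_module.E_in[OF S a] graded_module.E_add[OF S a] graded_module.E_scl[OF S a] E0
        module.scale_zero_right[OF md]
      by (simp add: fun_eq_iff)
    show "linear_between (scl (dsum J S)) (scl (dsum J S)) (comp (dsum J S) (up \<mu> \<alpha> n)) (comp (dsum J S) \<mu>) (Fact (dsum J S) \<mu> \<alpha> n)"
      unfolding linear_between_def image_subset_iff
      using finF graded_module.F_in[OF S a] graded_module.F_add[OF S a] graded_module.F_scl[OF S a] F0
        module.scale_zero_right[OF md]
      by (simp add: fun_eq_iff)
  qed
  show ?thesis
    using mod sub E F ground by unfold_locales (simp add: graded_operators_def)
qed

end

section \<open>Morphisms between minimal objects\<close>

context ground_context
begin

lemma Smin_scalar_hom:
  "hom G (Smin G \<nu>) (Smin G \<nu>) (\<lambda>_. scl (Smin G \<nu>) a)"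
proof -
  interpret S: graded_module G "Smin G \<nu>" by (rule Smin_graded_module)
  have "scl (Smin G \<nu>) a (x + y) = scl (Smin G \<nu>) a x + scl (Smin G \<nu>) a y"
    "scl (Smin G \<nu>) a (scl (Smin G \<nu>) b x) = scl (Smin G \<nu>) b (scl (Smin G \<nu>) a x)" for b x y
    by (simp_all add: S.md.scale_right_distrib mult.commute del: Smin_simps)
  then show ?thesis
    unfolding hom_def linear_between_def image_subset_iff
    using S.comp_scl S.E_scl S.F_scl by (simp del: Smin_simps)
qed

text \<open>The image of the vacuum has weight \<open>\<nu>\<close>, so it is a multiple of the vacuum, and the vacuum generates.\<close>

lemma Smin_End:
  assumes \<nu>: "\<nu> \<in> weights G"
  shows "hom G (Smin G \<nu>) (Smin G \<nu>) f \<longleftrightarrow>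
    (\<exists>a. \<forall>\<mu>\<in>weights G. \<forall>x\<in>comp (Smin G \<nu>) \<mu>. f \<mu> x = scl (Smin G \<nu>) a x)"
proof
  interpret S: graded_module G "Smin G \<nu>" by (rule Smin_graded_module)
  interpret SS: two_modules G "Smin G \<nu>" "Smin G \<nu>" ..
  note hw = Smin_highest_weight_basis[of \<nu>]
  assume f: "hom G (Smin G \<nu>) (Smin G \<nu>) f"
  have "vacuum \<in> comp (Smin G \<nu>) \<nu>" using S.highest_weight_basis_comp[OF hw \<nu>] by (simp add: vacuum_at_def)
  then have "f \<nu> vacuum \<in> comp (Smin G \<nu>) \<nu>" by (rule hom_in[OF f \<nu>])
  then obtain a where a: "f \<nu> vacuum = scl (Smin G \<nu>) a vacuum" using Smin_top[OF \<nu>] by blast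
  have "f \<mu> x = scl (Smin G \<nu>) a x" if "\<mu> \<in> weights G" "x \<in> comp (Smin G \<nu>) \<mu>" for \<mu> x
  proof (rule SS.hom_eq_on_F_generated[OF f Smin_scalar_hom S.highest_weight_basis_comp[OF hw]])
    show "f \<mu> k = scl (Smin G \<nu>) a k" if "k \<in> vacuum_at \<nu> \<mu>" for \<mu> k
      using that a by (auto simp: vacuum_at_def split: if_splits)
    show "F_generated G (Smin G \<nu>) (vacuum_at \<nu>) \<mu> x" using that by (simp add: Smin_comp)
  qed
  then show "\<exists>a. \<forall>\<mu>\<in>weights G. \<forall>x\<in>comp (Smin G \<nu>) \<mu>. f \<mu> x = scl (Smin G \<nu>) a x" by blast
next
  interpret S: graded_module G "Smin G \<nu>" by (rule Smin_graded_module)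
  assume "\<exists>a. \<forall>\<mu>\<in>weights G. \<forall>x\<in>comp (Smin G \<nu>) \<mu>. f \<mu> x = scl (Smin G \<nu>) a x"
  then obtain a where a: "\<And>\<mu> x. \<mu> \<in> weights G \<Longrightarrow> x \<in> comp (Smin G \<nu>) \<mu> \<Longrightarrow> f \<mu> x = scl (Smin G \<nu>) a x"
    by blast
  show "hom G (Smin G \<nu>) (Smin G \<nu>) f"
    using Smin_scalar_hom[of \<nu> a] S.comp_add S.comp_scl S.E_in S.F_in up_weights
    unfolding hom_def linear_between_def image_subset_iff by (simp add: a del: Smin_simps)
qed

text \<open>The image of the vacuum is a singular vector whose weight \<open>\<nu>\<close> is not the highest weight \<open>\<kappa>\<close> of the target.\<close>

lemma Smin_Hom_eq_0:
  assumes \<nu>: "\<nu> \<in> weights G" and neq: "\<nu> \<noteq> \<kappa>"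
    and f: "hom G (Smin G \<nu>) (Smin G \<kappa>) f" and x: "\<mu> \<in> weights G" "x \<in> comp (Smin G \<nu>) \<mu>"
  shows "f \<mu> x = 0"
proof -
  interpret S: graded_module G "Smin G \<nu>" by (rule Smin_graded_module)
  interpret T: graded_module G "Smin G \<kappa>" by (rule Smin_graded_module)
  interpret ST: two_modules G "Smin G \<nu>" "Smin G \<kappa>" ..
  note hw = Smin_highest_weight_basis[of \<nu>]
  have z: "hom G (Smin G \<nu>) (Smin G \<kappa>) (\<lambda>_ _. 0)"
    using T.comp_0 T.E_0[OF _ _ _ T.comp_0] T.F_0[OF _ _ _ T.comp_0] up_weights
    unfolding hom_def linear_between_def image_subset_iff by (simp del: Smin_simps)
  have v: "vacuum \<in> comp (Smin G \<nu>) \<nu>" "singular G (Smin G \<nu>) \<nu> vacuum"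
    using S.highest_weight_basis_comp[OF hw \<nu>] S.highest_weight_basis_singular[OF hw \<nu>, of vacuum] by (simp_all add: vacuum_at_def)
  have "singular G (Smin G \<kappa>) \<nu> (f \<nu> vacuum)"
    unfolding singular_def
  proof (intro ballI allI impI)
    fix \<alpha> and n :: nat assume a: "\<alpha> \<in> simples G" "n > 0"
    have "f (up \<nu> \<alpha> n) (Eact (Smin G \<nu>) \<nu> \<alpha> n vacuum) = 0"
      using v(2) a ST.hom_zero[OF f up_weights[OF \<nu> a(1)]] unfolding singular_def by metis
    then show "Eact (Smin G \<kappa>) \<nu> \<alpha> n (f \<nu> vacuum) = 0" using hom_E[OF f \<nu> v(1) a] by metis
  qed
  then have "f \<nu> vacuum = 0" using Smin_singular_eq_0[OF hom_in[OF f \<nu> v(1)]] neq by blast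
  show ?thesis
  proof (rule ST.hom_eq_on_F_generated[OF f z S.highest_weight_basis_comp[OF hw]])
    show "f \<mu> k = 0" if "k \<in> vacuum_at \<nu> \<mu>" for \<mu> k
      using that \<open>f \<nu> vacuum = 0\<close> by (auto simp: vacuum_at_def split: if_splits)
    show "F_generated G (Smin G \<nu>) (vacuum_at \<nu>) \<mu> x" using x by (simp add: Smin_comp)
  qed
qed

end

section \<open>Decomposition and uniqueness\<close>

context graded_module
begin

text \<open>The matrix coefficients for all elements of a highest weight basis, taken together, form a bijective
  morphism to the direct sum.\<close>

lemma minimal_iso_dsum:
  assumes M: "obj G M" "minimal G M"
  obtains J :: "nat set" and wt :: "nat \<Rightarrow> 'v"
  where "\<And>i. i \<in> J \<Longrightarrow> wt i \<in> weights G" "iso G M (dsum J (\<lambda>i. Smin G (wt i)))"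
proof -
  obtain K l where hw: "highest_weight_basis G M K l" using minimal_has_highest_weight_basis[OF M] .
  have X2: "X2 G M" and qb: "quasi_bounded G {\<mu> \<in> weights G. comp M \<mu> \<noteq> {0}}"
    using M by (auto simp: obj_def X1_def)
  define I where "I = Sigma (weights G) K"
  obtain c\<^sub>1 :: "'v \<Rightarrow> nat" where c\<^sub>1: "inj_on c\<^sub>1 (weights G)" by (rule weights_inj_nat)
  have "\<exists>h::'m \<Rightarrow> nat. inj_on h (K \<mu>)" if "\<mu> \<in> weights G" for \<mu>
    using finite_imp_inj_to_nat_seg[OF highest_weight_basis_finite[OF hw that]] by blast
  then obtain c\<^sub>2 :: "'v \<Rightarrow> 'm \<Rightarrow> nat" where c\<^sub>2: "\<And>\<mu>. \<mu> \<in> weights G \<Longrightarrow> inj_on (c\<^sub>2 \<mu>) (K \<mu>)" by metis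
  (* numbering the basis elements, so that the summands are indexed by natural numbers *)
  define e where "e p = prod_encode (c\<^sub>1 (fst p), c\<^sub>2 (fst p) (snd p))" for p
  have "inj_on e I"
  proof (rule inj_onI)
    fix p q assume p: "p \<in> I" and q: "q \<in> I" and "e p = e q"
    then have eq: "c\<^sub>1 (fst p) = c\<^sub>1 (fst q)" "c\<^sub>2 (fst p) (snd p) = c\<^sub>2 (fst q) (snd q)"
      by (simp_all add: e_def prod_encode_eq)
    have w: "fst p \<in> weights G" "fst q \<in> weights G" "snd p \<in> K (fst p)" "snd q \<in> K (fst q)"
      using p q by (auto simp: I_def)
    have "fst p = fst q" using inj_onD[OF c\<^sub>1 eq(1) w(1,2)] .
    moreover from this have "snd p = snd q" using inj_onD[OF c\<^sub>2[OF w(1)], of "snd p" "snd q"] eq(2) w(3,4) by simp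
    ultimately show "p = q" by (simp add: prod_eq_iff)
  qed
  then have inv: "inv_into I e (e p) = p" if "p \<in> I" for p using that by simp
  define J where "J = e ` I"
  define wt where "wt = fst \<circ> inv_into I e"
  define b where "b = snd \<circ> inv_into I e"
  define S where "S i = Smin G (wt i)" for i
  have J: "wt i \<in> weights G \<and> b i \<in> K (wt i)" if "i \<in> J" for i
    using that inv by (auto simp: J_def wt_def b_def I_def)
  have J_inj: "i = j" if "i \<in> J" "j \<in> J" "wt i = wt j" "b i = b j" for i j
    using that inv by (auto simp: J_def wt_def b_def prod_eq_iff)
  have J_surj: "\<exists>i\<in>J. wt i = \<nu> \<and> b i = k" if "\<nu> \<in> weights G" "k \<in> K \<nu>" for \<nu> k
    using that inv[of "(\<nu>, k)"] by (intro bexI[of _ "e (\<nu>, k)"]) (auto simp: J_def wt_def b_def I_def)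
  have Sgm: "graded_module G (S i)" for i unfolding S_def by (rule Smin_graded_module)
  define c where "c i = matrix_coeff G M (wt i) (l (wt i) (b i))" for i
  define f where "f \<mu> x i = (if i \<in> J then c i \<mu> x else 0)" for \<mu> x i
  interpret D: graded_module G "dsum J S" by (rule dsum_graded_module[OF Sgm])
  interpret MD: two_modules G M "dsum J S" ..
  have c_hom: "hom G M (S i) (c i)" if "i \<in> J" for i
    unfolding c_def S_def using matrix_coeff_hom[OF hw X2] J[OF that] by blast
  have f_in: "f \<mu> x \<in> comp (dsum J S) \<mu>" if \<mu>: "\<mu> \<in> weights G" and x: "x \<in> comp M \<mu>" for \<mu> x
  proof -
    have "finite {(\<nu>, k). \<nu> \<in> weights G \<and> k \<in> K \<nu> \<and> matrix_coeff G M \<nu> (l \<nu> k) \<mu> x \<noteq> 0}"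
      using matrix_coeff_finite_support[OF hw X2] highest_weight_basis_gen[OF hw \<mu>] x by blast
    then have "finite {i \<in> J. c i \<mu> x \<noteq> 0}"
    proof (rule inj_on_finite[rotated 2])
      show "inj_on (\<lambda>i. (wt i, b i)) {i \<in> J. c i \<mu> x \<noteq> 0}" using J_inj by (auto intro: inj_onI)
      show "(\<lambda>i. (wt i, b i)) ` {i \<in> J. c i \<mu> x \<noteq> 0}
          \<subseteq> {(\<nu>, k). \<nu> \<in> weights G \<and> k \<in> K \<nu> \<and> matrix_coeff G M \<nu> (l \<nu> k) \<mu> x \<noteq> 0}"
        using J by (auto simp: c_def)
    qed
    moreover have "{i. f \<mu> x i \<noteq> 0} = {i \<in> J. c i \<mu> x \<noteq> 0}" by (auto simp: f_def)
    ultimately have "finite {i. f \<mu> x i \<noteq> 0}" by simp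
    then show ?thesis using hom_in[OF c_hom \<mu> x] by (simp add: f_def)
  qed
  have hom: "hom G M (dsum J S) f"
    unfolding hom_def linear_between_def image_subset_iff
  proof (intro conjI ballI allI impI)
    fix \<mu> assume \<mu>: "\<mu> \<in> weights G"
    show "f \<mu> x \<in> comp (dsum J S) \<mu>" if "x \<in> comp M \<mu>" for x using f_in[OF \<mu> that] .
    show "f \<mu> (x + y) = f \<mu> x + f \<mu> y" if "x \<in> comp M \<mu>" "y \<in> comp M \<mu>" for x y
      using hom_add[OF c_hom \<mu> that] by (auto simp: f_def fun_eq_iff)
    show "f \<mu> (scl M a x) = scl (dsum J S) a (f \<mu> x)" if "x \<in> comp M \<mu>" for a x
    proof
      fix i
      have "scl (S i) a 0 = 0" by (simp add: S_def fun_eq_iff)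
      then show "f \<mu> (scl M a x) i = scl (dsum J S) a (f \<mu> x) i"
        using hom_scl[OF c_hom \<mu> that] by (simp add: f_def)
    qed
    fix \<alpha> and n :: nat assume a: "\<alpha> \<in> simples G" "0 < n"
    show "f (up \<mu> \<alpha> n) (Eact M \<mu> \<alpha> n x) = Eact (dsum J S) \<mu> \<alpha> n (f \<mu> x)" if "x \<in> comp M \<mu>" for x
      using hom_E[OF c_hom \<mu> that a] by (intro ext) (simp add: f_def)
    show "f \<mu> (Fact M \<mu> \<alpha> n x) = Fact (dsum J S) \<mu> \<alpha> n (f (up \<mu> \<alpha> n) x)" if "x \<in> comp M (up \<mu> \<alpha> n)" for x
      using hom_F[OF c_hom \<mu> that a] by (intro ext) (simp add: f_def)
  qed
  have single: "\<exists>x\<in>comp M \<mu>. f \<mu> x = (\<lambda>j. if j = i then \<phi> else 0)"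
    if \<mu>: "\<mu> \<in> weights G" and i: "i \<in> J" and \<phi>: "\<phi> \<in> comp (S i) \<mu>" for \<mu> i \<phi>
  proof -
    obtain x where x: "x \<in> comp M \<mu>" "\<And>\<nu>' k'. \<nu>' \<in> weights G \<Longrightarrow> k' \<in> K \<nu>' \<Longrightarrow>
      matrix_coeff G M \<nu>' (l \<nu>' k') \<mu> x = (if \<nu>' = wt i \<and> k' = b i then \<phi> else 0)"
      using matrix_coeff_surj[OF hw X2 _ _ \<mu>, of "wt i" "b i" \<phi>] J[OF i] \<phi> unfolding S_def by blast
    have "c j \<mu> x = (if j = i then \<phi> else 0)" if "j \<in> J" for j
      unfolding c_def using x(2)[of "wt j" "b j"] J[OF that] J_inj[OF that i] by auto
    then have "f \<mu> x = (\<lambda>j. if j = i then \<phi> else 0)" using i by (auto simp: f_def fun_eq_iff)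
    then show ?thesis using x(1) by blast
  qed
  have surj: "\<exists>x\<in>comp M \<mu>. f \<mu> x = y" if \<mu>: "\<mu> \<in> weights G" and y: "y \<in> comp (dsum J S) \<mu>" for \<mu> y
  proof -
    have "\<exists>x\<in>comp M \<mu>. f \<mu> x = y" if "finite T" "{i. y i \<noteq> 0} \<subseteq> T" "y \<in> comp (dsum J S) \<mu>" for T y
      using that
    proof (induction T arbitrary: y rule: finite_induct)
      case empty
      then have "y = 0" by (auto simp: fun_eq_iff)
      then show ?case using MD.hom_zero[OF hom \<mu>] comp_0[OF \<mu>] by blast
    next
      case (insert i T)
      show ?case
      proof (cases "i \<in> J")
        case False
        then have "y i = 0" using insert.prems(2) by (simp split: if_splits) 
        then have "{j. y j \<noteq> 0} \<subseteq> T" using insert.prems(1) by blast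
        then show ?thesis using insert.prems(2) by (rule insert.IH)
      next
        case True
        let ?y = "y(i := 0)"
        have yi: "y i \<in> comp (S i) \<mu>" using insert.prems(2) True by auto
        have "finite {j. ?y j \<noteq> 0}"
          by (rule finite_subset[of _ "{j. y j \<noteq> 0}"]) (use insert.prems in auto)
        then have "?y \<in> comp (dsum J S) \<mu>"
          using insert.prems(2) graded_module.comp_0[OF Sgm \<mu>] True by auto
        moreover have "j \<in> T" if "?y j \<noteq> 0" for j
        proof -
          have "j \<noteq> i" "y j \<noteq> 0" using that by (metis fun_upd_apply)+
          then show ?thesis using insert.prems(1) by blast
        qed
        then have "{j. ?y j \<noteq> 0} \<subseteq> T" by blast
        ultimately obtain x where x: "x \<in> comp M \<mu>" "f \<mu> x = ?y" using insert.IH by blast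
        obtain z where z: "z \<in> comp M \<mu>" "f \<mu> z = (\<lambda>j. if j = i then y i else 0)"
          using single[OF \<mu> True yi] by blast
        have "f \<mu> (x + z) = y"
          unfolding hom_add[OF hom \<mu> x(1) z(1)] x(2) z(2) by (auto simp: fun_eq_iff)
        then show ?thesis using comp_add[OF \<mu> x(1) z(1)] by blast
      qed
    qed
    then show ?thesis using y by auto
  qed
  have bij: "bij_betw (f \<mu>) (comp M \<mu>) (comp (dsum J S) \<mu>)" if \<mu>: "\<mu> \<in> weights G" for \<mu>
    unfolding bij_betw_def
  proof
    show "inj_on (f \<mu>) (comp M \<mu>)"
    proof (rule inj_onI)
      fix x y assume xy: "x \<in> comp M \<mu>" "y \<in> comp M \<mu>" "f \<mu> x = f \<mu> y"
      note d = comp_diff[OF \<mu> xy(1,2)]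
      have "f \<mu> (x - y + y) = f \<mu> (x - y) + f \<mu> y" by (rule hom_add[OF hom \<mu> d xy(2)])
      then have fd: "f \<mu> (x - y) = 0" using xy(3) by simp
      have "x - y = 0"
      proof (rule matrix_coeff_joint_inj[OF hw qb \<mu> d])
        fix \<nu> k assume \<nu>: "\<nu> \<in> weights G" "k \<in> K \<nu>"
        then obtain i where i: "i \<in> J" "wt i = \<nu>" "b i = k" using J_surj by blast
        then show "matrix_coeff G M \<nu> (l \<nu> k) \<mu> (x - y) = 0"
          using fun_cong[OF fd, of i] by (simp add: f_def c_def)
      qed
      then show "x = y" by simp
    qed
    show "f \<mu> ` comp M \<mu> = comp (dsum J S) \<mu>" using f_in[OF \<mu>] surj[OF \<mu>] by blast
  qed
  have "iso G M (dsum J S)"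
    using MD.hom_bij_iso[OF hom bij M(1) MD.hom_bij_obj[OF hom bij M(1) hw]] .
  then have "iso G M (dsum J (\<lambda>i. Smin G (wt i)))" unfolding S_def[abs_def] .
  then show thesis using that J by blast
qed

text \<open>The weight \<open>\<nu>\<close> is the top one, so nothing in its weight space comes from an \<open>F\<close> and some basis
  element \<open>b\<close> must have weight \<open>\<nu>\<close>. The submodules generated by \<open>b\<close> and by the other basis elements are
  complementary objects; by indecomposability the second one vanishes.\<close>

lemma is_Smin_singleton_basis:
  assumes M: "is_Smin G \<nu> M" and \<nu>: "\<nu> \<in> weights G" and hw: "highest_weight_basis G M K l"
  obtains b where "b \<in> K \<nu>" "\<And>\<mu> k. \<mu> \<in> weights G \<Longrightarrow> k \<in> K \<mu> \<Longrightarrow> \<mu> = \<nu> \<and> k = b"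
proof -
  have X2: "X2 G M" and qb: "quasi_bounded G {\<mu> \<in> weights G. comp M \<mu> \<noteq> {0}}"
    and le: "\<And>\<mu>. \<mu> \<in> weights G \<Longrightarrow> comp M \<mu> \<noteq> {0} \<Longrightarrow> wle G \<mu> \<nu>"
    and indec: "indecomposable G M"
    using M by (auto simp: is_Smin_def obj_def X1_def)
  have "\<exists>b. b \<in> K \<nu>"
  proof (rule ccontr)
    assume no: "\<not> (\<exists>b. b \<in> K \<nu>)"
    have "imF G M \<nu> \<subseteq> {0}"
    proof (rule imF_subset[OF \<nu>])
      show "md.subspace {0}" by (simp add: md.subspace_def)
      fix \<alpha> n x assume a: "\<alpha> \<in> simples G" "(n::nat) > 0" and x: "x \<in> comp M (up \<nu> \<alpha> n)"
      have "comp M (up \<nu> \<alpha> n) = {0}" using le[OF up_weights[OF \<nu> a(1)]] not_up_wle[OF a] by blast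
      then have "x = 0" using x by simp
      then show "Fact M \<nu> \<alpha> n x \<in> {0}" using F_0[OF \<nu> a x] by simp
    qed
    moreover have "K \<nu> = {}" using no by blast
    ultimately have zero: "x = 0" if "x \<in> comp M \<nu>" for x
      using F_generated_decompose[OF highest_weight_basis_comp[OF hw], of \<nu> x] subsetD[OF highest_weight_basis_gen[OF hw \<nu>] that] by auto
    obtain B where B: "finite B" "card B = 1" "\<not> md.dependent B" "md.span B = comp M \<nu>"
      using M by (auto simp: is_Smin_def free_of_rank_def)
    obtain z where z: "B = {z}" using B(2) by (auto simp: card_1_singleton_iff)
    have "z = 0" using zero B(4) md.span_base[of z B] z by auto
    then show False using B(3) z md.dependent_zero[of B] by simp
  qed
  then obtain b where b: "b \<in> K \<nu>" by blast
  define L where "L \<mu> = (if \<mu> = \<nu> then {b} else {})" for \<mu>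
  define L' where "L' \<mu> = K \<mu> - L \<mu>" for \<mu>
  have LK: "L \<mu> \<subseteq> K \<mu>" "L' \<mu> \<subseteq> K \<mu>" for \<mu> using b by (auto simp: L_def L'_def)
  define A where "A \<mu> = Collect (F_generated G M L \<mu>)" for \<mu>
  define B where "B \<mu> = Collect (F_generated G M L' \<mu>)" for \<mu>
  have gen: "generated G M L = M\<lparr>comp := A\<rparr>" "generated G M L' = M\<lparr>comp := B\<rparr>"
    unfolding generated_def A_def[abs_def] B_def[abs_def] by (rule refl)+
  have objs: "obj G (M\<lparr>comp := A\<rparr>)" "obj G (M\<lparr>comp := B\<rparr>)"
    using generated_sub_obj[OF hw X2 LK(1) qb] generated_sub_obj[OF hw X2 LK(2) qb] unfolding gen .
  have sum: "comp M \<mu> = {x + y |x y. x \<in> A \<mu> \<and> y \<in> B \<mu>} \<and> A \<mu> \<inter> B \<mu> = {0}" if \<mu>: "\<mu> \<in> weights G" for \<mu>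
  proof
    have AB: "A \<mu> \<subseteq> comp M \<mu>" "B \<mu> \<subseteq> comp M \<mu>"
      unfolding A_def B_def using F_generated_sub_in_comp[OF hw LK(1)] F_generated_sub_in_comp[OF hw LK(2)] by auto
    show "comp M \<mu> = {x + y |x y. x \<in> A \<mu> \<and> y \<in> B \<mu>}"
    proof
      show "{x + y |x y. x \<in> A \<mu> \<and> y \<in> B \<mu>} \<subseteq> comp M \<mu>" using AB comp_add[OF \<mu>] by blast
      show "comp M \<mu> \<subseteq> {x + y |x y. x \<in> A \<mu> \<and> y \<in> B \<mu>}"
      proof
        fix x assume "x \<in> comp M \<mu>"
        then have "F_generated G M K \<mu> x" using highest_weight_basis_gen[OF hw \<mu>] by blast
        then have "\<exists>a b. x = a + b \<and> F_generated G M L \<mu> a \<and> F_generated G M L' \<mu> b"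
        proof (rule F_generated_split)
          show "K \<mu> \<subseteq> L \<mu> \<union> L' \<mu>" for \<mu> by (auto simp: L'_def)
          show "L \<mu> \<union> L' \<mu> \<subseteq> comp M \<mu>" if "\<mu> \<in> weights G" for \<mu>
            using LK[of \<mu>] highest_weight_basis_comp[OF hw that] by blast
        qed
        then show "x \<in> {x + y |x y. x \<in> A \<mu> \<and> y \<in> B \<mu>}" by (simp add: A_def B_def)
      qed
    qed
    have "x = 0" if x: "F_generated G M L \<mu> x" "F_generated G M L' \<mu> x" for x
    proof (rule matrix_coeff_joint_inj[OF hw qb \<mu> F_generated_sub_in_comp[OF hw LK(1) x(1)]])
      fix \<kappa> k assume \<kappa>: "\<kappa> \<in> weights G" "k \<in> K \<kappa>"
      show "matrix_coeff G M \<kappa> (l \<kappa> k) \<mu> x = 0"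
      proof (cases "k \<in> L \<kappa>")
        case True
        then have "k \<notin> L' \<kappa>" by (simp add: L'_def)
        then show ?thesis by (rule matrix_coeff_complement_eq_0[OF hw X2 LK(2) \<kappa> _ x(2)])
      next
        case False
        then show ?thesis by (rule matrix_coeff_complement_eq_0[OF hw X2 LK(1) \<kappa> _ x(1)])
      qed
    qed
    then show "A \<mu> \<inter> B \<mu> = {0}" using \<mu> by (auto simp: A_def B_def intro: F_generated.zero)
  qed
  have "zero_obj G (M\<lparr>comp := A\<rparr>) \<or> zero_obj G (M\<lparr>comp := B\<rparr>)"
    using indec objs sum unfolding indecomposable_def by blast
  moreover have "b \<in> A \<nu>" using \<nu> by (auto simp: A_def L_def intro: F_generated.base)
  then have "\<not> zero_obj G (M\<lparr>comp := A\<rparr>)" using \<nu> highest_weight_basis_nonzero[OF hw \<nu> b] by (auto simp: zero_obj_def)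
  ultimately have "zero_obj G (M\<lparr>comp := B\<rparr>)" by blast
  then have B0: "B \<mu> = {0}" if "\<mu> \<in> weights G" for \<mu> using that by (simp add: zero_obj_def)
  have "\<mu> = \<nu> \<and> k = b" if "\<mu> \<in> weights G" "k \<in> K \<mu>" for \<mu> k
  proof (rule ccontr)
    assume "\<not> (\<mu> = \<nu> \<and> k = b)"
    then have "k \<in> L' \<mu>" using that by (auto simp: L'_def L_def)
    then have "k \<in> B \<mu>" using that(1) by (simp add: B_def F_generated.base)
    then show False using B0[OF that(1)] highest_weight_basis_nonzero[OF hw that] by simp
  qed
  then show thesis using b that by blast
qed

text \<open>With a single basis element the matrix coefficients for its coordinate form are an isomorphism already.\<close>

lemma is_Smin_iso:
  assumes M: "is_Smin G \<nu> M" and \<nu>: "\<nu> \<in> weights G"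
  shows "iso G M (Smin G \<nu>)"
proof -
  have obj: "obj G M" and min: "minimal G M" using M by (auto simp: is_Smin_def)
  have X2: "X2 G M" and qb: "quasi_bounded G {\<mu> \<in> weights G. comp M \<mu> \<noteq> {0}}"
    using obj by (auto simp: obj_def X1_def)
  obtain K l where hw: "highest_weight_basis G M K l" using minimal_has_highest_weight_basis[OF obj min] .
  obtain b where b: "b \<in> K \<nu>" and K: "\<And>\<mu> k. \<mu> \<in> weights G \<Longrightarrow> k \<in> K \<mu> \<Longrightarrow> \<mu> = \<nu> \<and> k = b"
    using is_Smin_singleton_basis[OF M \<nu> hw] by metis
  define f where "f = matrix_coeff G M \<nu> (l \<nu> b)"
  have f: "hom G M (Smin G \<nu>) f" unfolding f_def by (rule matrix_coeff_hom[OF hw X2 \<nu> b])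
  interpret S: graded_module G "Smin G \<nu>" by (rule Smin_graded_module)
  interpret MS: two_modules G M "Smin G \<nu>" ..
  have "bij_betw (f \<mu>) (comp M \<mu>) (comp (Smin G \<nu>) \<mu>)" if \<mu>: "\<mu> \<in> weights G" for \<mu>
    unfolding bij_betw_def
  proof
    show "inj_on (f \<mu>) (comp M \<mu>)"
    proof (rule inj_onI)
      fix x y assume xy: "x \<in> comp M \<mu>" "y \<in> comp M \<mu>" "f \<mu> x = f \<mu> y"
      note d = comp_diff[OF \<mu> xy(1,2)]
      have "f \<mu> (x - y + y) = f \<mu> (x - y) + f \<mu> y" by (rule hom_add[OF f \<mu> d xy(2)])
      then have fd: "f \<mu> (x - y) = 0" using xy(3) by simp
      have "x - y = 0"
      proof (rule matrix_coeff_joint_inj[OF hw qb \<mu> d])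
        fix \<kappa> k assume \<kappa>: "\<kappa> \<in> weights G" "k \<in> K \<kappa>"
        show "matrix_coeff G M \<kappa> (l \<kappa> k) \<mu> (x - y) = 0" using K[OF \<kappa>] fd unfolding f_def by simp
      qed
      then show "x = y" by simp
    qed
    have "\<exists>x\<in>comp M \<mu>. f \<mu> x = \<phi>" if \<phi>: "\<phi> \<in> comp (Smin G \<nu>) \<mu>" for \<phi>
    proof -
      obtain x where "x \<in> comp M \<mu>" and x: "\<forall>\<nu>'\<in>weights G. \<forall>k'\<in>K \<nu>'.
        matrix_coeff G M \<nu>' (l \<nu>' k') \<mu> x = (if \<nu>' = \<nu> \<and> k' = b then \<phi> else 0)"
        using matrix_coeff_surj[OF hw X2 \<nu> b \<mu> \<phi>] by (elim bexE)
      moreover have "f \<mu> x = \<phi>" unfolding f_def using bspec[OF bspec[OF x \<nu>] b] by simp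
      ultimately show ?thesis by blast
    qed
    then show "f \<mu> ` comp M \<mu> = comp (Smin G \<nu>) \<mu>" using hom_in[OF f \<mu>] by blast
  qed
  then show ?thesis using MS.hom_bij_iso[OF f] obj Smin_obj by blast
qed

end

theorem proposition4p3:
  fixes G :: "('v::real_vector, 'a::idom) ground"
  assumes "ground_data G"
    and "noetherian TYPE('a)"
  shows "\<exists>Smin :: 'v \<Rightarrow> ('v, 'a, ('v \<times> nat) list \<Rightarrow> 'a) gobj.
    (\<forall>\<nu>\<in>weights G. is_Smin G \<nu> (Smin \<nu>) \<and>
       (\<forall>N :: ('v, 'a, 'm::ab_group_add) gobj. is_Smin G \<nu> N \<longrightarrow> iso G N (Smin \<nu>))) \<and>
    (\<forall>\<nu>\<in>weights G. \<forall>f. hom G (Smin \<nu>) (Smin \<nu>) f \<longleftrightarrow>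
       (\<exists>a. \<forall>\<mu>\<in>weights G. \<forall>x\<in>comp (Smin \<nu>) \<mu>. f \<mu> x = scl (Smin \<nu>) a x)) \<and>
    (\<forall>\<nu>\<in>weights G. \<forall>\<kappa>\<in>weights G. \<nu> \<noteq> \<kappa> \<longrightarrow>
       (\<forall>f. hom G (Smin \<nu>) (Smin \<kappa>) f \<longrightarrow>
          (\<forall>\<mu>\<in>weights G. \<forall>x\<in>comp (Smin \<nu>) \<mu>. f \<mu> x = 0))) \<and>
    (\<forall>S :: ('v, 'a, 'm) gobj. obj G S \<and> minimal G S \<longrightarrow>
       (\<exists>(J :: nat set) (l :: nat \<Rightarrow> 'v).
          (\<forall>i\<in>J. l i \<in> weights G) \<and> iso G S (dsum J (\<lambda>i. Smin (l i)))))"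
proof -
  interpret ground_context G using assms(1) by unfold_locales
  have gm: "graded_module G N" if "obj G N" for N :: "('v, 'a, 'm) gobj"
    using that by unfold_locales (simp add: obj_def)
  have iso: "iso G N (Smin G \<nu>)" if "\<nu> \<in> weights G" "is_Smin G \<nu> N" for \<nu> and N :: "('v, 'a, 'm) gobj"
    using graded_module.is_Smin_iso[OF gm that(2,1)] that(2) by (simp add: is_Smin_def)
  have dec: "\<exists>(J :: nat set) (l :: nat \<Rightarrow> 'v). (\<forall>i\<in>J. l i \<in> weights G) \<and> iso G S (dsum J (\<lambda>i. Smin G (l i)))"
    if S: "obj G S" "minimal G S" for S :: "('v, 'a, 'm) gobj"
  proof -
    obtain J :: "nat set" and l :: "nat \<Rightarrow> 'v" where "\<And>i. i \<in> J \<Longrightarrow> l i \<in> weights G"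
      "iso G S (dsum J (\<lambda>i. Smin G (l i)))"
      by (rule graded_module.minimal_iso_dsum[OF gm[OF S(1)] S]) (rule that)
    then show ?thesis by (intro exI[of _ J] exI[of _ l]) simp
  qed
  show ?thesis
    by (rule exI[of _ "Smin G"])
      (intro conjI ballI allI impI Smin_is_Smin iso Smin_End Smin_Hom_eq_0; (elim conjE)?; (rule dec | assumption))
qed

end
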